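(* Let $a \ge 0$ and $b > 0$. If $N \ge 5$ and \[ a^{N-4}\, b^2 > \frac{4\,(N-4)^{N-4}}{(N-2)^{N-2}}\, S^{-N}, \] then the problem \[ \left\{\begin{aligned} - \left[a + b \int_\Omega |\nabla u|^2\, dx\right] \Delta u & = \lambda u + |u|^{2^*-2}\, u && \text{in } \Omega\\ u & = 0 && \text{on } \partial\Omega \end{aligned}\right. \] has two nontrivial weak solutions for $\lambda \ge a\lambda_1$.
   Context: $\Omega$ is a bounded domain in $\mathbb{R}^N$ and $2^* = 2N/(N-2)$. $\lambda_1 > 0$ is the first Dirichlet eigenvalue of $-\Delta$ in $\Omega$. The best Sobolev constant is $S = \inf_{u \in H^1_0(\Omega) \setminus \{0\}} \int_\Omega |\nabla u|^2\, dx \big/ \left(\int_\Omega |u|^{2^*} dx\right)^{2/2^*}$. A (weak) solution is a function $u \in H^1_0(\Omega)$ such that $\left[a + b \int_\Omega |\nabla u|^2\, dx\right] \int_\Omega \nabla u \cdot \nabla v\, dx = \lambda \int_\Omega uv\, dx + \int_\Omega |u|^{2^*-2} uv\, dx$ for all $v \in H^1_0(\Omega)$; it is nontrivial if $u \neq 0$. "Two nontrivial solutions" means at least two distinct nontrivial solutions. *)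

theory Defs
  imports "HOL-Analysis.Analysis"
begin

text \<open>Functions on \<open>\<Omega>\<close> are represented by total functions of which only the values on \<open>\<Omega>\<close>
  matter, up to equality almost everywhere: two of them are the same element of a Lebesgue or
  Sobolev space iff they satisfy \<open>ae_eq \<Omega>\<close>.\<close>

definition ae_eq :: "'a::euclidean_space set \<Rightarrow> ('a \<Rightarrow> 'b) \<Rightarrow> ('a \<Rightarrow> 'b) \<Rightarrow> bool" where
  "ae_eq \<Omega> u v \<longleftrightarrow> (AE x in lebesgue_on \<Omega>. u x = v x)"

definition L2_space :: "'a::euclidean_space set \<Rightarrow> ('a \<Rightarrow> 'b::euclidean_space) set" where
  "L2_space \<Omega> = {f \<in> borel_measurable (lebesgue_on \<Omega>).
     integrable (lebesgue_on \<Omega>) (\<lambda>x. (norm (f x))\<^sup>2)}"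

fun Ck :: "nat \<Rightarrow> ('a::euclidean_space \<Rightarrow> real) \<Rightarrow> bool" where
  "Ck 0 f \<longleftrightarrow> continuous_on UNIV f"
| "Ck (Suc k) f \<longleftrightarrow> (\<forall>x. f differentiable (at x)) \<and>
     (\<forall>e\<in>Basis. Ck k (\<lambda>x. frechet_derivative f (at x) e))"

definition test_function :: "'a::euclidean_space set \<Rightarrow> ('a \<Rightarrow> real) \<Rightarrow> bool" where
  "test_function \<Omega> \<phi> \<longleftrightarrow> (\<forall>k. Ck k \<phi>) \<and>
     compact (closure {x. \<phi> x \<noteq> 0}) \<and> closure {x. \<phi> x \<noteq> 0} \<subseteq> \<Omega>"

definition gradient :: "('a::euclidean_space \<Rightarrow> real) \<Rightarrow> 'a \<Rightarrow> 'a" where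
  "gradient \<phi> x = (\<Sum>e\<in>Basis. frechet_derivative \<phi> (at x) e *\<^sub>R e)"

definition is_weak_gradient :: "'a::euclidean_space set \<Rightarrow> ('a \<Rightarrow> real) \<Rightarrow> ('a \<Rightarrow> 'a) \<Rightarrow> bool" where
  "is_weak_gradient \<Omega> u g \<longleftrightarrow> (\<forall>\<phi> e. test_function \<Omega> \<phi> \<longrightarrow> e \<in> Basis \<longrightarrow>
     (LINT x|lebesgue_on \<Omega>. u x * (gradient \<phi> x \<bullet> e)) =
     - (LINT x|lebesgue_on \<Omega>. (g x \<bullet> e) * \<phi> x))"

definition H1 :: "'a::euclidean_space set \<Rightarrow> ('a \<Rightarrow> real) set" where
  "H1 \<Omega> = {u \<in> L2_space \<Omega>. \<exists>g\<in>L2_space \<Omega>. is_weak_gradient \<Omega> u g}"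

text \<open>For \<open>\<Omega>\<close> open and \<open>u \<in> H1 \<Omega>\<close> the weak gradient is unique up to \<open>ae_eq \<Omega>\<close>, so the choice
  does not affect any integral over \<open>\<Omega>\<close>.\<close>

definition weak_gradient :: "'a::euclidean_space set \<Rightarrow> ('a \<Rightarrow> real) \<Rightarrow> 'a \<Rightarrow> 'a" where
  "weak_gradient \<Omega> u = (SOME g. g \<in> L2_space \<Omega> \<and> is_weak_gradient \<Omega> u g)"

text \<open>The closure of the test functions in the norm of \<open>H1 \<Omega>\<close>.\<close>

definition H10 :: "'a::euclidean_space set \<Rightarrow> ('a \<Rightarrow> real) set" where
  "H10 \<Omega> = {u \<in> H1 \<Omega>. \<exists>\<phi> :: nat \<Rightarrow> 'a \<Rightarrow> real. (\<forall>n. test_function \<Omega> (\<phi> n)) \<and>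
     (\<lambda>n. (LINT x|lebesgue_on \<Omega>. (\<phi> n x - u x)\<^sup>2) +
          (LINT x|lebesgue_on \<Omega>. (norm (gradient (\<phi> n) x - weak_gradient \<Omega> u x))\<^sup>2))
       \<longlonglongrightarrow> 0}"

definition dirichlet_form :: "'a::euclidean_space set \<Rightarrow> ('a \<Rightarrow> real) \<Rightarrow> ('a \<Rightarrow> real) \<Rightarrow> real" where
  "dirichlet_form \<Omega> u v = (LINT x|lebesgue_on \<Omega>. weak_gradient \<Omega> u x \<bullet> weak_gradient \<Omega> v x)"

definition dirichlet_eigenvalue :: "'a::euclidean_space set \<Rightarrow> real \<Rightarrow> bool" where
  "dirichlet_eigenvalue \<Omega> \<mu> \<longleftrightarrow> (\<exists>u\<in>H10 \<Omega>. \<not> ae_eq \<Omega> u (\<lambda>x. 0) \<and>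
     (\<forall>v\<in>H10 \<Omega>. dirichlet_form \<Omega> u v = \<mu> * (LINT x|lebesgue_on \<Omega>. u x * v x)))"

definition first_eigenvalue :: "'a::euclidean_space set \<Rightarrow> real" where
  "first_eigenvalue \<Omega> = (LEAST \<mu>. dirichlet_eigenvalue \<Omega> \<mu>)"

definition crit_exp :: "nat \<Rightarrow> real" where
  "crit_exp N = 2 * real N / (real N - 2)"

definition sobolev_const :: "'a::euclidean_space set \<Rightarrow> real" where
  "sobolev_const \<Omega> = (INF u \<in> {u \<in> H10 \<Omega>. \<not> ae_eq \<Omega> u (\<lambda>x. 0)}.
     (LINT x|lebesgue_on \<Omega>. (norm (weak_gradient \<Omega> u x))\<^sup>2) /
     (LINT x|lebesgue_on \<Omega>. \<bar>u x\<bar> powr crit_exp DIM('a)) powr (2 / crit_exp DIM('a)))"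

definition weak_solution ::
    "'a::euclidean_space set \<Rightarrow> real \<Rightarrow> real \<Rightarrow> real \<Rightarrow> ('a \<Rightarrow> real) \<Rightarrow> bool" where
  "weak_solution \<Omega> a b lam u \<longleftrightarrow> u \<in> H10 \<Omega> \<and>
     (\<forall>v\<in>H10 \<Omega>.
       (a + b * (LINT x|lebesgue_on \<Omega>. (norm (weak_gradient \<Omega> u x))\<^sup>2)) * dirichlet_form \<Omega> u v =
       lam * (LINT x|lebesgue_on \<Omega>. u x * v x) +
       (LINT x|lebesgue_on \<Omega>. \<bar>u x\<bar> powr (crit_exp DIM('a) - 2) * u x * v x))"

end

theory Submission
  imports Defs "HOL-Library.Diagonal_Subsequence"
begin

text \<open>The energy is even, so a nontrivial minimizer \<open>V\<close> gives the two solutions \<open>V\<close> and \<open>-V\<close>. Since \<open>N \<ge> 5\<close>,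
  the critical exponent is below 4 and the energy is coercive. Along a minimizing sequence that converges to \<open>V\<close>
  in \<open>L\<^sup>2\<close>, the squared gradient norm \<open>s\<close> of the remainder contributes at least
  \<open>a s / 2 + b s\<^sup>2 / 4 - S powr (- p / 2) s powr (p / 2) / p\<close> to the limit of the energies (Brezis--Lieb), where \<open>p\<close> is
  the critical exponent, and the hypothesis on \<open>a\<close> and \<open>b\<close> makes this nonnegative. Hence \<open>V\<close> is a minimizer.
  It is nontrivial because \<open>lam \<ge> a \<lambda>\<^sub>1\<close> and \<open>p < 4\<close> make the energy of a small multiple of the first eigenfunction
  negative.\<close>

section \<open>The space of square-integrable functions\<close>

text \<open>The obstacle is that \<open>H10\<close> does not embed compactly at the critical
  exponent, so a minimizing sequence can lose gradient mass s in the limit. With g the squared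
  gradient norm of the limit, (s + g)^2 = s^2 + 2 s g + g^2 leaves a mixed term 2 s g \<ge> 0 that
  may be dropped; hence a scalar inequality in s alone decides. Two Sobolev constants occur. A
  Bochner integral of a nonintegrable function is 0, so the quotients in
  \<open>sobolev_const\<close> carry information only once the critical power is known to be
  integrable, and S > 0 is not evident; both come from a Sobolev inequality with the explicit
  constant \<open>sobolev_bound\<close>. The sharp S then enters through its definition as an
  infimum. Weak convergence is obtained from strong L2 convergence and bounded gradients: against
  smooth functions the gradient is moved away by integration by parts, and density does the
  rest.\<close>

definition l2_inner :: "'a::euclidean_space set \<Rightarrow> ('a \<Rightarrow> 'b::euclidean_space) \<Rightarrow> ('a \<Rightarrow> 'b) \<Rightarrow> real" where
  "l2_inner \<Omega> f g = (LINT x|lebesgue_on \<Omega>. f x \<bullet> g x)"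

definition l2_norm :: "'a::euclidean_space set \<Rightarrow> ('a \<Rightarrow> 'b::euclidean_space) \<Rightarrow> real" where
  "l2_norm \<Omega> f = sqrt (l2_inner \<Omega> f f)"

lemma L2_measurable [measurable_dest]: "f \<in> L2_space \<Omega> \<Longrightarrow> f \<in> borel_measurable (lebesgue_on \<Omega>)"
  by (simp add: L2_space_def)

lemma L2_inner_integrable:
  fixes f g :: "'a::euclidean_space \<Rightarrow> 'b::euclidean_space"
  assumes "f \<in> L2_space \<Omega>" "g \<in> L2_space \<Omega>"
  shows "integrable (lebesgue_on \<Omega>) (\<lambda>x. f x \<bullet> g x)"
proof (rule Bochner_Integration.integrable_bound)
  show "integrable (lebesgue_on \<Omega>) (\<lambda>x. (norm (f x))\<^sup>2 + (norm (g x))\<^sup>2)"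
    using assms by (auto simp: L2_space_def)
  show "(\<lambda>x. f x \<bullet> g x) \<in> borel_measurable (lebesgue_on \<Omega>)"
    using assms[THEN L2_measurable] by measurable
  have "\<bar>f x \<bullet> g x\<bar> \<le> (norm (f x))\<^sup>2 + (norm (g x))\<^sup>2" for x
  proof -
    have "\<bar>f x \<bullet> g x\<bar> \<le> norm (f x) * norm (g x)" by (rule Cauchy_Schwarz_ineq2)
    moreover have "2 * (norm (f x) * norm (g x)) \<le> (norm (f x))\<^sup>2 + (norm (g x))\<^sup>2"
      using sum_squares_bound[of "norm (f x)" "norm (g x)"] by simp
    ultimately show ?thesis using zero_le_mult_iff[of "norm (f x)" "norm (g x)"] by (smt (verit) norm_ge_zero)
  qed
  then show "AE x in lebesgue_on \<Omega>. norm (f x \<bullet> g x) \<le> norm ((norm (f x))\<^sup>2 + (norm (g x))\<^sup>2)"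
    by auto
qed

lemma L2_iff_inner: "f \<in> L2_space \<Omega> \<longleftrightarrow>
    f \<in> borel_measurable (lebesgue_on \<Omega>) \<and> integrable (lebesgue_on \<Omega>) (\<lambda>x. f x \<bullet> f x)"
  by (auto simp: L2_space_def power2_norm_eq_inner)

lemma L2_zero: "(\<lambda>x. 0) \<in> L2_space \<Omega>"
  by (simp add: L2_iff_inner)

lemma L2_add:
  assumes "f \<in> L2_space \<Omega>" "g \<in> L2_space \<Omega>"
  shows "(\<lambda>x. f x + g x) \<in> L2_space \<Omega>"
  using L2_inner_integrable[OF assms] L2_inner_integrable[OF assms(1,1)] L2_inner_integrable[OF assms(2,2)]
    assms[THEN L2_measurable]
  unfolding L2_iff_inner by (auto simp: inner_add inner_commute)

lemma L2_scale: "f \<in> L2_space \<Omega> \<Longrightarrow> (\<lambda>x. c *\<^sub>R f x) \<in> L2_space \<Omega>"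
  unfolding L2_iff_inner by auto

lemma L2_diff:
  assumes "f \<in> L2_space \<Omega>" "g \<in> L2_space \<Omega>"
  shows "(\<lambda>x. f x - g x) \<in> L2_space \<Omega>"
  using L2_add[OF assms(1) L2_scale[OF assms(2), of "-1"]] by simp

lemma L2_Pair:
  assumes "u \<in> L2_space \<Omega>" "g \<in> L2_space \<Omega>"
  shows "(\<lambda>x. (u x, g x)) \<in> L2_space \<Omega>"
  using assms by (auto simp: L2_iff_inner)

lemma L2_fst_snd:
  fixes U :: "'a::euclidean_space \<Rightarrow> 'b::euclidean_space \<times> 'c::euclidean_space"
  assumes "U \<in> L2_space \<Omega>"
  shows "(\<lambda>x. fst (U x)) \<in> L2_space \<Omega>" "(\<lambda>x. snd (U x)) \<in> L2_space \<Omega>"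
proof -
  note [measurable] = L2_measurable[OF assms]
  have *: "integrable (lebesgue_on \<Omega>) (\<lambda>x. U x \<bullet> U x)"
    using assms by (simp add: L2_iff_inner)
  have "(\<lambda>x. fst (U x)) \<in> borel_measurable (lebesgue_on \<Omega>)"
       "(\<lambda>x. snd (U x)) \<in> borel_measurable (lebesgue_on \<Omega>)"
    using L2_measurable[OF assms] measurable_fst[of borel borel] measurable_snd[of borel borel]
      measurable_compose borel_prod by metis+
  moreover from this have "integrable (lebesgue_on \<Omega>) (\<lambda>x. fst (U x) \<bullet> fst (U x))"
    "integrable (lebesgue_on \<Omega>) (\<lambda>x. snd (U x) \<bullet> snd (U x))"
    by (auto intro!: Bochner_Integration.integrable_bound[OF *] simp: inner_prod_def)
  ultimately show "(\<lambda>x. fst (U x)) \<in> L2_space \<Omega>" "(\<lambda>x. snd (U x)) \<in> L2_space \<Omega>"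
    by (auto simp: L2_iff_inner)
qed

lemma L2_component:
  fixes g :: "'a::euclidean_space \<Rightarrow> 'b::euclidean_space"
  assumes "g \<in> L2_space \<Omega>" "e \<in> Basis"
  shows "(\<lambda>x. g x \<bullet> e) \<in> L2_space \<Omega>"
proof -
  note [measurable] = L2_measurable[OF assms(1)]
  have "integrable (lebesgue_on \<Omega>) (\<lambda>x. (g x \<bullet> e)\<^sup>2)"
  proof (rule Bochner_Integration.integrable_bound)
    show "integrable (lebesgue_on \<Omega>) (\<lambda>x. (norm (g x))\<^sup>2)" using assms by (simp add: L2_space_def)
    have "(g x \<bullet> e)\<^sup>2 \<le> (norm (g x))\<^sup>2" for x
      using Basis_le_norm[OF assms(2), of "g x"] by (simp add: abs_le_square_iff[symmetric])
    then show "AE x in lebesgue_on \<Omega>. norm ((g x \<bullet> e)\<^sup>2) \<le> norm ((norm (g x))\<^sup>2)" by simp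
  qed measurable
  then show ?thesis by (simp add: L2_space_def)
qed

lemma l2_inner_commute: "l2_inner \<Omega> f g = l2_inner \<Omega> g f"
  by (simp add: l2_inner_def inner_commute)

lemma l2_inner_add_left:
  assumes "f \<in> L2_space \<Omega>" "g \<in> L2_space \<Omega>" "h \<in> L2_space \<Omega>"
  shows "l2_inner \<Omega> (\<lambda>x. f x + g x) h = l2_inner \<Omega> f h + l2_inner \<Omega> g h"
  using assms by (simp add: l2_inner_def inner_add_left L2_inner_integrable)

lemma l2_inner_diff_left:
  assumes "f \<in> L2_space \<Omega>" "g \<in> L2_space \<Omega>" "h \<in> L2_space \<Omega>"
  shows "l2_inner \<Omega> (\<lambda>x. f x - g x) h = l2_inner \<Omega> f h - l2_inner \<Omega> g h"
  using assms by (simp add: l2_inner_def inner_diff_left L2_inner_integrable)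

lemma l2_inner_scale_left: "l2_inner \<Omega> (\<lambda>x. c *\<^sub>R f x) h = c * l2_inner \<Omega> f h"
  by (simp add: l2_inner_def)

lemma l2_inner_add_right:
  assumes "f \<in> L2_space \<Omega>" "g \<in> L2_space \<Omega>" "h \<in> L2_space \<Omega>"
  shows "l2_inner \<Omega> h (\<lambda>x. f x + g x) = l2_inner \<Omega> h f + l2_inner \<Omega> h g"
  using l2_inner_add_left[OF assms] by (simp add: l2_inner_commute)

lemma l2_inner_diff_right:
  assumes "f \<in> L2_space \<Omega>" "g \<in> L2_space \<Omega>" "h \<in> L2_space \<Omega>"
  shows "l2_inner \<Omega> h (\<lambda>x. f x - g x) = l2_inner \<Omega> h f - l2_inner \<Omega> h g"
  using l2_inner_diff_left[OF assms] by (simp add: l2_inner_commute)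

lemma l2_inner_scale_right: "l2_inner \<Omega> h (\<lambda>x. c *\<^sub>R f x) = c * l2_inner \<Omega> h f"
  by (simp add: l2_inner_def)

lemma l2_inner_self_nonneg [simp]: "0 \<le> l2_inner \<Omega> f f"
  by (simp add: l2_inner_def)

lemma l2_norm_nonneg [simp]: "0 \<le> l2_norm \<Omega> f"
  by (simp add: l2_norm_def)

lemma l2_norm_square: "(l2_norm \<Omega> f)\<^sup>2 = l2_inner \<Omega> f f"
  by (simp add: l2_norm_def)

lemma l2_inner_self_eq: "l2_inner \<Omega> f f = (LINT x|lebesgue_on \<Omega>. (norm (f x))\<^sup>2)"
  by (simp add: l2_inner_def power2_norm_eq_inner)

lemma l2_inner_self_add:
  assumes "f \<in> L2_space \<Omega>" "g \<in> L2_space \<Omega>"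
  shows "l2_inner \<Omega> (\<lambda>x. f x + g x) (\<lambda>x. f x + g x) = l2_inner \<Omega> f f + 2 * l2_inner \<Omega> f g + l2_inner \<Omega> g g"
  using assms L2_add[OF assms] by (simp add: l2_inner_add_left l2_inner_add_right l2_inner_commute)

lemma l2_inner_self_scale: "l2_inner \<Omega> (\<lambda>x. c *\<^sub>R f x) (\<lambda>x. c *\<^sub>R f x) = c\<^sup>2 * l2_inner \<Omega> f f"
  by (simp add: l2_inner_scale_left l2_inner_scale_right power2_eq_square)

lemma l2_norm_scale: "l2_norm \<Omega> (\<lambda>x. c *\<^sub>R f x) = \<bar>c\<bar> * l2_norm \<Omega> f"
  by (simp add: l2_norm_def l2_inner_self_scale real_sqrt_mult)

lemma l2_Cauchy_Schwarz:
  assumes "f \<in> L2_space \<Omega>" "g \<in> L2_space \<Omega>"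
  shows "\<bar>l2_inner \<Omega> f g\<bar> \<le> l2_norm \<Omega> f * l2_norm \<Omega> g"
proof -
  have quad: "0 \<le> l2_inner \<Omega> f f + 2 * t * l2_inner \<Omega> f g + t\<^sup>2 * l2_inner \<Omega> g g" for t
    using l2_inner_self_add[OF assms(1) L2_scale[OF assms(2), of t]]
      l2_inner_self_nonneg[of \<Omega> "\<lambda>x. f x + t *\<^sub>R g x"]
    by (simp add: l2_inner_self_scale l2_inner_scale_right)
  have "(l2_inner \<Omega> f g)\<^sup>2 \<le> l2_inner \<Omega> f f * l2_inner \<Omega> g g"
  proof (cases "l2_inner \<Omega> g g = 0")
    case True
    have "l2_inner \<Omega> f g = 0"
    proof (rule ccontr)
      assume "l2_inner \<Omega> f g \<noteq> 0"
      \<comment> \<open>This t makes the quadratic, which is affine in t because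
        \<open>l2_inner \<Omega> g g = 0\<close>, equal to -1.\<close>
      then show False
        using quad[of "- (l2_inner \<Omega> f f + 1) / (2 * l2_inner \<Omega> f g)"] True by (simp add: field_simps)
    qed
    then show ?thesis using True by simp
  next
    case False
    then have pos: "l2_inner \<Omega> g g > 0" using l2_inner_self_nonneg[of \<Omega> g] by linarith
    show ?thesis
      using quad[of "- l2_inner \<Omega> f g / l2_inner \<Omega> g g"] pos
      by (simp add: power2_eq_square field_simps)
  qed
  then have "sqrt ((l2_inner \<Omega> f g)\<^sup>2) \<le> sqrt (l2_inner \<Omega> f f * l2_inner \<Omega> g g)"
    by (rule real_sqrt_le_mono)
  then show ?thesis by (simp add: l2_norm_def real_sqrt_mult)
qed

lemma l2_norm_triangle:
  assumes "f \<in> L2_space \<Omega>" "g \<in> L2_space \<Omega>"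
  shows "l2_norm \<Omega> (\<lambda>x. f x + g x) \<le> l2_norm \<Omega> f + l2_norm \<Omega> g"
proof (rule power2_le_imp_le)
  show "(l2_norm \<Omega> (\<lambda>x. f x + g x))\<^sup>2 \<le> (l2_norm \<Omega> f + l2_norm \<Omega> g)\<^sup>2"
    using l2_Cauchy_Schwarz[OF assms] by (simp add: l2_norm_square power2_sum l2_inner_self_add[OF assms])
qed simp

lemma l2_norm_diff_triangle:
  assumes "f \<in> L2_space \<Omega>" "g \<in> L2_space \<Omega>" "h \<in> L2_space \<Omega>"
  shows "l2_norm \<Omega> (\<lambda>x. f x - h x) \<le> l2_norm \<Omega> (\<lambda>x. f x - g x) + l2_norm \<Omega> (\<lambda>x. g x - h x)"
  using l2_norm_triangle[OF L2_diff[OF assms(1,2)] L2_diff[OF assms(2,3)]] by simp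

lemma l2_norm_minus_commute: "l2_norm \<Omega> (\<lambda>x. f x - g x) = l2_norm \<Omega> (\<lambda>x. g x - f x)"
  using l2_norm_scale[of \<Omega> "-1" "\<lambda>x. f x - g x"] by simp

lemma l2_norm_le_add_diff:
  assumes "f \<in> L2_space \<Omega>" "g \<in> L2_space \<Omega>"
  shows "l2_norm \<Omega> f \<le> l2_norm \<Omega> g + l2_norm \<Omega> (\<lambda>x. f x - g x)"
  using l2_norm_triangle[OF assms(2) L2_diff[OF assms]] by simp

text \<open>With values in a product space, a function and its gradient form one L2 element whose
  squared norm is the sum of both; for jets this is the squared H1 norm.\<close>

lemma l2_norm_fst_snd_le:
  fixes U :: "'a::euclidean_space \<Rightarrow> 'b::euclidean_space \<times> 'c::euclidean_space"
  assumes "U \<in> L2_space \<Omega>"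
  shows "l2_inner \<Omega> U U = l2_inner \<Omega> (\<lambda>x. fst (U x)) (\<lambda>x. fst (U x)) + l2_inner \<Omega> (\<lambda>x. snd (U x)) (\<lambda>x. snd (U x))"
    "l2_norm \<Omega> (\<lambda>x. fst (U x)) \<le> l2_norm \<Omega> U" "l2_norm \<Omega> (\<lambda>x. snd (U x)) \<le> l2_norm \<Omega> U"
proof -
  show *: "l2_inner \<Omega> U U = l2_inner \<Omega> (\<lambda>x. fst (U x)) (\<lambda>x. fst (U x)) + l2_inner \<Omega> (\<lambda>x. snd (U x)) (\<lambda>x. snd (U x))"
    using L2_fst_snd[OF assms] by (simp add: l2_inner_def inner_prod_def L2_inner_integrable)
  show "l2_norm \<Omega> (\<lambda>x. fst (U x)) \<le> l2_norm \<Omega> U" "l2_norm \<Omega> (\<lambda>x. snd (U x)) \<le> l2_norm \<Omega> U"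
    unfolding l2_norm_def * by auto
qed

lemma l2_norm_zero_iff:
  assumes "f \<in> L2_space \<Omega>"
  shows "l2_norm \<Omega> f = 0 \<longleftrightarrow> ae_eq \<Omega> f (\<lambda>x. 0)"
  using integral_nonneg_eq_0_iff_AE[OF L2_inner_integrable[OF assms assms]]
  by (simp add: l2_norm_def l2_inner_def ae_eq_def)

lemma l2_inner_cong:
  assumes "f \<in> L2_space \<Omega>" "g \<in> L2_space \<Omega>" "f' \<in> L2_space \<Omega>" "g' \<in> L2_space \<Omega>"
    and "ae_eq \<Omega> f f'" "ae_eq \<Omega> g g'"
  shows "l2_inner \<Omega> f g = l2_inner \<Omega> f' g'"
  unfolding l2_inner_def
proof (rule integral_cong_AE)
  show "(\<lambda>x. f x \<bullet> g x) \<in> borel_measurable (lebesgue_on \<Omega>)" "(\<lambda>x. f' x \<bullet> g' x) \<in> borel_measurable (lebesgue_on \<Omega>)"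
    using assms(1-4)[THEN L2_measurable] by measurable
  show "AE x in lebesgue_on \<Omega>. f x \<bullet> g x = f' x \<bullet> g' x"
    using assms(5,6) by (auto simp: ae_eq_def)
qed

section \<open>Limits, almost everywhere convergent subsequences and completeness\<close>

lemma l2_inner_tendsto:
  assumes f: "\<And>n. f n \<in> L2_space \<Omega>" "f' \<in> L2_space \<Omega>" and h: "h \<in> L2_space \<Omega>"
    and lim: "(\<lambda>n. l2_norm \<Omega> (\<lambda>x. f n x - f' x)) \<longlonglongrightarrow> 0"
  shows "(\<lambda>n. l2_inner \<Omega> (f n) h) \<longlonglongrightarrow> l2_inner \<Omega> f' h"
proof -
  have "(\<lambda>n. l2_inner \<Omega> (f n) h - l2_inner \<Omega> f' h) \<longlonglongrightarrow> 0"
  proof (rule Lim_null_comparison)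
    show "(\<lambda>n. l2_norm \<Omega> (\<lambda>x. f n x - f' x) * l2_norm \<Omega> h) \<longlonglongrightarrow> 0"
      using tendsto_mult_left_zero[OF lim] by simp
    show "\<forall>\<^sub>F n in sequentially. norm (l2_inner \<Omega> (f n) h - l2_inner \<Omega> f' h)
        \<le> l2_norm \<Omega> (\<lambda>x. f n x - f' x) * l2_norm \<Omega> h"
      using l2_Cauchy_Schwarz[OF L2_diff[OF f] h] by (simp add: l2_inner_diff_left f h)
  qed
  then show ?thesis by (rule LIM_zero_cancel)
qed

lemma l2_norm_tendsto:
  assumes f: "\<And>n. f n \<in> L2_space \<Omega>" "f' \<in> L2_space \<Omega>"
    and lim: "(\<lambda>n. l2_norm \<Omega> (\<lambda>x. f n x - f' x)) \<longlonglongrightarrow> 0"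
  shows "(\<lambda>n. l2_norm \<Omega> (f n)) \<longlonglongrightarrow> l2_norm \<Omega> f'"
proof -
  have "(\<lambda>n. l2_norm \<Omega> (f n) - l2_norm \<Omega> f') \<longlonglongrightarrow> 0"
  proof (rule Lim_null_comparison[OF _ lim])
    have "\<bar>l2_norm \<Omega> (f n) - l2_norm \<Omega> f'\<bar> \<le> l2_norm \<Omega> (\<lambda>x. f n x - f' x)" for n
      using l2_norm_le_add_diff[OF f(1)[of n] f(2)] l2_norm_le_add_diff[OF f(2) f(1)[of n]]
      by (simp add: l2_norm_minus_commute[of \<Omega> f'] abs_le_iff)
    then show "\<forall>\<^sub>F n in sequentially. norm (l2_norm \<Omega> (f n) - l2_norm \<Omega> f') \<le> l2_norm \<Omega> (\<lambda>x. f n x - f' x)"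
      by simp
  qed
  then show ?thesis by (rule LIM_zero_cancel)
qed

text \<open>Cauchy-Schwarz against the constant function 1, which is square integrable because
  \<Omega> has finite measure.\<close>

lemma L2_imp_integrable:
  fixes f :: "'a::euclidean_space \<Rightarrow> 'b::euclidean_space"
  assumes "\<Omega> \<in> lmeasurable" "f \<in> L2_space \<Omega>"
  shows "integrable (lebesgue_on \<Omega>) f"
    "(LINT x|lebesgue_on \<Omega>. norm (f x)) \<le> sqrt (measure lebesgue \<Omega>) * l2_norm \<Omega> f"
proof -
  interpret finite_measure "lebesgue_on \<Omega>" using assms(1) by (rule finite_measure_lebesgue_on)
  have one: "(\<lambda>x. 1::real) \<in> L2_space \<Omega>" by (simp add: L2_iff_inner)
  have nf: "(\<lambda>x. norm (f x)) \<in> L2_space \<Omega>"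
    using assms(2) by (auto simp: L2_space_def)
  have "integrable (lebesgue_on \<Omega>) (\<lambda>x. norm (f x))"
    using L2_inner_integrable[OF one nf] by simp
  then show "integrable (lebesgue_on \<Omega>) f"
    using L2_measurable[OF assms(2)] by (simp add: integrable_norm_iff)
  have "l2_inner \<Omega> (\<lambda>x. 1::real) (\<lambda>x. 1) = measure lebesgue \<Omega>"
    using assms(1) by (simp add: l2_inner_def measure_restrict_space fmeasurableD)
  moreover have "l2_norm \<Omega> (\<lambda>x. norm (f x)) = l2_norm \<Omega> f"
    by (simp add: l2_norm_def l2_inner_def power2_norm_eq_inner flip: power2_eq_square)
  ultimately show "(LINT x|lebesgue_on \<Omega>. norm (f x)) \<le> sqrt (measure lebesgue \<Omega>) * l2_norm \<Omega> f"
    using l2_Cauchy_Schwarz[OF one nf] by (simp add: l2_inner_def l2_norm_def)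
qed

text \<open>On a set of finite measure L2 convergence implies L1 convergence, and an L1 null
  sequence has a subsequence tending to 0 almost everywhere.\<close>

lemma L2_AE_subseq:
  fixes f :: "nat \<Rightarrow> 'a::euclidean_space \<Rightarrow> 'b::euclidean_space"
  assumes \<Omega>: "\<Omega> \<in> lmeasurable" and f: "\<And>n. f n \<in> L2_space \<Omega>" "g \<in> L2_space \<Omega>"
    and lim: "(\<lambda>n. l2_norm \<Omega> (\<lambda>x. f n x - g x)) \<longlonglongrightarrow> 0"
  obtains r :: "nat \<Rightarrow> nat" where "strict_mono r" "AE x in lebesgue_on \<Omega>. (\<lambda>n. f (r n) x) \<longlonglongrightarrow> g x"
proof -
  have "(\<lambda>n. LINT x|lebesgue_on \<Omega>. norm (f n x - g x)) \<longlonglongrightarrow> 0"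
  proof (rule Lim_null_comparison)
    show "(\<lambda>n. sqrt (measure lebesgue \<Omega>) * l2_norm \<Omega> (\<lambda>x. f n x - g x)) \<longlonglongrightarrow> 0"
      using tendsto_mult_right_zero[OF lim] by simp
    show "\<forall>\<^sub>F n in sequentially. norm (LINT x|lebesgue_on \<Omega>. norm (f n x - g x))
        \<le> sqrt (measure lebesgue \<Omega>) * l2_norm \<Omega> (\<lambda>x. f n x - g x)"
      using L2_imp_integrable(2)[OF \<Omega> L2_diff[OF f]] by simp
  qed
  from tendsto_L1_AE_subseq[OF L2_imp_integrable(1)[OF \<Omega> L2_diff[OF f]] this]
  obtain r :: "nat \<Rightarrow> nat" where "strict_mono r" "AE x in lebesgue_on \<Omega>. (\<lambda>n. f (r n) x - g x) \<longlonglongrightarrow> 0"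
    by auto
  moreover from this(2) have "AE x in lebesgue_on \<Omega>. (\<lambda>n. f (r n) x) \<longlonglongrightarrow> g x"
    by eventually_elim (rule LIM_zero_cancel)
  ultimately show ?thesis using that by blast
qed

text \<open>Riesz-Fischer: on a set of finite measure an L2 Cauchy sequence is L1 Cauchy, hence has
  a subsequence that is Cauchy almost everywhere. Its pointwise limit is the L2 limit.\<close>

lemma L2_complete:
  fixes f :: "nat \<Rightarrow> 'a::euclidean_space \<Rightarrow> 'b::euclidean_space"
  assumes \<Omega>: "\<Omega> \<in> lmeasurable" and f: "\<And>n. f n \<in> L2_space \<Omega>"
    and Cauchy: "\<And>e. e > 0 \<Longrightarrow> \<exists>N. \<forall>m\<ge>N. \<forall>n\<ge>N. l2_norm \<Omega> (\<lambda>x. f m x - f n x) < e"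
  obtains g where "g \<in> L2_space \<Omega>" "(\<lambda>n. l2_norm \<Omega> (\<lambda>x. f n x - g x)) \<longlonglongrightarrow> 0"
proof -
  let ?M = "lebesgue_on \<Omega>"
  have L1: "\<exists>N. \<forall>i\<ge>N. \<forall>j\<ge>N. (LINT x|?M. norm (f i x - f j x)) < e" if "e > 0" for e
  proof -
    \<comment> \<open>The summand 1 keeps the denominator positive when \<Omega> is a null
      set.\<close>
    have "e / (sqrt (measure lebesgue \<Omega>) + 1) > 0" using that by (simp add: add_nonneg_pos)
    then obtain N where N: "l2_norm \<Omega> (\<lambda>x. f m x - f n x) < e / (sqrt (measure lebesgue \<Omega>) + 1)"
      if "m \<ge> N" "n \<ge> N" for m n using Cauchy by blast
    show ?thesis
    proof (intro exI allI impI)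
      fix i j assume "i \<ge> N" "j \<ge> N"
      have "(LINT x|?M. norm (f i x - f j x)) \<le> sqrt (measure lebesgue \<Omega>) * l2_norm \<Omega> (\<lambda>x. f i x - f j x)"
        by (rule L2_imp_integrable(2)[OF \<Omega> L2_diff[OF f f]])
      also have "\<dots> \<le> sqrt (measure lebesgue \<Omega>) * (e / (sqrt (measure lebesgue \<Omega>) + 1))"
        using N[OF \<open>i \<ge> N\<close> \<open>j \<ge> N\<close>] by (intro mult_left_mono) auto
      also have "\<dots> < e"
        using that by (subst times_divide_eq_right, subst pos_divide_less_eq) (auto simp: algebra_simps add_nonneg_pos add_pos_nonneg)
      finally show "(LINT x|?M. norm (f i x - f j x)) < e" .
    qed
  qed
  obtain r where r: "strict_mono r" "AE x in ?M. Cauchy (\<lambda>i. f (r i) x)"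
    using cauchy_L1_AE_cauchy_subseq[OF L2_imp_integrable(1)[OF \<Omega> f] L1] by blast
  define g where "g = (\<lambda>x. lim (\<lambda>i. f (r i) x))"
  have [measurable]: "f n \<in> borel_measurable ?M" for n by (rule L2_measurable[OF f])
  have g_meas [measurable]: "g \<in> borel_measurable ?M"
    unfolding g_def by (rule borel_measurable_lim_metric) measurable
  have lim: "AE x in ?M. (\<lambda>i. f (r i) x) \<longlonglongrightarrow> g x"
    using r(2) unfolding g_def by eventually_elim (simp add: Cauchy_convergent_iff convergent_LIMSEQ_iff)
  \<comment> \<open>Fatou along the subsequence: for fixed n, the bound e on the distances to
    \<open>f (r i)\<close> survives the limit in i, which gives integrability of the squared
    difference and its estimate at once.\<close>
  have key: "integrable ?M (\<lambda>x. (norm (f n x - g x))\<^sup>2) \<and> l2_inner \<Omega> (\<lambda>x. f n x - g x) (\<lambda>x. f n x - g x) \<le> e\<^sup>2"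
    if N: "\<forall>m\<ge>N. \<forall>n\<ge>N. l2_norm \<Omega> (\<lambda>x. f m x - f n x) < e" "n \<ge> N" for n N e
  proof -
    have e: "e \<ge> 0" using N by (meson l2_norm_nonneg le_less_trans less_imp_le order_refl)
    have "(\<integral>\<^sup>+x. ennreal ((norm (f n x - g x))\<^sup>2) \<partial>?M) =
        (\<integral>\<^sup>+x. liminf (\<lambda>i. ennreal ((norm (f n x - f (r i) x))\<^sup>2)) \<partial>?M)"
    proof (rule nn_integral_cong_AE)
      show "AE x in ?M. ennreal ((norm (f n x - g x))\<^sup>2) = liminf (\<lambda>i. ennreal ((norm (f n x - f (r i) x))\<^sup>2))"
        using lim
      proof eventually_elim
        case (elim x)
        have "(\<lambda>i. ennreal ((norm (f n x - f (r i) x))\<^sup>2)) \<longlonglongrightarrow> ennreal ((norm (f n x - g x))\<^sup>2)"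
          by (intro tendsto_intros elim)
        then show ?case by (rule lim_imp_Liminf[OF trivial_limit_sequentially, symmetric])
      qed
    qed
    also have "\<dots> \<le> liminf (\<lambda>i. \<integral>\<^sup>+x. ennreal ((norm (f n x - f (r i) x))\<^sup>2) \<partial>?M)"
      by (rule nn_integral_liminf) measurable
    also have "\<dots> \<le> liminf (\<lambda>i. ennreal (e\<^sup>2))"
    proof (rule Liminf_mono)
      have "(\<integral>\<^sup>+x. ennreal ((norm (f n x - f (r i) x))\<^sup>2) \<partial>?M) \<le> ennreal (e\<^sup>2)" if "i \<ge> N" for i
      proof -
        have "(\<integral>\<^sup>+x. ennreal ((norm (f n x - f (r i) x))\<^sup>2) \<partial>?M) = ennreal (l2_inner \<Omega> (\<lambda>x. f n x - f (r i) x) (\<lambda>x. f n x - f (r i) x))"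
          using L2_diff[OF f[of n] f[of "r i"]]
          unfolding l2_inner_self_eq L2_space_def by (intro nn_integral_eq_integral) auto
        also have "\<dots> \<le> ennreal (e\<^sup>2)"
        proof (rule ennreal_leI)
          have "r i \<ge> N" using that seq_suble[OF r(1), of i] by simp
          then have "l2_norm \<Omega> (\<lambda>x. f n x - f (r i) x) \<le> e" using N by (simp add: less_imp_le)
          then show "l2_inner \<Omega> (\<lambda>x. f n x - f (r i) x) (\<lambda>x. f n x - f (r i) x) \<le> e\<^sup>2"
            unfolding l2_norm_square[symmetric] by (intro power_mono) auto
        qed
        finally show ?thesis .
      qed
      then show "\<forall>\<^sub>F i in sequentially. (\<integral>\<^sup>+x. ennreal ((norm (f n x - f (r i) x))\<^sup>2) \<partial>?M) \<le> ennreal (e\<^sup>2)"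
        unfolding eventually_sequentially by blast
    qed
    also have "\<dots> = ennreal (e\<^sup>2)" by (simp add: Liminf_const)
    finally have le: "(\<integral>\<^sup>+x. ennreal ((norm (f n x - g x))\<^sup>2) \<partial>?M) \<le> ennreal (e\<^sup>2)" .
    then have int: "integrable ?M (\<lambda>x. (norm (f n x - g x))\<^sup>2)"
      by (intro integrableI_nonneg) (auto simp: le_less_trans[OF le])
    moreover have "ennreal (LINT x|?M. (norm (f n x - g x))\<^sup>2) \<le> ennreal (e\<^sup>2)"
      using le nn_integral_eq_integral[OF int] by simp
    ultimately show ?thesis by (simp add: l2_inner_self_eq ennreal_le_iff)
  qed
  obtain N1 where "\<forall>m\<ge>N1. \<forall>n\<ge>N1. l2_norm \<Omega> (\<lambda>x. f m x - f n x) < 1" using Cauchy[of 1] by auto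
  from key[OF this order_refl] have "(\<lambda>x. f N1 x - g x) \<in> L2_space \<Omega>"
    by (simp add: L2_space_def)
  from L2_diff[OF f[of N1] this] have g: "g \<in> L2_space \<Omega>" by simp
  moreover have "(\<lambda>n. l2_norm \<Omega> (\<lambda>x. f n x - g x)) \<longlonglongrightarrow> 0"
  proof (rule LIMSEQ_I)
    fix e :: real assume "e > 0"
    then obtain N where N: "\<forall>m\<ge>N. \<forall>n\<ge>N. l2_norm \<Omega> (\<lambda>x. f m x - f n x) < e/2" using Cauchy[of "e/2"] by auto
    have "l2_norm \<Omega> (\<lambda>x. f n x - g x) < e" if "n \<ge> N" for n
    proof -
      have "(l2_norm \<Omega> (\<lambda>x. f n x - g x))\<^sup>2 \<le> (e/2)\<^sup>2" using key[OF N that] by (simp add: l2_norm_square)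
      then have "l2_norm \<Omega> (\<lambda>x. f n x - g x) \<le> e/2" by (rule power2_le_imp_le) (use \<open>e > 0\<close> in simp)
      then show ?thesis using \<open>e > 0\<close> by simp
    qed
    then show "\<exists>no. \<forall>n\<ge>no. norm (l2_norm \<Omega> (\<lambda>x. f n x - g x) - 0) < e" by auto
  qed
  ultimately show ?thesis by (rule that)
qed

section \<open>Smooth functions and test functions\<close>

lemma frechet_derivative_eqI: "(f has_derivative f') (at x) \<Longrightarrow> frechet_derivative f (at x) = f'"
  by (metis frechet_derivative_at)

lemma Ck_SucD: "Ck (Suc k) f \<Longrightarrow> Ck k f"
proof (induction k arbitrary: f)
  case 0
  then show ?case by (auto intro!: continuous_at_imp_continuous_on differentiable_imp_continuous_within)
next
  case (Suc k)
  then show ?case by (metis Ck.simps(2))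
qed

lemma Ck_const: "Ck k (\<lambda>x. c)"
  by (induction k arbitrary: c) auto

lemma Ck_add: "Ck k f \<Longrightarrow> Ck k g \<Longrightarrow> Ck k (\<lambda>x. f x + g x)"
proof (induction k arbitrary: f g)
  case 0
  then show ?case by (auto intro: continuous_intros)
next
  case (Suc k)
  have "frechet_derivative (\<lambda>x. f x + g x) (at x) = (\<lambda>h. frechet_derivative f (at x) h + frechet_derivative g (at x) h)" for x
    using Suc.prems by (intro frechet_derivative_eqI has_derivative_add) (auto simp: frechet_derivative_works)
  then show ?case using Suc by auto
qed

lemma Ck_mult: "Ck k f \<Longrightarrow> Ck k g \<Longrightarrow> Ck k (\<lambda>x. f x * g x)"
proof (induction k arbitrary: f g)
  case 0
  then show ?case by (auto intro: continuous_intros)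
next
  case (Suc k)
  have "frechet_derivative (\<lambda>x. f x * g x) (at x) =
      (\<lambda>h. f x * frechet_derivative g (at x) h + frechet_derivative f (at x) h * g x)" for x
    using Suc.prems by (intro frechet_derivative_eqI has_derivative_mult) (auto simp: frechet_derivative_works)
  moreover have "Ck k f" "Ck k g" using Suc.prems Ck_SucD by blast+
  ultimately show ?case using Suc by (auto intro!: Ck_add)
qed

lemma Ck_prod: "finite I \<Longrightarrow> (\<And>i. i \<in> I \<Longrightarrow> Ck k (f i)) \<Longrightarrow> Ck k (\<lambda>x. \<Prod>i\<in>I. f i x)"
  by (induction I rule: finite_induct) (auto intro: Ck_mult simp: Ck_const)

section \<open>Smooth bump functions on boxes\<close>

definition flat_exp :: "real poly \<Rightarrow> real \<Rightarrow> real" where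
  "flat_exp p t = (if t > 0 then poly p (1/t) * exp (- (1/t)) else 0)"

lemma poly_exp_tendsto_0: "((\<lambda>y::real. poly p y * exp (- y)) \<longlongrightarrow> 0) at_top"
proof -
  \<comment> \<open>The factor \<open>y ^ k\<close> carries the induction: splitting the constant
    coefficient off \<open>pCons a p\<close> multiplies the remaining polynomial by y.\<close>
  have "((\<lambda>y::real. y ^ k * poly p y * exp (- y)) \<longlongrightarrow> 0) at_top" for k
  proof (induction p arbitrary: k)
    case 0
    then show ?case by simp
  next
    case (pCons a p)
    have "((\<lambda>y. a * (y ^ k / exp y) + y ^ Suc k * poly p y * exp (- y)) \<longlongrightarrow> a * 0 + 0) at_top"
      by (intro tendsto_intros tendsto_power_div_exp_0 pCons.IH)
    then show ?case by (simp add: algebra_simps exp_minus divide_simps)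
  qed
  from this[of 0] show ?thesis by simp
qed

text \<open>The functions p(1/t) exp(-1/t), extended by 0, are closed under differentiation: the
  product rule replaces p by X^2 (p - p'), which is the nested \<open>pCons 0\<close>. At t = 0 the
  right difference quotient is (X p)(1/h) exp(-1/h), and 1/h tends to infinity.\<close>

lemma flat_exp_DERIV: "(flat_exp p has_real_derivative flat_exp (pCons 0 (pCons 0 (p - pderiv p))) t) (at t)"
proof -
  consider "t > 0" | "t < 0" | "t = 0" by linarith
  then show ?thesis
  proof cases
    case 1
    have "((\<lambda>t. poly p (1/t) * exp (- (1/t))) has_real_derivative
        flat_exp (pCons 0 (pCons 0 (p - pderiv p))) t) (at t)"
      using 1 by (auto intro!: derivative_eq_intros DERIV_chain2[OF poly_DERIV] simp: flat_exp_def field_simps power2_eq_square)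
    then show ?thesis
      by (rule has_field_derivative_transform_within_open[where S="{0<..}"]) (use 1 in \<open>auto simp: flat_exp_def\<close>)
  next
    case 2
    have "((\<lambda>t. 0) has_real_derivative flat_exp (pCons 0 (pCons 0 (p - pderiv p))) t) (at t)"
      using 2 by (auto simp: flat_exp_def)
    then show ?thesis
      by (rule has_field_derivative_transform_within_open[where S="{..<0}"]) (use 2 in \<open>auto simp: flat_exp_def\<close>)
  next
    case 3
    have "((\<lambda>t. poly (pCons 0 p) (inverse t) * exp (- inverse t)) \<longlongrightarrow> 0) (at_right 0)"
      using filterlim_compose[OF poly_exp_tendsto_0 filterlim_inverse_at_top_right] .
    then have "((\<lambda>h. flat_exp p h / h) \<longlongrightarrow> 0) (at_right 0)"
      by (rule Lim_transform_eventually)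
        (auto simp: flat_exp_def eventually_at_right_less field_simps intro!: eventually_at_rightI[of 0 1])
    moreover have "((\<lambda>h. flat_exp p h / h) \<longlongrightarrow> 0) (at_left 0)"
      by (rule Lim_transform_eventually[OF tendsto_const])
        (auto simp: flat_exp_def intro!: eventually_at_leftI[of "-1" 0])
    ultimately have "((\<lambda>h. flat_exp p h / h) \<longlongrightarrow> 0) (at 0)"
      by (simp add: filterlim_split_at)
    then show ?thesis using 3 by (simp add: has_field_derivative_iff flat_exp_def)
  qed
qed

text \<open>Induction over k with p arbitrary, since a partial derivative is a constant times a
  function of the same form with a new polynomial.\<close>

lemma flat_exp_coordinate_Ck:
  fixes e :: "'a::euclidean_space"
  shows "Ck k (\<lambda>x. flat_exp p (c * (x \<bullet> e) + d))"
proof (induction k arbitrary: p)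
  have deriv: "((\<lambda>x. flat_exp p (c * (x \<bullet> e) + d)) has_derivative
      (\<lambda>h. flat_exp (pCons 0 (pCons 0 (p - pderiv p))) (c * (x \<bullet> e) + d) * (c * (h \<bullet> e)))) (at x)" for p and x :: 'a
  proof -
    have "((\<lambda>x. c * (x \<bullet> e) + d) has_derivative (\<lambda>h. c * (h \<bullet> e))) (at x)"
      by (auto intro!: derivative_eq_intros)
    from has_derivative_compose[OF this flat_exp_DERIV[unfolded has_field_derivative_def]]
    show ?thesis .
  qed
  case 0
  show ?case
    using has_derivative_continuous[OF deriv] by (auto intro!: continuous_at_imp_continuous_on)
  case (Suc k)
  show ?case
    unfolding Ck.simps frechet_derivative_eqI[OF deriv]
    using deriv Suc by (intro conjI allI ballI Ck_mult Ck_const) (blast intro: differentiableI)+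
qed

lemma flat_exp_one: "flat_exp 1 t = (if t > 0 then exp (- (1/t)) else 0)"
  by (simp add: flat_exp_def)

text \<open>One cutoff exp(-1/t) for each face of the box. For s > 0 the product is nonzero exactly
  on the open box, and letting s grow sharpens it to the indicator; this replaces smoothing by
  convolution.\<close>

definition box_bump :: "real \<Rightarrow> 'a::euclidean_space \<Rightarrow> 'a \<Rightarrow> 'a \<Rightarrow> real" where
  "box_bump s a b x = (\<Prod>e\<in>Basis. flat_exp 1 (s * (x \<bullet> e - a \<bullet> e)) * flat_exp 1 (s * (b \<bullet> e - x \<bullet> e)))"

lemma box_bump_Ck: "Ck k (box_bump s a b)"
proof -
  have "Ck k (\<lambda>x. flat_exp 1 (s * (x \<bullet> e) + - s * (a \<bullet> e)) * flat_exp 1 (- s * (x \<bullet> e) + s * (b \<bullet> e)))" for e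
    by (intro Ck_mult flat_exp_coordinate_Ck)
  then have "Ck k (\<lambda>x. \<Prod>e\<in>Basis. flat_exp 1 (s * (x \<bullet> e) + - s * (a \<bullet> e)) * flat_exp 1 (- s * (x \<bullet> e) + s * (b \<bullet> e)))"
    by (intro Ck_prod) auto
  then show ?thesis by (simp add: box_bump_def[abs_def] algebra_simps)
qed

lemma box_bump_nonzero_iff: "s > 0 \<Longrightarrow> box_bump s a b x \<noteq> 0 \<longleftrightarrow> x \<in> box a b"
  by (auto simp: box_bump_def flat_exp_one mem_box zero_less_mult_iff split: if_splits)

lemma box_bump_bounds: "0 \<le> box_bump s a b x" "box_bump s a b x \<le> 1"
proof -
  have *: "0 \<le> flat_exp 1 t" "flat_exp 1 t \<le> 1" for t by (auto simp: flat_exp_one)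
  show "0 \<le> box_bump s a b x" unfolding box_bump_def using * by (auto intro!: prod_nonneg)
  show "box_bump s a b x \<le> 1" unfolding box_bump_def using * by (intro prod_le_1 conjI mult_le_one) auto
qed

lemma box_bump_tendsto: "(\<lambda>n. box_bump (real (Suc n)) a b x) \<longlonglongrightarrow> indicator (box a b) x"
proof (cases "x \<in> box a b")
  case True
  have *: "(\<lambda>n. flat_exp 1 (real (Suc n) * t)) \<longlonglongrightarrow> 1" if "t > 0" for t
  proof -
    have "(\<lambda>n. exp (- (inverse t * inverse (real (Suc n))))) \<longlonglongrightarrow> exp (- (inverse t * 0))"
      by (intro tendsto_intros LIMSEQ_inverse_real_of_nat)
    moreover have "flat_exp 1 (real (Suc n) * t) = exp (- (inverse t * inverse (real (Suc n))))" for n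
      using that by (simp add: flat_exp_one zero_less_mult_iff field_simps del: of_nat_Suc)
    ultimately show ?thesis by simp
  qed
  have "(\<lambda>n. box_bump (real (Suc n)) a b x) \<longlonglongrightarrow> (\<Prod>e\<in>(Basis::'a set). 1 * 1)"
    unfolding box_bump_def using True by (intro tendsto_prod tendsto_mult *) (auto simp: mem_box)
  then show ?thesis using True by simp
next
  case False
  then show ?thesis using box_bump_nonzero_iff[of "real (Suc n)" a b x for n] by (simp del: of_nat_Suc)
qed

lemma box_bump_test:
  assumes "s > 0" "cbox a b \<subseteq> \<Omega>"
  shows "test_function \<Omega> (box_bump s a b)"
proof -
  have "{x. box_bump s a b x \<noteq> 0} = box a b" using box_bump_nonzero_iff[OF assms(1)] by auto
  moreover have "closure (box a b) \<subseteq> cbox a b" by (rule closure_minimal[OF box_subset_cbox closed_cbox])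
  ultimately show ?thesis
    using assms by (auto simp: test_function_def box_bump_Ck intro: compact_closure[THEN iffD2] bounded_box)
qed

section \<open>Calculus of test functions\<close>

lemma test_differentiable:
  assumes "test_function \<Omega> \<phi>"
  shows "\<phi> differentiable (at x)"
proof -
  have "Ck (Suc 0) \<phi>" using assms unfolding test_function_def by blast
  then show ?thesis by simp
qed

text \<open>The derivative is linear, so its values on \<open>Basis\<close>, which define
  \<open>gradient\<close>, determine it.\<close>

lemma test_has_derivative:
  assumes "test_function \<Omega> \<phi>"
  shows "(\<phi> has_derivative (\<lambda>h. gradient \<phi> x \<bullet> h)) (at x)"
proof -
  let ?D = "frechet_derivative \<phi> (at x)"
  have D: "(\<phi> has_derivative ?D) (at x)"
    using test_differentiable[OF assms] by (simp add: frechet_derivative_works)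
  then interpret linear ?D by (rule has_derivative_linear)
  have "?D = (\<lambda>h. gradient \<phi> x \<bullet> h)"
  proof
    fix h
    have "?D h = ?D (\<Sum>e\<in>Basis. (h \<bullet> e) *\<^sub>R e)" by (simp add: euclidean_representation)
    also have "\<dots> = (\<Sum>e\<in>Basis. (h \<bullet> e) * ?D e)" by (simp add: sum scale)
    also have "\<dots> = gradient \<phi> x \<bullet> h"
      by (simp add: gradient_def inner_sum_left inner_commute[of h] mult.commute)
    finally show "?D h = gradient \<phi> x \<bullet> h" .
  qed
  with D show ?thesis by simp
qed

lemma gradient_eqI: "(f has_derivative (\<lambda>h. g \<bullet> h)) (at x) \<Longrightarrow> gradient f x = g"
  by (simp add: gradient_def frechet_derivative_eqI euclidean_representation)

lemma gradient_inner_Basis: "e \<in> Basis \<Longrightarrow> gradient \<phi> x \<bullet> e = frechet_derivative \<phi> (at x) e"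
  by (simp add: gradient_def inner_sum_left inner_Basis if_distrib cong: if_cong)

lemma test_zero_outside: "test_function \<Omega> \<phi> \<Longrightarrow> x \<notin> closure {x. \<phi> x \<noteq> 0} \<Longrightarrow> \<phi> x = 0"
  by (metis (mono_tags, lifting) closure_subset mem_Collect_eq subsetD)

lemma test_gradient_zero_outside:
  assumes "test_function \<Omega> \<phi>" "x \<notin> closure {x. \<phi> x \<noteq> 0}"
  shows "gradient \<phi> x = 0"
proof (rule gradient_eqI)
  have "((\<lambda>x. 0) has_derivative (\<lambda>h. 0 \<bullet> h)) (at x)" by simp
  then show "(\<phi> has_derivative (\<lambda>h. 0 \<bullet> h)) (at x)"
    by (rule has_derivative_transform_within_open[OF _ open_Compl[OF closed_closure[of "{x. \<phi> x \<noteq> 0}"]]])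
      (use assms test_zero_outside in auto)
qed

lemma test_continuous: "test_function \<Omega> \<phi> \<Longrightarrow> continuous_on S \<phi>"
  by (meson Ck.simps(1) continuous_on_subset subset_UNIV test_function_def)

lemma test_gradient_continuous:
  assumes "test_function \<Omega> \<phi>" shows "continuous_on S (gradient \<phi>)"
proof -
  have "Ck (Suc 0) \<phi>" using assms unfolding test_function_def by blast
  then have "continuous_on UNIV (gradient \<phi>)"
    unfolding gradient_def[abs_def] by (auto intro!: continuous_intros)
  then show ?thesis using continuous_on_subset by blast
qed

lemma test_compact_support: "test_function \<Omega> \<phi> \<Longrightarrow> compact (closure {x. \<phi> x \<noteq> 0})"
  by (simp add: test_function_def)

lemma test_functionI:
  assumes "\<And>k. Ck k \<phi>" and K: "compact K" "K \<subseteq> \<Omega>" "\<And>x. x \<notin> K \<Longrightarrow> \<phi> x = 0"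
  shows "test_function \<Omega> \<phi>"
proof -
  have "closure {x. \<phi> x \<noteq> 0} \<subseteq> K" using K by (intro closure_minimal compact_imp_closed) auto
  then show ?thesis using assms by (auto simp: test_function_def intro: compact_closure[THEN iffD2] bounded_subset[OF compact_imp_bounded])
qed

lemma test_support:
  assumes "test_function \<Omega> \<phi>"
  obtains K where "compact K" "K \<subseteq> \<Omega>" "\<And>x. x \<notin> K \<Longrightarrow> \<phi> x = 0" "\<And>x. x \<notin> K \<Longrightarrow> gradient \<phi> x = 0"
  using assms test_zero_outside[OF assms] test_gradient_zero_outside[OF assms]
  unfolding test_function_def by blast

lemma test_Ck: "test_function \<Omega> \<phi> \<Longrightarrow> Ck k \<phi>"
  by (simp add: test_function_def)

lemma test_add:
  assumes "test_function \<Omega> \<phi>" "test_function \<Omega> \<psi>"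
  shows "test_function \<Omega> (\<lambda>x. \<phi> x + \<psi> x)"
proof -
  obtain K L where K: "compact K" "K \<subseteq> \<Omega>" "\<And>x. x \<notin> K \<Longrightarrow> \<phi> x = 0"
    and L: "compact L" "L \<subseteq> \<Omega>" "\<And>x. x \<notin> L \<Longrightarrow> \<psi> x = 0"
    using test_support[OF assms(1)] test_support[OF assms(2)] by metis
  show ?thesis
    by (rule test_functionI[OF _ compact_Un[OF K(1) L(1)]])
      (use K L assms in \<open>auto intro: Ck_add test_Ck\<close>)
qed

lemma test_mult:
  assumes "test_function \<Omega> \<phi>" "test_function \<Omega> \<psi>"
  shows "test_function \<Omega> (\<lambda>x. \<phi> x * \<psi> x)"
proof -
  obtain K where K: "compact K" "K \<subseteq> \<Omega>" "\<And>x. x \<notin> K \<Longrightarrow> \<phi> x = 0"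
    using test_support[OF assms(1)] by metis
  show ?thesis
    by (rule test_functionI[OF _ K(1,2)]) (use K assms in \<open>auto intro: Ck_mult test_Ck\<close>)
qed

lemma test_scale:
  assumes "test_function \<Omega> \<phi>"
  shows "test_function \<Omega> (\<lambda>x. c * \<phi> x)"
proof -
  obtain K where K: "compact K" "K \<subseteq> \<Omega>" "\<And>x. x \<notin> K \<Longrightarrow> \<phi> x = 0"
    using test_support[OF assms(1)] by metis
  show ?thesis
    by (rule test_functionI[OF _ K(1,2)]) (use K assms in \<open>auto intro: Ck_mult Ck_const test_Ck\<close>)
qed

lemma test_partial:
  assumes "test_function \<Omega> \<phi>" "e \<in> Basis"
  shows "test_function \<Omega> (\<lambda>x. gradient \<phi> x \<bullet> e)"
proof -
  obtain K where K: "compact K" "K \<subseteq> \<Omega>" "\<And>x. x \<notin> K \<Longrightarrow> gradient \<phi> x = 0"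
    using test_support[OF assms(1)] by metis
  show ?thesis
  proof (rule test_functionI[OF _ K(1,2)])
    fix k
    show "Ck k (\<lambda>x. gradient \<phi> x \<bullet> e)"
      using test_Ck[OF assms(1), of "Suc k"] assms(2) by (simp add: gradient_inner_Basis)
  qed (use K in auto)
qed

lemma gradient_add:
  assumes "test_function \<Omega> \<phi>" "test_function \<Omega> \<psi>"
  shows "gradient (\<lambda>x. \<phi> x + \<psi> x) x = gradient \<phi> x + gradient \<psi> x"
  using has_derivative_add[OF test_has_derivative[OF assms(1)] test_has_derivative[OF assms(2)]]
  by (intro gradient_eqI) (simp add: inner_add_left)

lemma gradient_mult:
  assumes "test_function \<Omega> \<phi>" "test_function \<Omega> \<psi>"
  shows "gradient (\<lambda>x. \<phi> x * \<psi> x) x = \<phi> x *\<^sub>R gradient \<psi> x + \<psi> x *\<^sub>R gradient \<phi> x"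
  using has_derivative_mult[OF test_has_derivative[OF assms(1)] test_has_derivative[OF assms(2)]]
  by (intro gradient_eqI) (simp add: inner_add_left mult.commute)

lemma gradient_scale:
  assumes "test_function \<Omega> \<phi>"
  shows "gradient (\<lambda>x. c * \<phi> x) x = c *\<^sub>R gradient \<phi> x"
  using has_derivative_mult_right[OF test_has_derivative[OF assms], of c] by (intro gradient_eqI) simp

section \<open>Compactly supported integrands and integration by parts\<close>

lemma compact_support_integrable:
  fixes f :: "'a::euclidean_space \<Rightarrow> 'b::euclidean_space"
  assumes "compact K" "continuous_on UNIV f" "\<And>x. x \<notin> K \<Longrightarrow> f x = 0"
  shows "integrable lborel f"
proof -
  have "integrable lborel (\<lambda>x. indicator K x *\<^sub>R f x)"
    using assms by (intro borel_integrable_compact) (auto intro: continuous_on_subset)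
  moreover have "(\<lambda>x. indicator K x *\<^sub>R f x) = f" using assms(3) by (auto simp: indicator_def fun_eq_iff)
  ultimately show ?thesis by simp
qed

text \<open>Carries integrals over \<Omega> for the completed measure to \<open>lborel\<close>,
  where translation invariance, Fubini and product measures are applied.\<close>

lemma lebesgue_on_integral_eq_lborel:
  fixes f :: "'a::euclidean_space \<Rightarrow> 'b::euclidean_space"
  assumes "open \<Omega>" "f \<in> borel_measurable borel" "\<And>x. x \<notin> \<Omega> \<Longrightarrow> f x = 0"
  shows "integral\<^sup>L (lebesgue_on \<Omega>) f = integral\<^sup>L lborel f"
    "integrable (lebesgue_on \<Omega>) f \<longleftrightarrow> integrable lborel f"
proof -
  have \<Omega>: "\<Omega> \<inter> space lebesgue \<in> sets lebesgue" using assms(1) by simp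
  have *: "(\<lambda>x. indicator \<Omega> x *\<^sub>R f x) = f" using assms(3) by (auto simp: indicator_def fun_eq_iff)
  show "integral\<^sup>L (lebesgue_on \<Omega>) f = integral\<^sup>L lborel f"
    using assms(2) by (simp add: integral_restrict_space[OF \<Omega>] * integral_completion)
  show "integrable (lebesgue_on \<Omega>) f \<longleftrightarrow> integrable lborel f"
    using assms(2) by (simp add: integrable_restrict_space[OF \<Omega>] * integrable_completion)
qed

lemma compact_support_L2:
  fixes f :: "'a::euclidean_space \<Rightarrow> 'b::euclidean_space"
  assumes "open \<Omega>" "compact K" "K \<subseteq> \<Omega>" "continuous_on UNIV f" "\<And>x. x \<notin> K \<Longrightarrow> f x = 0"
  shows "f \<in> L2_space \<Omega>"
proof -
  have fb: "f \<in> borel_measurable borel" using assms(4) by (rule borel_measurable_continuous_onI)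
  then have "f \<in> borel_measurable lebesgue" by (intro measurable_completion) simp
  then have "f \<in> borel_measurable (lebesgue_on \<Omega>)" by (rule measurable_restrict_space1)
  moreover have "integrable lborel (\<lambda>x. f x \<bullet> f x)"
    using assms by (intro compact_support_integrable[of K] continuous_intros) auto
  then have "integrable (lebesgue_on \<Omega>) (\<lambda>x. f x \<bullet> f x)"
    using assms fb by (subst lebesgue_on_integral_eq_lborel(2)) auto
  ultimately show ?thesis by (simp add: L2_iff_inner)
qed

lemma test_L2:
  assumes "open \<Omega>" "test_function \<Omega> \<phi>"
  shows "\<phi> \<in> L2_space \<Omega>" "gradient \<phi> \<in> L2_space \<Omega>"
proof -
  obtain K where K: "compact K" "K \<subseteq> \<Omega>" "\<And>x. x \<notin> K \<Longrightarrow> \<phi> x = 0" "\<And>x. x \<notin> K \<Longrightarrow> gradient \<phi> x = 0"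
    using test_support[OF assms(2)] by metis
  show "\<phi> \<in> L2_space \<Omega>"
    by (rule compact_support_L2[OF assms(1) K(1,2) test_continuous[OF assms(2)] K(3)])
  show "gradient \<phi> \<in> L2_space \<Omega>"
    by (rule compact_support_L2[OF assms(1) K(1,2) test_gradient_continuous[OF assms(2)] K(4)])
qed

lemma compact_support_bounded:
  fixes f :: "'a::euclidean_space \<Rightarrow> 'b::euclidean_space"
  assumes "compact K" "continuous_on UNIV f" "\<And>x. x \<notin> K \<Longrightarrow> f x = 0"
  obtains B where "B > 0" "\<And>x. norm (f x) \<le> B"
proof -
  have "bounded (f ` K)"
    using assms by (intro compact_imp_bounded compact_continuous_image) (auto intro: continuous_on_subset)
  then obtain B where B: "B > 0" "\<And>x. x \<in> K \<Longrightarrow> norm (f x) \<le> B" by (auto simp: bounded_pos)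
  then have "norm (f x) \<le> B" for x using assms(3)[of x] by (cases "x \<in> K") auto
  with B(1) that show ?thesis by blast
qed

lemma test_bounded:
  assumes "test_function \<Omega> \<phi>"
  obtains B where "B > 0" "\<And>x. \<bar>\<phi> x\<bar> \<le> B" "\<And>x. norm (gradient \<phi> x) \<le> B"
proof -
  obtain B1 where B1: "B1 > 0" "\<And>x. norm (\<phi> x) \<le> B1"
    using compact_support_bounded[OF test_compact_support[OF assms] test_continuous[OF assms] test_zero_outside[OF assms]] by blast
  obtain B2 where B2: "B2 > 0" "\<And>x. norm (gradient \<phi> x) \<le> B2"
    using compact_support_bounded[OF test_compact_support[OF assms] test_gradient_continuous[OF assms] test_gradient_zero_outside[OF assms]] by blast
  show ?thesis using that[of "max B1 B2"] B1 B2 by (auto simp: le_max_iff_disj)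
qed

lemma lborel_integral_translation:
  fixes f :: "'a::euclidean_space \<Rightarrow> 'b::euclidean_space"
  assumes "f \<in> borel_measurable borel"
  shows "(LINT x|lborel. f (x + c)) = (LINT x|lborel. f x)"
proof -
  have "(LINT x|lborel. f x) = (LINT x|distr lborel borel ((+) c). f x)" by (simp add: lborel_distr_plus)
  also have "\<dots> = (LINT x|lborel. f (c + x))" using assms by (subst integral_distr) auto
  finally show ?thesis by (simp add: add.commute)
qed

lemma lborel_nn_integral_translation:
  fixes f :: "'a::euclidean_space \<Rightarrow> ennreal"
  assumes "f \<in> borel_measurable borel"
  shows "(\<integral>\<^sup>+x. f (x + c) \<partial>lborel) = (\<integral>\<^sup>+x. f x \<partial>lborel)"
proof -
  have "(\<integral>\<^sup>+x. f x \<partial>lborel) = (\<integral>\<^sup>+x. f x \<partial>distr lborel borel ((+) c))" by (simp add: lborel_distr_plus)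
  also have "\<dots> = (\<integral>\<^sup>+x. f (c + x) \<partial>lborel)" using assms by (subst nn_integral_distr) auto
  finally show ?thesis by (simp add: add.commute)
qed

lemma test_lipschitz:
  assumes "test_function \<Omega> \<phi>" "\<And>x. norm (gradient \<phi> x) \<le> B"
  shows "\<bar>\<phi> x - \<phi> y\<bar> \<le> B * norm (x - y)"
proof -
  have "norm (\<phi> x - \<phi> y) \<le> B * norm (x - y)"
  proof (rule differentiable_bound[of UNIV \<phi> "\<lambda>x h. gradient \<phi> x \<bullet> h"])
    show "onorm ((\<bullet>) (gradient \<phi> z)) \<le> B" for z
    proof (rule onorm_le)
      fix h
      have "norm (gradient \<phi> z \<bullet> h) \<le> norm (gradient \<phi> z) * norm h"
        using Cauchy_Schwarz_ineq2 by simp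
      also have "\<dots> \<le> B * norm h" by (intro mult_right_mono assms) simp
      finally show "norm (gradient \<phi> z \<bullet> h) \<le> B * norm h" .
    qed
  qed (use test_has_derivative[OF assms(1)] in auto)
  then show ?thesis by simp
qed

text \<open>Difference quotients have integral zero by translation invariance.\<close>

lemma test_partial_integral_zero:
  assumes "test_function \<Omega> \<phi>" "e \<in> Basis"
  shows "(LINT x|lborel. gradient \<phi> x \<bullet> e) = 0"
proof -
  obtain B where B: "B > 0" "\<And>x. norm (gradient \<phi> x) \<le> B" using test_bounded[OF assms(1)] by metis
  obtain R where R: "\<And>x. x \<in> closure {x. \<phi> x \<noteq> 0} \<Longrightarrow> norm x \<le> R"
    using compact_imp_bounded[OF test_compact_support[OF assms(1)]] by (auto simp: bounded_iff)
  define g where "g n x = (\<phi> (x + inverse (real (Suc n)) *\<^sub>R e) - \<phi> x) / inverse (real (Suc n))" for n x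
  have [measurable]: "\<phi> \<in> borel_measurable borel" "gradient \<phi> \<in> borel_measurable borel"
    using test_continuous[OF assms(1)] test_gradient_continuous[OF assms(1)] by (auto intro: borel_measurable_continuous_onI)
  have int: "integrable lborel \<phi>"
    using test_compact_support[OF assms(1)] test_continuous[OF assms(1)] test_zero_outside[OF assms(1)]
    by (rule compact_support_integrable)
  \<comment> \<open>The quotients vanish unless x lies within distance 1 of the ball of radius R,
    since the shift has length at most 1; there the gradient bound B dominates them.\<close>
  have "(\<lambda>n. LINT x|lborel. g n x) \<longlonglongrightarrow> (LINT x|lborel. gradient \<phi> x \<bullet> e)"
  proof (rule integral_dominated_convergence[where w="\<lambda>x. indicator (cball 0 (R + 1)) x *\<^sub>R B"])
    show "integrable lborel (\<lambda>x. indicator (cball 0 (R + 1)) x *\<^sub>R B)"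
      by (intro borel_integrable_compact) auto
    show "AE x in lborel. (\<lambda>n. g n x) \<longlonglongrightarrow> gradient \<phi> x \<bullet> e"
    proof (intro AE_I2)
      fix x :: 'a
      have "((\<lambda>t. x + t *\<^sub>R e) has_derivative (\<lambda>t. t *\<^sub>R e)) (at 0)"
        by (auto intro!: derivative_eq_intros)
      from has_derivative_compose[OF this, of \<phi> "\<lambda>h. gradient \<phi> x \<bullet> h"] test_has_derivative[OF assms(1), of x]
      have "((\<lambda>t. \<phi> (x + t *\<^sub>R e)) has_derivative (\<lambda>t. gradient \<phi> x \<bullet> (t *\<^sub>R e))) (at 0)"
        by simp
      then have "((\<lambda>t. \<phi> (x + t *\<^sub>R e)) has_real_derivative (gradient \<phi> x \<bullet> e)) (at 0)"
        by (simp add: has_field_derivative_def mult.commute[of _ "gradient \<phi> x \<bullet> e"])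
      then have "((\<lambda>h. (\<phi> (x + h *\<^sub>R e) - \<phi> x) / h) \<longlongrightarrow> gradient \<phi> x \<bullet> e) (at 0)"
        by (simp add: DERIV_def)
      moreover have "filterlim (\<lambda>n. inverse (real (Suc n))) (at 0) sequentially"
        using LIMSEQ_inverse_real_of_nat by (auto simp: filterlim_at simp del: of_nat_Suc)
      ultimately show "(\<lambda>n. g n x) \<longlonglongrightarrow> gradient \<phi> x \<bullet> e"
        unfolding g_def by (rule filterlim_compose)
    qed
    fix n
    show "AE x in lborel. norm (g n x) \<le> indicator (cball 0 (R + 1)) x *\<^sub>R B"
    proof (intro AE_I2)
      fix x
      let ?t = "inverse (real (Suc n))"
      have t: "0 < ?t" "?t \<le> 1" by (auto simp: field_simps)
      have ne: "norm (?t *\<^sub>R e) \<le> 1" using t assms(2) by (simp del: of_nat_Suc)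
      show "norm (g n x) \<le> indicator (cball 0 (R + 1)) x *\<^sub>R B"
      proof (cases "norm x \<le> R + 1")
        case True
        have "\<bar>\<phi> (x + ?t *\<^sub>R e) - \<phi> x\<bar> \<le> B * norm (x + ?t *\<^sub>R e - x)"
          by (rule test_lipschitz[OF assms(1) B(2)])
        also have "\<dots> = B * ?t" using assms(2) t by (simp del: of_nat_Suc)
        finally have "norm (g n x) \<le> B"
          using t unfolding g_def by (simp add: abs_divide pos_divide_le_eq del: of_nat_Suc)
        then show ?thesis using True by simp
      next
        case False
        have "norm x \<le> norm (x + ?t *\<^sub>R e) + norm (?t *\<^sub>R e)"
          using norm_triangle_ineq4[of "x + ?t *\<^sub>R e" "?t *\<^sub>R e"] by simp
        then have "norm (x + ?t *\<^sub>R e) > R" "norm x > R" using False ne by linarith+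
        then have "\<phi> (x + ?t *\<^sub>R e) = 0" "\<phi> x = 0" using R test_zero_outside[OF assms(1)] by (meson not_less)+
        then show ?thesis using False by (simp add: g_def)
      qed
    qed
  qed (auto simp: g_def)
  moreover have "(LINT x|lborel. g n x) = 0" for n
  proof -
    have "integrable lborel (\<lambda>x. \<phi> (x + inverse (real (Suc n)) *\<^sub>R e))"
    proof (rule compact_support_integrable[where K="cball 0 (R + norm (inverse (real (Suc n)) *\<^sub>R e))"])
      show "continuous_on UNIV (\<lambda>x. \<phi> (x + inverse (real (Suc n)) *\<^sub>R e))"
        by (rule continuous_on_compose2[OF test_continuous[OF assms(1), of UNIV]]) (auto intro!: continuous_intros)
      fix x :: 'a assume "x \<notin> cball 0 (R + norm (inverse (real (Suc n)) *\<^sub>R e))"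
      then have "norm (x + inverse (real (Suc n)) *\<^sub>R e) > R"
        using norm_triangle_ineq4[of "x + inverse (real (Suc n)) *\<^sub>R e" "inverse (real (Suc n)) *\<^sub>R e"]
        by (simp del: of_nat_Suc norm_scaleR)
      then show "\<phi> (x + inverse (real (Suc n)) *\<^sub>R e) = 0" using R test_zero_outside[OF assms(1)] by (meson not_less)
    qed auto
    then show ?thesis using int unfolding g_def
      by (simp add: lborel_integral_translation del: of_nat_Suc)
  qed
  ultimately show ?thesis by (simp add: LIMSEQ_const_iff)
qed

text \<open>The product of two test functions is a test function, its partial derivatives integrate
  to zero, and the Leibniz rule splits that integral.\<close>

lemma test_weak_gradient:
  assumes "open \<Omega>" "test_function \<Omega> \<phi>"
  shows "is_weak_gradient \<Omega> \<phi> (gradient \<phi>)"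
  unfolding is_weak_gradient_def
proof (intro allI impI)
  fix \<psi> and e :: 'a assume \<psi>: "test_function \<Omega> \<psi>" and e: "e \<in> Basis"
  have [measurable]: "\<phi> \<in> borel_measurable borel" "gradient \<phi> \<in> borel_measurable borel"
    "\<psi> \<in> borel_measurable borel" "gradient \<psi> \<in> borel_measurable borel"
    using test_continuous[OF assms(2)] test_gradient_continuous[OF assms(2)]
     test_continuous[OF \<psi>] test_gradient_continuous[OF \<psi>] by (auto intro: borel_measurable_continuous_onI)
  obtain K L where "K \<subseteq> \<Omega>" "\<And>x. x \<notin> K \<Longrightarrow> \<phi> x = 0" "L \<subseteq> \<Omega>" "\<And>x. x \<notin> L \<Longrightarrow> \<psi> x = 0"
    using test_support[OF assms(2)] test_support[OF \<psi>] by metis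
  then have zero: "\<phi> x = 0" "\<psi> x = 0" if "x \<notin> \<Omega>" for x
    using that by blast+
  have cont: "continuous_on UNIV (\<lambda>x. \<phi> x * (gradient \<psi> x \<bullet> e))" "continuous_on UNIV (\<lambda>x. \<psi> x * (gradient \<phi> x \<bullet> e))"
    by (intro continuous_on_mult continuous_on_inner continuous_on_const
        test_continuous[OF assms(2)] test_continuous[OF \<psi>] test_gradient_continuous[OF assms(2)] test_gradient_continuous[OF \<psi>])+
  have "integrable lborel (\<lambda>x. \<phi> x * (gradient \<psi> x \<bullet> e))"
    by (rule compact_support_integrable[OF test_compact_support[OF assms(2)] cont(1)])
      (metis test_zero_outside[OF assms(2)] mult_zero_left)
  moreover have "integrable lborel (\<lambda>x. \<psi> x * (gradient \<phi> x \<bullet> e))"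
    by (rule compact_support_integrable[OF test_compact_support[OF \<psi>] cont(2)])
      (metis test_zero_outside[OF \<psi>] mult_zero_left)
  moreover have "(LINT x|lborel. \<phi> x * (gradient \<psi> x \<bullet> e) + \<psi> x * (gradient \<phi> x \<bullet> e)) = 0"
    using test_partial_integral_zero[OF test_mult[OF assms(2) \<psi>] e]
    by (simp add: gradient_mult[OF assms(2) \<psi>] inner_add_left)
  ultimately have "(LINT x|lborel. \<phi> x * (gradient \<psi> x \<bullet> e)) = - (LINT x|lborel. (gradient \<phi> x \<bullet> e) * \<psi> x)"
    by (simp add: mult.commute)
  then show "(LINT x|lebesgue_on \<Omega>. \<phi> x * (gradient \<psi> x \<bullet> e)) = - (LINT x|lebesgue_on \<Omega>. (gradient \<phi> x \<bullet> e) * \<psi> x)"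
    using zero by (simp add: lebesgue_on_integral_eq_lborel(1)[OF assms(1)])
qed

section \<open>Jets and weak gradients\<close>

definition jet :: "('a::euclidean_space \<Rightarrow> real) \<Rightarrow> 'a \<Rightarrow> real \<times> 'a" where
  "jet \<phi> x = (\<phi> x, gradient \<phi> x)"

text \<open>Pairs \<open>(u, \<nabla>u)\<close> with \<open>u \<in> H10 \<Omega>\<close>; working with pairs avoids the choice in \<open>weak_gradient\<close>.\<close>

definition jet_space :: "'a::euclidean_space set \<Rightarrow> ('a \<Rightarrow> real \<times> 'a) set" where
  "jet_space \<Omega> = {U \<in> L2_space \<Omega>. \<forall>\<epsilon>>0. \<exists>\<phi>. test_function \<Omega> \<phi> \<and> l2_norm \<Omega> (\<lambda>x. jet \<phi> x - U x) < \<epsilon>}"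

locale bounded_open =
  fixes \<Omega> :: "'a::euclidean_space set"
  assumes open_\<Omega>: "open \<Omega>" and bounded_\<Omega>: "bounded \<Omega>"
begin

lemma lmeasurable_\<Omega>: "\<Omega> \<in> lmeasurable"
  using bounded_\<Omega> open_\<Omega> by (rule lmeasurable_open)

lemma finite_measure_\<Omega>: "finite_measure (lebesgue_on \<Omega>)"
  by (rule finite_measure_lebesgue_on[OF lmeasurable_\<Omega>])

lemma jet_L2: "test_function \<Omega> \<phi> \<Longrightarrow> jet \<phi> \<in> L2_space \<Omega>"
  unfolding jet_def[abs_def] by (intro L2_Pair test_L2[OF open_\<Omega>])

lemma jet_space_L2: "U \<in> jet_space \<Omega> \<Longrightarrow> U \<in> L2_space \<Omega>"
  by (simp add: jet_space_def)

lemma jet_in_jet_space: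
  assumes "test_function \<Omega> \<phi>" shows "jet \<phi> \<in> jet_space \<Omega>"
  unfolding jet_space_def
proof (intro CollectI conjI allI impI jet_L2 assms)
  fix \<epsilon> :: real assume "\<epsilon> > 0"
  then have "l2_norm \<Omega> (\<lambda>x. jet \<phi> x - jet \<phi> x) < \<epsilon>" by (simp add: l2_norm_def l2_inner_def)
  then show "\<exists>\<psi>. test_function \<Omega> \<psi> \<and> l2_norm \<Omega> (\<lambda>x. jet \<psi> x - jet \<phi> x) < \<epsilon>" using assms by blast
qed

lemma jet_space_approx:
  assumes "U \<in> jet_space \<Omega>" "\<epsilon> > 0"
  obtains \<phi> where "test_function \<Omega> \<phi>" "l2_norm \<Omega> (\<lambda>x. jet \<phi> x - U x) < \<epsilon>"
  using assms by (auto simp: jet_space_def)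

lemma jet_space_sequence:
  assumes "U \<in> jet_space \<Omega>"
  shows "\<exists>\<phi>. (\<forall>n::nat. test_function \<Omega> (\<phi> n)) \<and> (\<lambda>n. l2_norm \<Omega> (\<lambda>x. jet (\<phi> n) x - U x)) \<longlonglongrightarrow> 0"
proof -
  have "\<forall>n. \<exists>\<phi>. test_function \<Omega> \<phi> \<and> l2_norm \<Omega> (\<lambda>x. jet \<phi> x - U x) < inverse (real (Suc n))"
    using assms unfolding jet_space_def by (auto simp del: of_nat_Suc)
  then obtain \<phi> where \<phi>: "\<And>n. test_function \<Omega> (\<phi> n)" "\<And>n. l2_norm \<Omega> (\<lambda>x. jet (\<phi> n) x - U x) < inverse (real (Suc n))"
    by metis
  have "(\<lambda>n. l2_norm \<Omega> (\<lambda>x. jet (\<phi> n) x - U x)) \<longlonglongrightarrow> 0"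
    by (rule Lim_null_comparison[OF _ LIMSEQ_inverse_real_of_nat])
      (use \<phi>(2) in \<open>auto simp: less_imp_le simp del: of_nat_Suc\<close>)
  with \<phi>(1) show ?thesis by blast
qed

lemma jet_space_closed:
  assumes "\<And>n. U n \<in> jet_space \<Omega>" "V \<in> L2_space \<Omega>" "(\<lambda>n. l2_norm \<Omega> (\<lambda>x. U n x - V x)) \<longlonglongrightarrow> 0"
  shows "V \<in> jet_space \<Omega>"
  unfolding jet_space_def
proof (intro CollectI conjI allI impI assms(2))
  fix \<epsilon> :: real assume "\<epsilon> > 0"
  then have "\<epsilon>/2 > 0" by simp
  from LIMSEQ_D[OF assms(3) this] obtain n where n: "l2_norm \<Omega> (\<lambda>x. U n x - V x) < \<epsilon>/2" by auto
  obtain \<phi> where \<phi>: "test_function \<Omega> \<phi>" "l2_norm \<Omega> (\<lambda>x. jet \<phi> x - U n x) < \<epsilon>/2"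
    using jet_space_approx[OF assms(1) \<open>\<epsilon>/2 > 0\<close>] by metis
  have "l2_norm \<Omega> (\<lambda>x. jet \<phi> x - V x) < \<epsilon>"
    using l2_norm_diff_triangle[OF jet_L2[OF \<phi>(1)] jet_space_L2[OF assms(1)[of n]] assms(2)] n \<phi>(2) by simp
  with \<phi>(1) show "\<exists>\<phi>. test_function \<Omega> \<phi> \<and> l2_norm \<Omega> (\<lambda>x. jet \<phi> x - V x) < \<epsilon>" by blast
qed

lemma jet_space_add:
  assumes "U \<in> jet_space \<Omega>" "V \<in> jet_space \<Omega>"
  shows "(\<lambda>x. U x + V x) \<in> jet_space \<Omega>"
  unfolding jet_space_def
proof (intro CollectI conjI allI impI L2_add jet_space_L2 assms)
  fix \<epsilon> :: real assume "\<epsilon> > 0"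
  then have "\<epsilon>/2 > 0" by simp
  obtain \<phi> where \<phi>: "test_function \<Omega> \<phi>" "l2_norm \<Omega> (\<lambda>x. jet \<phi> x - U x) < \<epsilon>/2"
    using jet_space_approx[OF assms(1) \<open>\<epsilon>/2 > 0\<close>] by metis
  obtain \<psi> where \<psi>: "test_function \<Omega> \<psi>" "l2_norm \<Omega> (\<lambda>x. jet \<psi> x - V x) < \<epsilon>/2"
    using jet_space_approx[OF assms(2) \<open>\<epsilon>/2 > 0\<close>] by metis
  have "l2_norm \<Omega> (\<lambda>x. (jet \<phi> x - U x) + (jet \<psi> x - V x)) < \<epsilon>"
    using l2_norm_triangle[OF L2_diff[OF jet_L2[OF \<phi>(1)] jet_space_L2[OF assms(1)]]
      L2_diff[OF jet_L2[OF \<psi>(1)] jet_space_L2[OF assms(2)]]] \<phi>(2) \<psi>(2) by simp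
  moreover have "(\<lambda>x. (jet \<phi> x - U x) + (jet \<psi> x - V x)) = (\<lambda>x. jet (\<lambda>x. \<phi> x + \<psi> x) x - (U x + V x))"
    by (simp add: jet_def gradient_add[OF \<phi>(1) \<psi>(1)] fun_eq_iff prod_eq_iff)
  ultimately show "\<exists>\<phi>. test_function \<Omega> \<phi> \<and> l2_norm \<Omega> (\<lambda>x. jet \<phi> x - (U x + V x)) < \<epsilon>"
    using test_add[OF \<phi>(1) \<psi>(1)] by metis
qed

lemma jet_space_scale:
  assumes "U \<in> jet_space \<Omega>"
  shows "(\<lambda>x. c *\<^sub>R U x) \<in> jet_space \<Omega>"
  unfolding jet_space_def
proof (intro CollectI conjI allI impI L2_scale jet_space_L2 assms)
  fix \<epsilon> :: real assume "\<epsilon> > 0"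
  then have "\<epsilon> / (\<bar>c\<bar> + 1) > 0" by (simp add: add_nonneg_pos)
  then obtain \<phi> where \<phi>: "test_function \<Omega> \<phi>" "l2_norm \<Omega> (\<lambda>x. jet \<phi> x - U x) < \<epsilon> / (\<bar>c\<bar> + 1)"
    using jet_space_approx[OF assms] by metis
  have "l2_norm \<Omega> (\<lambda>x. c *\<^sub>R (jet \<phi> x - U x)) \<le> (\<bar>c\<bar> + 1) * l2_norm \<Omega> (\<lambda>x. jet \<phi> x - U x)"
    unfolding l2_norm_scale by (intro mult_right_mono) auto
  also have "\<dots> < \<epsilon>" using \<phi>(2) by (simp add: pos_less_divide_eq add_nonneg_pos mult.commute)
  also have "(\<lambda>x. c *\<^sub>R (jet \<phi> x - U x)) = (\<lambda>x. jet (\<lambda>x. c * \<phi> x) x - c *\<^sub>R U x)"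
    by (simp add: jet_def gradient_scale[OF \<phi>(1)] fun_eq_iff prod_eq_iff algebra_simps)
  finally show "\<exists>\<phi>. test_function \<Omega> \<phi> \<and> l2_norm \<Omega> (\<lambda>x. jet \<phi> x - c *\<^sub>R U x) < \<epsilon>"
    using test_scale[OF \<phi>(1)] by metis
qed

lemma jet_space_diff:
  assumes "U \<in> jet_space \<Omega>" "V \<in> jet_space \<Omega>"
  shows "(\<lambda>x. U x - V x) \<in> jet_space \<Omega>"
  using jet_space_add[OF assms(1) jet_space_scale[OF assms(2), of "-1"]] by simp

text \<open>Written as orthogonality in L2 to the pairs (\<partial>_e \<psi>, \<psi> e), being a
  weak gradient is a closed linear condition on (u, g), which therefore passes to L2 limits of
  jets.\<close>

lemma is_weak_gradient_iff:
  assumes "U \<in> L2_space \<Omega>"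
  shows "is_weak_gradient \<Omega> (\<lambda>x. fst (U x)) (\<lambda>x. snd (U x)) \<longleftrightarrow>
    (\<forall>\<psi> e. test_function \<Omega> \<psi> \<longrightarrow> e \<in> Basis \<longrightarrow> l2_inner \<Omega> U (\<lambda>x. (gradient \<psi> x \<bullet> e, \<psi> x *\<^sub>R e)) = 0)"
proof -
  have "(LINT x|lebesgue_on \<Omega>. fst (U x) * (gradient \<psi> x \<bullet> e)) = - (LINT x|lebesgue_on \<Omega>. (snd (U x) \<bullet> e) * \<psi> x) \<longleftrightarrow>
      l2_inner \<Omega> U (\<lambda>x. (gradient \<psi> x \<bullet> e, \<psi> x *\<^sub>R e)) = 0"
    if \<psi>: "test_function \<Omega> \<psi>" and e: "e \<in> Basis" for \<psi> and e :: 'a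
  proof -
    have 1: "integrable (lebesgue_on \<Omega>) (\<lambda>x. fst (U x) * (gradient \<psi> x \<bullet> e))"
      using L2_inner_integrable[OF L2_fst_snd(1)[OF assms] test_L2(1)[OF open_\<Omega> test_partial[OF \<psi> e]]] by simp
    have "(\<lambda>x. snd (U x) \<bullet> e) \<in> L2_space \<Omega>"
      by (rule L2_component[OF L2_fst_snd(2)[OF assms] e])
    from L2_inner_integrable[OF this test_L2(1)[OF open_\<Omega> \<psi>]]
    have 2: "integrable (lebesgue_on \<Omega>) (\<lambda>x. (snd (U x) \<bullet> e) * \<psi> x)" by simp
    have "l2_inner \<Omega> U (\<lambda>x. (gradient \<psi> x \<bullet> e, \<psi> x *\<^sub>R e)) =
      (LINT x|lebesgue_on \<Omega>. fst (U x) * (gradient \<psi> x \<bullet> e)) + (LINT x|lebesgue_on \<Omega>. (snd (U x) \<bullet> e) * \<psi> x)"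
      unfolding l2_inner_def using 1 2 by (simp add: inner_prod_def mult.commute)
    then show ?thesis by linarith
  qed
  then show ?thesis unfolding is_weak_gradient_def by blast
qed

lemma test_pair_L2:
  assumes "test_function \<Omega> \<psi>" "e \<in> Basis"
  shows "(\<lambda>x. (gradient \<psi> x \<bullet> e, \<psi> x *\<^sub>R e)) \<in> L2_space \<Omega>"
proof (rule L2_Pair)
  show "(\<lambda>x. gradient \<psi> x \<bullet> e) \<in> L2_space \<Omega>" by (rule test_L2(1)[OF open_\<Omega> test_partial[OF assms]])
  obtain K where K: "compact K" "K \<subseteq> \<Omega>" "\<And>x. x \<notin> K \<Longrightarrow> \<psi> x = 0"
    using test_support[OF assms(1)] by metis
  show "(\<lambda>x. \<psi> x *\<^sub>R e) \<in> L2_space \<Omega>"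
    by (rule compact_support_L2[OF open_\<Omega> K(1,2)])
      (simp_all add: K(3) continuous_on_scaleR test_continuous[OF assms(1)])
qed

lemma jet_space_weak_gradient:
  assumes "U \<in> jet_space \<Omega>"
  shows "is_weak_gradient \<Omega> (\<lambda>x. fst (U x)) (\<lambda>x. snd (U x))"
  unfolding is_weak_gradient_iff[OF jet_space_L2[OF assms]]
proof (intro allI impI)
  fix \<psi> and e :: 'a assume *: "test_function \<Omega> \<psi>" "e \<in> Basis"
  obtain \<phi> where \<phi>: "\<And>n::nat. test_function \<Omega> (\<phi> n)" "(\<lambda>n. l2_norm \<Omega> (\<lambda>x. jet (\<phi> n) x - U x)) \<longlonglongrightarrow> 0"
    using jet_space_sequence[OF assms] by blast
  have "(\<lambda>n. l2_inner \<Omega> (jet (\<phi> n)) (\<lambda>x. (gradient \<psi> x \<bullet> e, \<psi> x *\<^sub>R e))) \<longlonglongrightarrow>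
      l2_inner \<Omega> U (\<lambda>x. (gradient \<psi> x \<bullet> e, \<psi> x *\<^sub>R e))"
    by (rule l2_inner_tendsto[OF jet_L2[OF \<phi>(1)] jet_space_L2[OF assms] test_pair_L2[OF *] \<phi>(2)])
  moreover have "l2_inner \<Omega> (jet (\<phi> n)) (\<lambda>x. (gradient \<psi> x \<bullet> e, \<psi> x *\<^sub>R e)) = 0" for n
    using is_weak_gradient_iff[OF jet_L2[OF \<phi>(1)[of n]]] test_weak_gradient[OF open_\<Omega> \<phi>(1)[of n]] *
    by (simp add: jet_def)
  ultimately show "l2_inner \<Omega> U (\<lambda>x. (gradient \<psi> x \<bullet> e, \<psi> x *\<^sub>R e)) = 0"
    by (simp add: LIMSEQ_const_iff)
qed

section \<open>The fundamental lemma of the calculus of variations and uniqueness of weak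
  gradients\<close>

lemma set_integral_zero_imp_nonpos:
  fixes f :: "'a \<Rightarrow> real"
  assumes f: "integrable (lebesgue_on \<Omega>) f"
    and zero: "\<And>A. A \<in> sets borel \<Longrightarrow> (LINT x|lebesgue_on \<Omega>. indicator A x * f x) = 0"
  shows "AE x in lebesgue_on \<Omega>. f x \<le> 0"
proof -
  let ?M = "lebesgue_on \<Omega>"
  have \<Omega>l: "\<Omega> \<in> sets lebesgue" using lmeasurable_\<Omega> by (rule fmeasurableD)
  have [measurable]: "f \<in> borel_measurable ?M" using f by simp
  \<comment> \<open>S is only Lebesgue measurable, while the hypothesis speaks of Borel sets; S is
    therefore exchanged for a Borel set A from which it differs inside a null set.\<close>
  define S where "S = {x\<in>space ?M. f x > 0}"
  have S: "S \<in> sets ?M" unfolding S_def by measurable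
  then have "S \<in> sets lebesgue" using \<Omega>l by (simp add: sets_restrict_space_iff)
  then obtain A N N' where A: "S = A \<union> N" "N \<subseteq> N'" "N' \<in> null_sets lborel" "A \<in> sets lborel"
    by (elim sets_completionE) auto
  have "N' \<in> null_sets lebesgue" using A(3) by (simp add: null_sets_completionI)
  then have "AE x in lebesgue. x \<notin> N'" by (rule AE_not_in)
  then have N': "AE x in ?M. x \<notin> N'" using \<Omega>l by (simp add: AE_restrict_space_iff eventually_mono)
  have "(LINT x|?M. indicator S x * f x) = (LINT x|?M. indicator A x * f x)"
  proof (rule integral_cong_AE)
    have "(indicator A :: 'a \<Rightarrow> real) \<in> borel_measurable lebesgue" using A(4)
      by (intro measurable_completion borel_measurable_indicator) simp
    then have [measurable]: "(indicator A :: 'a \<Rightarrow> real) \<in> borel_measurable ?M" by (rule measurable_restrict_space1)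
    show "(\<lambda>x. indicator A x * f x) \<in> borel_measurable ?M" by measurable
    show "(\<lambda>x. indicator S x * f x) \<in> borel_measurable ?M" using S by measurable
    show "AE x in ?M. indicator S x * f x = indicator A x * f x"
      using N' by eventually_elim (use A in \<open>auto simp: indicator_def\<close>)
  qed
  also have "\<dots> = 0" using A(4) zero by simp
  finally have "(LINT x|?M. indicator S x * f x) = 0" .
  moreover have "integrable ?M (\<lambda>x. indicator S x * f x)"
    using integrable_mult_indicator[OF S f] by simp
  moreover have "AE x in ?M. 0 \<le> indicator S x * f x" by (auto simp: S_def indicator_def)
  ultimately have "AE x in ?M. indicator S x * f x = 0"
    using integral_nonneg_eq_0_iff_AE by blast
  then show ?thesis
    using AE_space by eventually_elim (auto simp: S_def indicator_def split: if_splits)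
qed

text \<open>Smooth bumps give zero integrals over boxes with closure in \<Omega>. As boxes are
  stable under intersection, a Dynkin argument extends this to Borel subsets of such a box, which
  forces f = 0 there almost everywhere; countably many boxes cover \<Omega> up to a null
  set.\<close>

lemma fundamental_lemma:
  fixes f :: "'a \<Rightarrow> real"
  assumes "f \<in> L2_space \<Omega>"
    and test: "\<And>\<psi>. test_function \<Omega> \<psi> \<Longrightarrow> (LINT x|lebesgue_on \<Omega>. f x * \<psi> x) = 0"
  shows "ae_eq \<Omega> f (\<lambda>x. 0)"
proof -
  let ?M = "lebesgue_on \<Omega>"
  have \<Omega>l: "\<Omega> \<in> sets lebesgue" using lmeasurable_\<Omega> by (rule fmeasurableD)
  have f: "integrable ?M f" by (rule L2_imp_integrable(1)[OF lmeasurable_\<Omega> assms(1)])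
  have [measurable]: "f \<in> borel_measurable ?M" using f by simp
  have borel_ind [measurable]: "(indicator A :: 'a \<Rightarrow> real) \<in> borel_measurable ?M" if "A \<in> sets borel" for A
    using that by (intro measurable_restrict_space1 measurable_completion borel_measurable_indicator) simp
  have int_ind: "integrable ?M (\<lambda>x. indicator A x * f x)" if "A \<in> sets borel" for A
  proof (rule Bochner_Integration.integrable_bound[OF f])
    show "(\<lambda>x. indicator A x * f x) \<in> borel_measurable ?M" using borel_ind[OF that] by measurable
    show "AE x in ?M. norm (indicator A x * f x) \<le> norm (f x)" by (auto simp: indicator_def)
  qed
  have box0: "(LINT x|?M. indicator (box a b) x * f x) = 0" if "cbox a b \<subseteq> \<Omega>" for a b
  proof -
    have "(\<lambda>n. LINT x|?M. f x * box_bump (real (Suc n)) a b x) \<longlonglongrightarrow> (LINT x|?M. indicator (box a b) x * f x)"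
    proof (rule integral_dominated_convergence[where w="\<lambda>x. \<bar>f x\<bar>"])
      show "(\<lambda>x. indicator (box a b) x * f x) \<in> borel_measurable ?M" using borel_ind[of "box a b"] by measurable
      fix n
      have "box_bump (real (Suc n)) a b \<in> borel_measurable ?M"
        using test_continuous[OF box_bump_test[OF _ that, of "real (Suc n)"], of UNIV]
        by (intro measurable_restrict_space1 measurable_completion) (simp add: borel_measurable_continuous_onI del: of_nat_Suc)
      then show "(\<lambda>x. f x * box_bump (real (Suc n)) a b x) \<in> borel_measurable ?M" by measurable
      show "AE x in ?M. norm (f x * box_bump (real (Suc n)) a b x) \<le> \<bar>f x\<bar>"
        using box_bump_bounds[of "real (Suc n)" a b] by (simp add: abs_mult mult_left_le del: of_nat_Suc)
    next
      show "AE x in ?M. (\<lambda>n. f x * box_bump (real (Suc n)) a b x) \<longlonglongrightarrow> indicator (box a b) x * f x"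
        unfolding mult.commute[of "indicator (box a b) _"]
        by (intro AE_I2 tendsto_mult_left box_bump_tendsto)
    qed (use f in auto)
    moreover have "(LINT x|?M. f x * box_bump (real (Suc n)) a b x) = 0" for n
      by (rule test[OF box_bump_test[OF _ that]]) simp
    ultimately show ?thesis by (simp add: LIMSEQ_const_iff)
  qed
  \<comment> \<open>Localizing to a box whose closure lies in \<Omega> keeps every intersection
    inside \<Omega> and makes complements harmless: the whole space contributes the integral over
    \<open>box c d\<close>, which is already 0.\<close>
  have cell: "AE x in ?M. x \<in> box c d \<longrightarrow> f x = 0" if cd: "cbox c d \<subseteq> \<Omega>" for c d
  proof -
    have zero: "(LINT x|?M. indicator A x * (indicator (box c d) x * f x)) = 0" if "A \<in> sets borel" for A
    proof -
      have "Int_stable (range (\<lambda>(a, b). box a b :: 'a set))"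
        by (auto simp: Int_stable_def box_Int_box)
      moreover have "range (\<lambda>(a, b). box a b) \<subseteq> Pow (UNIV :: 'a set)" by simp
      moreover have "A \<in> sigma_sets UNIV (range (\<lambda>(a, b). box a b))" using that unfolding borel_eq_box by simp
      ultimately show ?thesis
      proof (induction rule: sigma_sets_induct_disjoint)
        case (basic A)
        then obtain a b where A: "A = box a b" by auto
        define p q where "p = (\<Sum>i\<in>Basis. max (a\<bullet>i) (c\<bullet>i) *\<^sub>R i)" and "q = (\<Sum>i\<in>Basis. min (b\<bullet>i) (d\<bullet>i) *\<^sub>R i)"
        have "box a b \<inter> box c d = box p q" unfolding p_def q_def by (rule box_Int_box)
        then have "indicator A x * (indicator (box c d) x * f x) = indicator (box p q) x * f x" for x
          unfolding A by (metis indicator_inter_arith mult.assoc)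
        moreover have "cbox p q \<subseteq> cbox c d" by (auto simp: p_def q_def mem_box)
        ultimately show ?case using box0[of p q] cd by (simp only:)
      next
        case empty
        then show ?case by simp
      next
        case (compl A)
        then have A: "A \<in> sets borel" unfolding borel_eq_box by simp
        have "(LINT x|?M. indicator (UNIV - A) x * (indicator (box c d) x * f x)) =
            (LINT x|?M. indicator (box c d) x * f x - indicator A x * (indicator (box c d) x * f x))"
          by (intro Bochner_Integration.integral_cong) (auto simp: indicator_def)
        also have "\<dots> = (LINT x|?M. indicator (box c d) x * f x) - (LINT x|?M. indicator A x * (indicator (box c d) x * f x))"
        proof (rule Bochner_Integration.integral_diff)
          show "integrable ?M (\<lambda>x. indicator (box c d) x * f x)" by (rule int_ind) simp
          have "integrable ?M (\<lambda>x. indicator (A \<inter> box c d) x * f x)" by (rule int_ind) (use A in simp)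
          then show "integrable ?M (\<lambda>x. indicator A x * (indicator (box c d) x * f x))"
            by (simp add: indicator_inter_arith mult.assoc)
        qed
        also have "\<dots> = 0" using box0[OF cd] compl by simp
        finally show ?case .
      next
        case (union A)
        then have A: "A i \<in> sets borel" for i unfolding borel_eq_box by (auto simp: sigma_sets.Union)
        have part: "(\<Sum>i<n. indicator (A i) x * (indicator (box c d) x * f x)) =
            indicator (\<Union>i<n. A i) x * (indicator (box c d) x * f x)" for n :: nat and x
        proof -
          have "disjoint_family_on A {..<n}" using union(1) by (rule disjoint_family_on_mono[rotated]) simp
          then have "(\<Sum>i<n. indicator (A i) x :: real) = indicator (\<Union>i<n. A i) x"
            by (simp add: indicator_UN_disjoint)
          then show ?thesis by (simp flip: sum_distrib_right)
        qed
        have "(\<lambda>n. LINT x|?M. (\<Sum>i<n. indicator (A i) x * (indicator (box c d) x * f x))) \<longlonglongrightarrow>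
            (LINT x|?M. indicator (\<Union>i. A i) x * (indicator (box c d) x * f x))"
        proof (rule integral_dominated_convergence[where w="\<lambda>x. \<bar>f x\<bar>"])
          show "(\<lambda>x. indicator (\<Union>i. A i) x * (indicator (box c d) x * f x)) \<in> borel_measurable ?M"
            using borel_ind[of "\<Union>i. A i"] borel_ind[of "box c d"] A by measurable
          show "(\<lambda>x. \<Sum>i<n. indicator (A i) x * (indicator (box c d) x * f x)) \<in> borel_measurable ?M" for n
            using borel_ind[OF A] borel_ind[of "box c d"] by measurable
          show "AE x in ?M. (\<lambda>n. \<Sum>i<n. indicator (A i) x * (indicator (box c d) x * f x)) \<longlonglongrightarrow>
              indicator (\<Union>i. A i) x * (indicator (box c d) x * f x)"
            unfolding part by (intro AE_I2 tendsto_mult_right LIMSEQ_indicator_UN)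
          show "AE x in ?M. norm (\<Sum>i<n. indicator (A i) x * (indicator (box c d) x * f x)) \<le> \<bar>f x\<bar>" for n
            unfolding part by (auto simp: indicator_def)
        qed (use f in auto)
        moreover have "(LINT x|?M. (\<Sum>i<n. indicator (A i) x * (indicator (box c d) x * f x))) = 0" for n
        proof -
          have "integrable ?M (\<lambda>x. indicator (A i) x * (indicator (box c d) x * f x))" for i
            using int_ind[of "A i \<inter> box c d"] A by (simp add: indicator_inter_arith mult.assoc)
          then show ?thesis using union by (subst Bochner_Integration.integral_sum) auto
        qed
        ultimately show ?case by (simp add: LIMSEQ_const_iff)
      qed
    qed
    have int: "integrable ?M (\<lambda>x. indicator (box c d) x * f x)" by (rule int_ind) simp
    have 1: "AE x in ?M. indicator (box c d) x * f x \<le> 0"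
      by (rule set_integral_zero_imp_nonpos[OF int zero])
    have "AE x in ?M. - (indicator (box c d) x * f x) \<le> 0"
      by (rule set_integral_zero_imp_nonpos) (use int zero in auto)
    with 1 show ?thesis by eventually_elim (auto simp: indicator_def split: if_splits)
  qed
  \<comment> \<open>\<Omega> is a countable union of closed boxes; each differs from its open box by
    a null set, so the result for open boxes suffices.\<close>
  obtain D where D: "countable D" "D \<subseteq> Pow \<Omega>" "\<And>X. X \<in> D \<Longrightarrow> \<exists>a b. X = cbox a b" "\<Union>D = \<Omega>"
    by (rule open_countable_Union_open_cbox[OF open_\<Omega>]) blast
  have "AE x in ?M. x \<in> X \<longrightarrow> f x = 0" if XD: "X \<in> D" for X
  proof -
    obtain a b where X: "X = cbox a b" using D(3)[OF XD] by auto
    have "cbox a b - box a b \<in> null_sets lebesgue"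
      using negligible_frontier_interval[of a b] by (simp add: negligible_iff_null_sets)
    then have "AE x in lebesgue. x \<notin> cbox a b - box a b" by (rule AE_not_in)
    then have "AE x in ?M. x \<notin> cbox a b - box a b" using \<Omega>l by (simp add: AE_restrict_space_iff eventually_mono)
    moreover have "AE x in ?M. x \<in> box a b \<longrightarrow> f x = 0" by (rule cell) (use D XD X in auto)
    ultimately show ?thesis unfolding X by eventually_elim auto
  qed
  then have "AE x in ?M. \<forall>X\<in>D. x \<in> X \<longrightarrow> f x = 0" by (subst AE_ball_countable[OF D(1)]) blast
  then have "AE x in ?M. f x = 0" using AE_space by eventually_elim (use D in auto)
  then show ?thesis by (simp add: ae_eq_def)
qed

text \<open>Each coordinate of the difference of two weak gradients is annihilated by all test
  functions. This makes integrals of the chosen \<open>weak_gradient\<close> independent of the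
  choice.\<close>

lemma weak_gradient_unique:
  assumes "u \<in> L2_space \<Omega>" "g \<in> L2_space \<Omega>" "is_weak_gradient \<Omega> u g" "h \<in> L2_space \<Omega>" "is_weak_gradient \<Omega> u h"
  shows "ae_eq \<Omega> g h"
proof -
  have *: "AE x in lebesgue_on \<Omega>. (g x - h x) \<bullet> e = 0" if e: "e \<in> Basis" for e
  proof -
    have "ae_eq \<Omega> (\<lambda>x. (g x - h x) \<bullet> e) (\<lambda>x. 0)"
    proof (rule fundamental_lemma[OF L2_component[OF L2_diff[OF assms(2,4)] e]])
      fix \<psi> assume \<psi>: "test_function \<Omega> \<psi>"
      have "integrable (lebesgue_on \<Omega>) (\<lambda>x. (g x \<bullet> e) * \<psi> x)" "integrable (lebesgue_on \<Omega>) (\<lambda>x. (h x \<bullet> e) * \<psi> x)"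
        using L2_inner_integrable[OF L2_component[OF assms(2) e] test_L2(1)[OF open_\<Omega> \<psi>]]
          L2_inner_integrable[OF L2_component[OF assms(4) e] test_L2(1)[OF open_\<Omega> \<psi>]] by simp_all
      moreover have "(LINT x|lebesgue_on \<Omega>. (g x \<bullet> e) * \<psi> x) = (LINT x|lebesgue_on \<Omega>. (h x \<bullet> e) * \<psi> x)"
        using assms(3)[unfolded is_weak_gradient_def, rule_format, OF \<psi> e]
          assms(5)[unfolded is_weak_gradient_def, rule_format, OF \<psi> e] by linarith
      ultimately show "(LINT x|lebesgue_on \<Omega>. (g x - h x) \<bullet> e * \<psi> x) = 0"
        by (simp add: inner_diff_left left_diff_distrib)
    qed
    then show ?thesis by (simp add: ae_eq_def)
  qed
  then have "AE x in lebesgue_on \<Omega>. \<forall>e\<in>Basis. (g x - h x) \<bullet> e = 0"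
    by (intro AE_finite_allI) auto
  then show ?thesis unfolding ae_eq_def
    by eventually_elim (auto intro: euclidean_eqI simp: inner_diff_left)
qed

section \<open>Identification of \<open>H10\<close> with the first components of jets\<close>

lemma H1_weak_gradient:
  assumes "u \<in> H1 \<Omega>"
  shows "u \<in> L2_space \<Omega>" "weak_gradient \<Omega> u \<in> L2_space \<Omega>" "is_weak_gradient \<Omega> u (weak_gradient \<Omega> u)"
proof -
  have "\<exists>g. g \<in> L2_space \<Omega> \<and> is_weak_gradient \<Omega> u g" using assms by (auto simp: H1_def)
  from someI_ex[OF this]
  show "weak_gradient \<Omega> u \<in> L2_space \<Omega>" "is_weak_gradient \<Omega> u (weak_gradient \<Omega> u)"
    by (auto simp: weak_gradient_def)
  show "u \<in> L2_space \<Omega>" using assms by (simp add: H1_def)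
qed

lemma jet_diff_inner:
  assumes "test_function \<Omega> \<phi>" "u \<in> L2_space \<Omega>" "g \<in> L2_space \<Omega>"
  shows "(LINT x|lebesgue_on \<Omega>. (\<phi> x - u x)\<^sup>2) + (LINT x|lebesgue_on \<Omega>. (norm (gradient \<phi> x - g x))\<^sup>2) =
    (l2_norm \<Omega> (\<lambda>x. jet \<phi> x - (u x, g x)))\<^sup>2"
  using l2_norm_fst_snd_le(1)[OF L2_diff[OF jet_L2[OF assms(1)] L2_Pair[OF assms(2,3)]]]
  by (simp add: l2_norm_square l2_inner_self_eq jet_def)

lemma H10_imp_jet_space:
  assumes "u \<in> H10 \<Omega>"
  shows "(\<lambda>x. (u x, weak_gradient \<Omega> u x)) \<in> jet_space \<Omega>"
proof -
  have "u \<in> H1 \<Omega>" using assms by (simp add: H10_def)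
  note H1 = H1_weak_gradient[OF this]
  obtain \<phi> :: "nat \<Rightarrow> 'a \<Rightarrow> real" where \<phi>: "\<And>n. test_function \<Omega> (\<phi> n)"
    "(\<lambda>n. (LINT x|lebesgue_on \<Omega>. (\<phi> n x - u x)\<^sup>2) +
          (LINT x|lebesgue_on \<Omega>. (norm (gradient (\<phi> n) x - weak_gradient \<Omega> u x))\<^sup>2)) \<longlonglongrightarrow> 0"
    using assms by (auto simp: H10_def)
  from \<phi>(2) have "(\<lambda>n. (l2_norm \<Omega> (\<lambda>x. jet (\<phi> n) x - (u x, weak_gradient \<Omega> u x)))\<^sup>2) \<longlonglongrightarrow> 0"
    by (simp add: jet_diff_inner[OF \<phi>(1) H1(1,2)])
  then have "(\<lambda>n. l2_norm \<Omega> (\<lambda>x. jet (\<phi> n) x - (u x, weak_gradient \<Omega> u x))) \<longlonglongrightarrow> 0"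
    by (simp add: tendsto_null_power)
  from jet_space_closed[OF jet_in_jet_space[OF \<phi>(1)] L2_Pair[OF H1(1,2)] this] show ?thesis .
qed

text \<open>The second component is itself a weak gradient, so by uniqueness it agrees almost
  everywhere with the one picked by \<open>SOME\<close>; test functions approximating the jet then
  also witness membership in \<open>H10\<close>.\<close>

lemma jet_space_imp_H10:
  assumes "U \<in> jet_space \<Omega>"
  shows "(\<lambda>x. fst (U x)) \<in> H10 \<Omega>" "ae_eq \<Omega> (weak_gradient \<Omega> (\<lambda>x. fst (U x))) (\<lambda>x. snd (U x))"
proof -
  let ?u = "\<lambda>x. fst (U x)" and ?g = "\<lambda>x. snd (U x)"
  note L2 = L2_fst_snd[OF jet_space_L2[OF assms]] and wg = jet_space_weak_gradient[OF assms]
  have H1: "?u \<in> H1 \<Omega>" using L2 wg by (auto simp: H1_def)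
  note wH1 = H1_weak_gradient[OF H1]
  show ae: "ae_eq \<Omega> (weak_gradient \<Omega> ?u) ?g"
    by (rule weak_gradient_unique[OF L2(1) wH1(2,3) L2(2) wg])
  obtain \<phi> where \<phi>: "\<And>n::nat. test_function \<Omega> (\<phi> n)" "(\<lambda>n. l2_norm \<Omega> (\<lambda>x. jet (\<phi> n) x - U x)) \<longlonglongrightarrow> 0"
    using jet_space_sequence[OF assms] by blast
  have "(\<lambda>n. (l2_norm \<Omega> (\<lambda>x. jet (\<phi> n) x - (?u x, weak_gradient \<Omega> ?u x)))\<^sup>2) \<longlonglongrightarrow> 0\<^sup>2"
  proof (intro tendsto_power)
    have "l2_norm \<Omega> (\<lambda>x. jet (\<phi> n) x - (?u x, weak_gradient \<Omega> ?u x)) = l2_norm \<Omega> (\<lambda>x. jet (\<phi> n) x - U x)" for n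
    proof -
      have "ae_eq \<Omega> (\<lambda>x. jet (\<phi> n) x - (?u x, weak_gradient \<Omega> ?u x)) (\<lambda>x. jet (\<phi> n) x - U x)"
        using ae unfolding ae_eq_def by eventually_elim (simp add: prod_eq_iff)
      moreover have "(\<lambda>x. jet (\<phi> n) x - (?u x, weak_gradient \<Omega> ?u x)) \<in> L2_space \<Omega>"
        by (rule L2_diff[OF jet_L2[OF \<phi>(1)] L2_Pair[OF L2(1) wH1(2)]])
      moreover have "(\<lambda>x. jet (\<phi> n) x - U x) \<in> L2_space \<Omega>"
        by (rule L2_diff[OF jet_L2[OF \<phi>(1)] jet_space_L2[OF assms]])
      ultimately show ?thesis unfolding l2_norm_def by (simp add: l2_inner_cong)
    qed
    then show "(\<lambda>n. l2_norm \<Omega> (\<lambda>x. jet (\<phi> n) x - (?u x, weak_gradient \<Omega> ?u x))) \<longlonglongrightarrow> 0" using \<phi>(2) by simp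
  qed
  then have "(\<lambda>n. (LINT x|lebesgue_on \<Omega>. (\<phi> n x - ?u x)\<^sup>2) +
          (LINT x|lebesgue_on \<Omega>. (norm (gradient (\<phi> n) x - weak_gradient \<Omega> ?u x))\<^sup>2)) \<longlonglongrightarrow> 0"
    by (simp add: jet_diff_inner[OF \<phi>(1) L2(1) wH1(2)])
  then show "?u \<in> H10 \<Omega>" using H1 \<phi>(1) unfolding H10_def by blast
qed

end

section \<open>The Sobolev inequality\<close>

lemma weighted_arith_geom_mean:
  fixes w y :: "'i \<Rightarrow> real"
  assumes "finite I" "\<And>i. i \<in> I \<Longrightarrow> 0 \<le> w i" "(\<Sum>i\<in>I. w i) = 1" "\<And>i. i \<in> I \<Longrightarrow> 0 \<le> y i"
  shows "(\<Prod>i\<in>I. y i powr w i) \<le> (\<Sum>i\<in>I. w i * y i)"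
proof (cases "\<exists>i\<in>I. y i = 0")
  \<comment> \<open>A zero entry makes the product zero whatever its weight, because
    \<open>0 powr 0 = 0\<close>. The other case is convexity of exp at the points
    \<open>ln (y i)\<close>.\<close>
  case True
  then have "(\<Prod>i\<in>I. y i powr w i) = 0" using assms(1) by (auto intro!: prod_zero)
  moreover have "0 \<le> (\<Sum>i\<in>I. w i * y i)" using assms by (auto intro: sum_nonneg)
  ultimately show ?thesis by linarith
next
  case False
  then have pos: "y i > 0" if "i \<in> I" for i using assms(4)[OF that] that by force
  have "I \<noteq> {}" using assms(3) by auto
  have "(\<Prod>i\<in>I. y i powr w i) = exp (\<Sum>i\<in>I. w i *\<^sub>R ln (y i))"
    using assms(1) by (subst exp_sum) (auto simp: powr_def dest: pos intro!: prod.cong)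
  also have "\<dots> \<le> (\<Sum>i\<in>I. w i * exp (ln (y i)))"
    using assms \<open>I \<noteq> {}\<close> by (intro convex_on_sum[OF _ _ exp_convex]) auto
  also have "\<dots> = (\<Sum>i\<in>I. w i * y i)" using pos by simp
  finally show ?thesis .
qed

text \<open>Divide each factor by its integral and integrate the weighted mean inequality; its
  right-hand side becomes the sum of the weights. A factor with integral 0 vanishes almost
  everywhere and is treated separately.\<close>

lemma Hoelder_inequality_prod:
  fixes g :: "'i \<Rightarrow> 'a \<Rightarrow> real" and w :: "'i \<Rightarrow> real"
  assumes I: "finite I" and w: "\<And>i. i \<in> I \<Longrightarrow> 0 \<le> w i" "(\<Sum>i\<in>I. w i) = 1"
    and int: "\<And>i. i \<in> I \<Longrightarrow> integrable M (g i)" and nonneg: "\<And>i x. i \<in> I \<Longrightarrow> 0 \<le> g i x"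
  shows "integrable M (\<lambda>x. \<Prod>i\<in>I. g i x powr w i)"
    "(LINT x|M. (\<Prod>i\<in>I. g i x powr w i)) \<le> (\<Prod>i\<in>I. (LINT x|M. g i x) powr w i)"
proof -
  have meas: "(\<lambda>x. \<Prod>i\<in>I. g i x powr w i) \<in> borel_measurable M"
    using int by (intro borel_measurable_prod powr_real_measurable) auto
  show *: "integrable M (\<lambda>x. \<Prod>i\<in>I. g i x powr w i)"
  proof (rule Bochner_Integration.integrable_bound[OF _ meas])
    show "integrable M (\<lambda>x. \<Sum>i\<in>I. w i * g i x)" using int by auto
    show "AE x in M. norm (\<Prod>i\<in>I. g i x powr w i) \<le> norm (\<Sum>i\<in>I. w i * g i x)"
      using weighted_arith_geom_mean[OF I w, of "\<lambda>i. g i x" for x] nonneg w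
      by (intro AE_I2) (simp add: prod_nonneg sum_nonneg)
  qed
  show "(LINT x|M. (\<Prod>i\<in>I. g i x powr w i)) \<le> (\<Prod>i\<in>I. (LINT x|M. g i x) powr w i)"
  proof (cases "\<exists>i\<in>I. (LINT x|M. g i x) = 0")
    case True
    then obtain i where i: "i \<in> I" "(LINT x|M. g i x) = 0" by auto
    then have "AE x in M. g i x = 0"
      using integral_nonneg_eq_0_iff_AE[OF int[OF i(1)]] nonneg by auto
    then have "AE x in M. (\<Prod>i\<in>I. g i x powr w i) = 0"
      by eventually_elim (use I i in \<open>auto intro!: prod_zero\<close>)
    then have "(LINT x|M. (\<Prod>i\<in>I. g i x powr w i)) = 0" by (rule integral_eq_zero_AE)
    then show ?thesis by (simp add: prod_nonneg)
  next
    case False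
    define G where "G i = (LINT x|M. g i x)" for i
    have G: "G i > 0" if "i \<in> I" for i
    proof -
      have "0 \<le> G i" unfolding G_def by (rule Bochner_Integration.integral_nonneg) (rule nonneg[OF that])
      then show ?thesis using False that unfolding G_def by fastforce
    qed
    have eq: "(LINT x|M. (\<Prod>i\<in>I. g i x powr w i)) = (\<Prod>i\<in>I. G i powr w i) * (LINT x|M. (\<Prod>i\<in>I. (g i x / G i) powr w i))"
    proof -
      have pt: "(\<Prod>i\<in>I. g i x powr w i) = (\<Prod>i\<in>I. G i powr w i) * (\<Prod>i\<in>I. (g i x / G i) powr w i)" for x
        unfolding prod.distrib[symmetric]
      proof (rule prod.cong[OF refl])
        fix i assume "i \<in> I"
        then show "g i x powr w i = G i powr w i * (g i x / G i) powr w i"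
          using nonneg[of i x] G[of i] by (simp add: powr_divide)
      qed
      have "(LINT x|M. (\<Prod>i\<in>I. g i x powr w i)) =
          (LINT x|M. (\<Prod>i\<in>I. G i powr w i) * (\<Prod>i\<in>I. (g i x / G i) powr w i))"
        by (rule Bochner_Integration.integral_cong[OF refl]) (rule pt)
      then show ?thesis by (simp only: integral_mult_right_zero)
    qed
    have "(LINT x|M. (\<Prod>i\<in>I. (g i x / G i) powr w i)) \<le> (LINT x|M. (\<Sum>i\<in>I. w i * (g i x / G i)))"
    proof (rule integral_mono')
      show "integrable M (\<lambda>x. \<Sum>i\<in>I. w i * (g i x / G i))" using int by auto
      show "0 \<le> (\<Sum>i\<in>I. w i * (g i x / G i))" for x using nonneg G w by (auto intro!: sum_nonneg simp: less_imp_le)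
      show "(\<Prod>i\<in>I. (g i x / G i) powr w i) \<le> (\<Sum>i\<in>I. w i * (g i x / G i))" for x
        using nonneg G by (intro weighted_arith_geom_mean[OF I w]) (auto simp: less_imp_le)
    qed
    also have "(LINT x|M. (\<Sum>i\<in>I. w i * (g i x / G i))) = (\<Sum>i\<in>I. w i * (G i / G i))"
      using int by (subst Bochner_Integration.integral_sum) (auto simp: G_def intro!: sum.cong)
    also have "\<dots> = (\<Sum>i\<in>I. w i)"
      by (rule sum.cong[OF refl]) (simp add: G less_imp_neq[symmetric])
    also note w(2)
    finally have "(LINT x|M. (\<Prod>i\<in>I. g i x powr w i)) \<le> (\<Prod>i\<in>I. G i powr w i) * 1"
      unfolding eq by (intro mult_left_mono prod_nonneg) auto
    then show ?thesis unfolding G_def by simp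
  qed
qed

section \<open>Integrating along coordinate lines\<close>

definition marginal :: "'b measure \<Rightarrow> 'i \<Rightarrow> (('i \<Rightarrow> 'b) \<Rightarrow> real) \<Rightarrow> ('i \<Rightarrow> 'b) \<Rightarrow> real" where
  "marginal M i f x = (LINT t|M. f (x(i := t)))"

context
  fixes M :: "'b measure"
  assumes fin: "finite_measure M"
begin

interpretation M: finite_measure M by (rule fin)
interpretation P: product_sigma_finite "\<lambda>_. M" by unfold_locales

lemma finite_measure_PiM: "finite s \<Longrightarrow> finite_measure (PiM s (\<lambda>_. M))"
proof (rule finite_measureI)
  assume s: "finite s"
  interpret finite_product_sigma_finite "\<lambda>_. M" s by standard (rule s)
  have "emeasure (PiM s (\<lambda>_. M)) (space (PiM s (\<lambda>_. M))) = (\<Prod>i\<in>s. emeasure M (space M))"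
    by (subst space_PiM, subst P.emeasure_PiM) (use s in auto)
  also have "\<dots> < \<infinity>" by (simp add: M.emeasure_eq_measure ennreal_power)
  finally show "emeasure (PiM s (\<lambda>_. M)) (space (PiM s (\<lambda>_. M))) \<noteq> \<infinity>" by simp
qed

lemma update_measurable:
  "i \<in> s \<Longrightarrow> (\<lambda>(x, t). x(i := t)) \<in> PiM s (\<lambda>_. M) \<Otimes>\<^sub>M M \<rightarrow>\<^sub>M PiM s (\<lambda>_. M)"
  "(\<lambda>(x, t). x(i := t)) \<in> PiM s (\<lambda>_. M) \<Otimes>\<^sub>M M \<rightarrow>\<^sub>M PiM (insert i s) (\<lambda>_. M)"
  unfolding split_beta' by (rule measurable_fun_upd[where J=s]; auto)+

lemma marginal_measurable_insert:
  assumes "f \<in> borel_measurable (PiM (insert i s) (\<lambda>_. M))"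
  shows "marginal M i f \<in> borel_measurable (PiM s (\<lambda>_. M))"
  using measurable_compose[OF update_measurable(2) assms]
  unfolding marginal_def[abs_def] by (intro M.borel_measurable_lebesgue_integral) (simp add: split_beta')

lemma marginal_measurable:
  assumes "f \<in> borel_measurable (PiM s (\<lambda>_. M))" "i \<in> s"
  shows "marginal M i f \<in> borel_measurable (PiM s (\<lambda>_. M))"
  using marginal_measurable_insert[of f i s] assms by (simp add: insert_absorb)

lemma slice_integrable:
  fixes f :: "_ \<Rightarrow> real" and B :: real
  assumes "f \<in> borel_measurable (PiM (insert i s) (\<lambda>_. M))" "\<And>x. \<bar>f x\<bar> \<le> B" "x \<in> space (PiM s (\<lambda>_. M))"
  shows "integrable M (\<lambda>t. f (x(i := t)))"
proof (rule M.integrable_const_bound[where B=B])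
  show "(\<lambda>t. f (x(i := t))) \<in> borel_measurable M"
    using measurable_Pair2[OF measurable_compose[OF update_measurable(2) assms(1)] assms(3)] by simp
qed (use assms(2) in auto)

lemma marginal_nonneg: "(\<And>x. 0 \<le> f x) \<Longrightarrow> 0 \<le> marginal M i f x"
  by (simp add: marginal_def)

lemma marginal_le:
  assumes "\<And>x. 0 \<le> f x" "\<And>x. f x \<le> B"
  shows "marginal M i f x \<le> B * measure M (space M)"
proof -
  have "0 \<le> B" using assms(1,2) order_trans by blast
  have "marginal M i f x \<le> (LINT t|M. B)" unfolding marginal_def
    by (rule integral_mono') (use assms \<open>0 \<le> B\<close> in auto)
  then show ?thesis by (simp add: mult.commute)
qed

text \<open>The induction behind the Gagliardo--Nirenberg inequality: one variable after the other is
  integrated out, by Hoelder with exponents \<open>1 - card s * p\<close> and \<open>p\<close> (\<open>card s\<close> times).\<close>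

lemma gridlines:
  fixes p :: real
  assumes "finite s" "f \<in> borel_measurable (PiM s (\<lambda>_. M))" "\<And>x. 0 \<le> f x" "\<And>x. f x \<le> B"
    "0 \<le> p" "(real (card s) - 1) * p \<le> 1"
  shows "(LINT x|PiM s (\<lambda>_. M). f x powr (1 - (real (card s) - 1) * p) * (\<Prod>i\<in>s. marginal M i f x powr p))
    \<le> (LINT x|PiM s (\<lambda>_. M). f x) powr (1 + p)"
  using assms
proof (induction s arbitrary: f B rule: finite_induct)
  case empty
  then show ?case by (simp add: PiM_empty lebesgue_integral_count_space_finite)
next
  case (insert i s)
  let ?n = "real (card s)" and ?F = "marginal M i f"
  have card: "real (card (insert i s)) - 1 = ?n" using insert by simp
  note f_meas = insert.prems(1)
  have np: "?n * p \<le> 1" using insert.prems(5) card by simp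
  have n1p: "(?n - 1) * p \<le> 1" using np insert.prems(4) by (simp add: left_diff_distrib)
  interpret Ps: finite_measure "PiM s (\<lambda>_. M)" by (rule finite_measure_PiM[OF insert.hyps(1)])
  interpret Pi: finite_measure "PiM (insert i s) (\<lambda>_. M)" by (rule finite_measure_PiM) (use insert in simp)
  have "0 \<le> B" using insert.prems(2,3) order_trans by blast
  define V where "V = measure M (space M)"
  have F0: "0 \<le> ?F x" for x by (rule marginal_nonneg[OF insert.prems(2)])
  have FB: "?F x \<le> B * V" for x unfolding V_def by (rule marginal_le[OF insert.prems(2,3)])
  have BV: "0 \<le> B * V" using \<open>0 \<le> B\<close> by (simp add: V_def)
  have F_meas: "?F \<in> borel_measurable (PiM s (\<lambda>_. M))" by (rule marginal_measurable_insert[OF f_meas])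
  define h where "h x = f x powr (1 - ?n * p) * (\<Prod>j\<in>insert i s. marginal M j f x powr p)" for x
  have h_meas: "h \<in> borel_measurable (PiM (insert i s) (\<lambda>_. M))"
    unfolding h_def[abs_def]
    by (intro borel_measurable_times borel_measurable_prod powr_real_measurable f_meas marginal_measurable[OF f_meas]) auto
  have h0: "0 \<le> h x" for x unfolding h_def by (intro mult_nonneg_nonneg prod_nonneg) auto
  have hB: "h x \<le> B powr (1 - ?n * p) * (\<Prod>j\<in>insert i s. (B * V) powr p)" for x
    unfolding h_def using insert.prems np
    by (intro mult_mono powr_mono2 prod_mono conjI prod_nonneg marginal_nonneg marginal_le[where B=B, folded V_def]) auto
  have h_int: "integrable (PiM (insert i s) (\<lambda>_. M)) h"
    by (rule Pi.integrable_const_bound[where B="B powr (1 - ?n * p) * (\<Prod>j\<in>insert i s. (B * V) powr p)"])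
      (use h_meas h0 hB in auto)
  have f_int: "integrable (PiM (insert i s) (\<lambda>_. M)) f"
    by (rule Pi.integrable_const_bound[where B=B]) (use f_meas insert.prems in auto)
  have inner: "(LINT t|M. h (x(i := t))) \<le> ?F x powr (1 - (?n - 1) * p) * (\<Prod>j\<in>s. marginal M j ?F x powr p)"
    if x: "x \<in> space (PiM s (\<lambda>_. M))" for x
  proof -
    \<comment> \<open>The Hoelder family is indexed by \<open>insert i s\<close>: the entry at i is
      f itself, the others are its marginals. The weights add up to 1 because \<open>card s\<close>
      of them equal p.\<close>
    define g where "g j t = (if j = i then f (x(i := t)) else marginal M j f (x(i := t)))" for j t
    define w where "w j = (if j = i then 1 - ?n * p else p)" for j
    have x_upd: "x(j := t) \<in> space (PiM s (\<lambda>_. M))" if "j \<in> s" "t \<in> space M" for j t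
      using x that by (auto simp: space_PiM PiE_iff extensional_def)
    have g_int: "integrable M (g j)" if "j \<in> insert i s" for j
    proof (cases "j = i")
      case True
      have "integrable M (\<lambda>t. f (x(i := t)))"
        by (rule slice_integrable[OF f_meas _ x, where B=B]) (use insert.prems in simp)
      then show ?thesis by (simp only: g_def[abs_def] True if_True simp_thms)
    next
      case False
      have "\<bar>marginal M j f y\<bar> \<le> B * V" for y
        using marginal_le[OF insert.prems(2,3), where i=j and x=y] marginal_nonneg[OF insert.prems(2), where i=j and x=y] unfolding V_def by simp
      then have "integrable M (\<lambda>t. marginal M j f (x(i := t)))"
        by (intro slice_integrable[OF marginal_measurable[OF f_meas that] _ x])
      then show ?thesis by (simp only: g_def[abs_def] False if_False simp_thms)
    qed
    have m0: "0 \<le> marginal M j f y" for j y by (rule marginal_nonneg) (rule insert.prems(2))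
    have g0: "0 \<le> g j t" for j t using insert.prems(2) m0 by (simp add: g_def)
    have w: "(\<Sum>j\<in>insert i s. w j) = 1" "\<And>j. 0 \<le> w j"
    proof -
      have "(\<Sum>j\<in>s. w j) = (\<Sum>j\<in>s. p)" by (rule sum.cong) (use insert.hyps in \<open>auto simp: w_def\<close>)
      then show "(\<Sum>j\<in>insert i s. w j) = 1" using insert.hyps by (simp add: w_def)
      show "\<And>j. 0 \<le> w j" using np insert.prems by (simp add: w_def)
    qed
    have "(LINT t|M. h (x(i := t))) = (LINT t|M. ?F x powr p * (\<Prod>j\<in>insert i s. g j t powr w j))"
    proof (rule Bochner_Integration.integral_cong[OF refl])
      fix t
      \<comment> \<open>A marginal in direction i does not see the value of coordinate i, so this
        factor leaves the integral over t.\<close>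
      have "marginal M i f (x(i := t)) = ?F x" by (simp add: marginal_def)
      moreover have "(\<Prod>j\<in>s. g j t powr w j) = (\<Prod>j\<in>s. marginal M j f (x(i := t)) powr p)"
        by (rule prod.cong) (use insert.hyps in \<open>auto simp: g_def w_def\<close>)
      ultimately show "h (x(i := t)) = ?F x powr p * (\<Prod>j\<in>insert i s. g j t powr w j)"
        using insert.hyps by (simp add: h_def g_def w_def)
    qed
    also have "\<dots> = ?F x powr p * (LINT t|M. (\<Prod>j\<in>insert i s. g j t powr w j))" by simp
    also have "\<dots> \<le> ?F x powr p * (\<Prod>j\<in>insert i s. (LINT t|M. g j t) powr w j)"
      by (intro mult_left_mono Hoelder_inequality_prod(2)) (use insert.hyps w g0 g_int in auto)
    also have "\<dots> = ?F x powr p * ((LINT t|M. g i t) powr w i * (\<Prod>j\<in>s. (LINT t|M. g j t) powr w j))"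
      using insert.hyps by simp
    also have "(LINT t|M. g i t) powr w i = ?F x powr (1 - ?n * p)"
      by (simp add: g_def w_def marginal_def)
    \<comment> \<open>Fubini: integrating the j-marginal of f over coordinate i gives the j-marginal
      of \<open>?F\<close>.\<close>
    also have "(\<Prod>j\<in>s. (LINT t|M. g j t) powr w j) = (\<Prod>j\<in>s. marginal M j ?F x powr p)"
    proof (rule prod.cong[OF refl])
      fix j assume j: "j \<in> s"
      then have ji: "j \<noteq> i" using insert.hyps by auto
      interpret MM: pair_sigma_finite M M by unfold_locales
      have meas: "(\<lambda>(t, r). f (x(i := t, j := r))) \<in> borel_measurable (M \<Otimes>\<^sub>M M)"
      proof -
        have "(\<lambda>q. (x(i := fst q))(j := snd q)) \<in> M \<Otimes>\<^sub>M M \<rightarrow>\<^sub>M PiM (insert i s) (\<lambda>_. M)"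
        proof (rule measurable_fun_upd[where J="insert i s"])
          show "(\<lambda>q. x(i := fst q)) \<in> M \<Otimes>\<^sub>M M \<rightarrow>\<^sub>M PiM (insert i s) (\<lambda>_. M)"
            by (rule measurable_fun_upd[where J=s]) (use x in \<open>auto intro: measurable_const\<close>)
        qed (use j in auto)
        from measurable_compose[OF this f_meas] show ?thesis by (simp only: split_beta')
      qed
      interpret MMf: finite_measure "M \<Otimes>\<^sub>M M"
        by (rule finite_measure_pair_measure[OF fin fin])
      have int: "integrable (M \<Otimes>\<^sub>M M) (\<lambda>(t, r). f (x(i := t, j := r)))"
        by (rule MMf.integrable_const_bound[where B=B, OF _ meas]) (use insert.prems in auto)
      have "(LINT t|M. g j t) = (LINT t|M. LINT r|M. f (x(i := t, j := r)))"
        using ji by (simp add: g_def marginal_def)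
      also have "\<dots> = (LINT r|M. LINT t|M. f (x(i := t, j := r)))"
        using MM.Fubini_integral[OF int] by simp
      also have "\<dots> = marginal M j ?F x"
        using ji by (simp add: marginal_def fun_upd_twist)
      finally show "(LINT t|M. g j t) powr w j = marginal M j ?F x powr p" using ji by (simp add: w_def)
    qed
    also have "?F x powr p * (?F x powr (1 - ?n * p) * (\<Prod>j\<in>s. marginal M j ?F x powr p)) =
        ?F x powr (1 - (?n - 1) * p) * (\<Prod>j\<in>s. marginal M j ?F x powr p)"
    proof -
      \<comment> \<open>The power p of \<open>?F\<close> pulled out and the power from Hoelder
        combine to exactly the exponent that the induction hypothesis has for s.\<close>
      have "p + (1 - ?n * p) = 1 - (?n - 1) * p" by (simp add: algebra_simps)
      then have "?F x powr p * ?F x powr (1 - ?n * p) = ?F x powr (1 - (?n - 1) * p)"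
        by (simp only: powr_add[symmetric])
      then show ?thesis by (simp only: mult.assoc[symmetric])
    qed
    finally show ?thesis .
  qed
  have "(LINT x|PiM (insert i s) (\<lambda>_. M). h x) = (LINT x|PiM s (\<lambda>_. M). LINT t|M. h (x(i := t)))"
    using P.product_integral_insert[OF insert.hyps h_int] .
  also have "\<dots> \<le> (LINT x|PiM s (\<lambda>_. M). ?F x powr (1 - (?n - 1) * p) * (\<Prod>j\<in>s. marginal M j ?F x powr p))"
  proof (rule integral_mono)
    show "integrable (PiM s (\<lambda>_. M)) (\<lambda>x. LINT t|M. h (x(i := t)))"
    proof (rule Ps.integrable_const_bound)
      show "(\<lambda>x. LINT t|M. h (x(i := t))) \<in> borel_measurable (PiM s (\<lambda>_. M))"
        using marginal_measurable_insert[OF h_meas] by (simp add: marginal_def[abs_def])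
      show "AE x in PiM s (\<lambda>_. M). norm (LINT t|M. h (x(i := t))) \<le>
          B powr (1 - ?n * p) * (\<Prod>j\<in>insert i s. (B * V) powr p) * V"
        using marginal_le[where f=h, OF h0 hB] marginal_nonneg[where f=h, OF h0] unfolding V_def marginal_def by (intro AE_I2) simp
    qed
    show "integrable (PiM s (\<lambda>_. M)) (\<lambda>x. ?F x powr (1 - (?n - 1) * p) * (\<Prod>j\<in>s. marginal M j ?F x powr p))"
    proof (rule Ps.integrable_const_bound)
      show "(\<lambda>x. ?F x powr (1 - (?n - 1) * p) * (\<Prod>j\<in>s. marginal M j ?F x powr p)) \<in> borel_measurable (PiM s (\<lambda>_. M))"
        by (intro borel_measurable_times borel_measurable_prod powr_real_measurable F_meas marginal_measurable[OF F_meas]) auto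
      have "?F x powr (1 - (?n - 1) * p) * (\<Prod>j\<in>s. marginal M j ?F x powr p) \<le>
          (B * V) powr (1 - (?n - 1) * p) * (\<Prod>j\<in>s. (B * V * V) powr p)" for x
        using n1p insert.prems(2,4) F0 FB
        by (intro mult_mono powr_mono2 prod_mono conjI prod_nonneg marginal_nonneg marginal_le[where B="B * V", folded V_def]) auto
      then show "AE x in PiM s (\<lambda>_. M). norm (?F x powr (1 - (?n - 1) * p) * (\<Prod>j\<in>s. marginal M j ?F x powr p)) \<le>
          (B * V) powr (1 - (?n - 1) * p) * (\<Prod>j\<in>s. (B * V * V) powr p)"
        by (simp add: abs_mult prod_nonneg)
    qed
  qed (rule inner)
  also have "\<dots> \<le> (LINT x|PiM s (\<lambda>_. M). ?F x) powr (1 + p)"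
    by (rule insert.IH[OF F_meas F0 FB insert.prems(4) n1p])
  also have "(LINT x|PiM s (\<lambda>_. M). ?F x) = (LINT x|PiM (insert i s) (\<lambda>_. M). f x)"
    using P.product_integral_insert[OF insert.hyps f_int] by (simp add: marginal_def)
  finally show ?case unfolding h_def card .
qed

end

text \<open>Since \<gamma> > 1, the difference quotient at 0 is bounded by |h|^(\<gamma> - 1) and
  tends to 0, in agreement with the formula, whose factor t vanishes there.\<close>

lemma abs_powr_DERIV:
  fixes t :: real
  assumes "\<gamma> > 1"
  shows "((\<lambda>t. \<bar>t\<bar> powr \<gamma>) has_real_derivative \<gamma> * (\<bar>t\<bar> powr (\<gamma> - 2) * t)) (at t)"
proof -
  consider "t > 0" | "t < 0" | "t = 0" by linarith
  then show ?thesis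
  proof cases
    case 1
    have "((\<lambda>t. t powr \<gamma>) has_real_derivative \<gamma> * (\<bar>t\<bar> powr (\<gamma> - 2) * t)) (at t)"
      using 1 powr_add[of t "\<gamma> - 2" 1] by (auto intro!: derivative_eq_intros)
    then show ?thesis
      by (rule has_field_derivative_transform_within_open[where S="{0<..}"]) (use 1 in auto)
  next
    case 2
    have "((\<lambda>t. (- t) powr \<gamma>) has_real_derivative \<gamma> * (\<bar>t\<bar> powr (\<gamma> - 2) * t)) (at t)"
      using 2 powr_add[of "- t" "\<gamma> - 2" 1] by (auto intro!: derivative_eq_intros)
    then show ?thesis
      by (rule has_field_derivative_transform_within_open[where S="{..<0}"]) (use 2 in auto)
  next
    case 3
    have "((\<lambda>h::real. \<bar>h\<bar> powr \<gamma> / h) \<longlongrightarrow> 0) (at 0)"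
    proof (rule Lim_null_comparison)
      have "((\<lambda>h::real. \<bar>h\<bar> powr (\<gamma> - 1)) \<longlongrightarrow> \<bar>0\<bar> powr (\<gamma> - 1)) (at 0)"
        using assms by (intro tendsto_powr' tendsto_intros) auto
      then show "((\<lambda>h::real. \<bar>h\<bar> powr (\<gamma> - 1)) \<longlongrightarrow> 0) (at 0)" by simp
      have "norm (\<bar>h\<bar> powr \<gamma> / h) \<le> \<bar>h\<bar> powr (\<gamma> - 1)" if "h \<noteq> 0" for h :: real
        using that powr_add[of "\<bar>h\<bar>" "\<gamma> - 1" 1] by (simp add: abs_divide)
      then show "\<forall>\<^sub>F h::real in at 0. norm (\<bar>h\<bar> powr \<gamma> / h) \<le> \<bar>h\<bar> powr (\<gamma> - 1)"
        by (auto simp: eventually_at_filter)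
    qed
    then show ?thesis using 3 by (simp add: has_field_derivative_iff)
  qed
qed

text \<open>\<open>gridlines\<close> works with a finite measure in each coordinate, so Lebesgue
  measure is cut down to an interval. A product of cut-down measures is the product measure cut down
  to the cube, as both agree on rectangles.\<close>

lemma PiM_density_indicator:
  fixes L :: "'b measure" and C :: "'b set"
  assumes "sigma_finite_measure L" "C \<in> sets L" "finite I" and fin: "finite_measure (density L (indicator C))"
  shows "PiM I (\<lambda>_. density L (indicator C)) = density (PiM I (\<lambda>_. L)) (indicator (PiE I (\<lambda>_. C)))"
proof -
  interpret M: finite_measure "density L (indicator C)" by (rule fin)
  interpret PM: product_sigma_finite "\<lambda>_. density L (indicator C)" by unfold_locales
  interpret L: sigma_finite_measure L by (rule assms(1))
  interpret PL: product_sigma_finite "\<lambda>_. L" by unfold_locales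
  interpret PLf: finite_product_sigma_finite "\<lambda>_. L" I by standard (rule assms(3))
  have sets_eq: "sets (PiM I (\<lambda>_. density L (indicator C))) = sets (PiM I (\<lambda>_. L))"
    by (intro sets_PiM_cong) simp_all
  have C: "PiE I (\<lambda>_. C) \<in> sets (PiM I (\<lambda>_. L))" using assms by (intro sets_PiM_I_finite) auto
  show ?thesis
  proof (rule PM.PiM_eqI[symmetric, OF assms(3)])
    show "sets (density (PiM I (\<lambda>_. L)) (indicator (PiE I (\<lambda>_. C)))) = sets (PiM I (\<lambda>_. density L (indicator C)))"
      by (simp add: sets_eq)
    fix A assume "\<And>i. i \<in> I \<Longrightarrow> A i \<in> sets (density L (indicator C))"
    then have A: "\<And>i. i \<in> I \<Longrightarrow> A i \<in> sets L" by simp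
    then have PA: "PiE I A \<in> sets (PiM I (\<lambda>_. L))" using assms(3) by (intro sets_PiM_I_finite) auto
    have "emeasure (density (PiM I (\<lambda>_. L)) (indicator (PiE I (\<lambda>_. C)))) (PiE I A) =
        (\<integral>\<^sup>+x. indicator (PiE I (\<lambda>i. A i \<inter> C)) x \<partial>PiM I (\<lambda>_. L))"
    proof -
      have "emeasure (density (PiM I (\<lambda>_. L)) (indicator (PiE I (\<lambda>_. C)))) (PiE I A) =
          (\<integral>\<^sup>+x. indicator (PiE I (\<lambda>_. C)) x * indicator (PiE I A) x \<partial>PiM I (\<lambda>_. L))"
        by (rule emeasure_density) (use C PA in auto)
      also have "\<dots> = (\<integral>\<^sup>+x. indicator (PiE I (\<lambda>i. A i \<inter> C)) x \<partial>PiM I (\<lambda>_. L))"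
        by (rule nn_integral_cong) (auto simp: indicator_def PiE_iff)
      finally show ?thesis .
    qed
    also have "\<dots> = emeasure (PiM I (\<lambda>_. L)) (PiE I (\<lambda>i. A i \<inter> C))"
      using A assms by (intro nn_integral_indicator sets_PiM_I_finite) auto
    also have "\<dots> = (\<Prod>i\<in>I. emeasure L (A i \<inter> C))"
      using A assms by (intro PL.emeasure_PiM) auto
    also have "\<dots> = (\<Prod>i\<in>I. emeasure (density L (indicator C)) (A i))"
    proof (rule prod.cong[OF refl])
      fix i assume "i \<in> I"
      then have "emeasure (density L (indicator C)) (A i) = (\<integral>\<^sup>+x. indicator (A i \<inter> C) x \<partial>L)"
      proof -
        have "emeasure (density L (indicator C)) (A i) = (\<integral>\<^sup>+x. indicator C x * indicator (A i) x \<partial>L)"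
          by (rule emeasure_density) (use A[OF \<open>i \<in> I\<close>] assms in auto)
        also have "\<dots> = (\<integral>\<^sup>+x. indicator (A i \<inter> C) x \<partial>L)"
          by (rule nn_integral_cong) (auto simp: indicator_def)
        finally show ?thesis .
      qed
      also have "\<dots> = emeasure L (A i \<inter> C)" using A[OF \<open>i \<in> I\<close>] assms by (intro nn_integral_indicator) auto
      finally show "emeasure L (A i \<inter> C) = emeasure (density L (indicator C)) (A i)" by simp
    qed
    finally show "emeasure (density (PiM I (\<lambda>_. L)) (indicator (PiE I (\<lambda>_. C)))) (PiE I A) =
      (\<Prod>i\<in>I. emeasure (density L (indicator C)) (A i))" .
  qed
qed

definition of_coords :: "('a::euclidean_space \<Rightarrow> real) \<Rightarrow> 'a" where
  "of_coords y = (\<Sum>b\<in>Basis. y b *\<^sub>R b)"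

lemma of_coords_inner: "e \<in> Basis \<Longrightarrow> of_coords y \<bullet> e = y e"
  by (simp add: of_coords_def inner_sum_left inner_Basis if_distrib cong: if_cong)

lemma of_coords_measurable: "of_coords \<in> borel_measurable (PiM Basis (\<lambda>_. lborel))"
  unfolding of_coords_def[abs_def] by measurable

lemma of_coords_upd:
  fixes e :: "'a::euclidean_space"
  assumes "e \<in> Basis"
  shows "of_coords (y(e := t)) = of_coords y + (t - y e) *\<^sub>R e"
proof -
  have "of_coords (y(e := t)) = (\<Sum>b\<in>Basis. y b *\<^sub>R b + (if b = e then (t - y e) *\<^sub>R e else 0))"
    unfolding of_coords_def by (rule sum.cong) (auto simp: algebra_simps)
  then show ?thesis using assms by (simp add: sum.distrib of_coords_def)
qed

text \<open>The cube contains the ball outside which G vanishes, so the truncation does not change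
  the integral; \<open>of_coords\<close> maps the product of the line measures to
  \<open>lborel\<close>.\<close>

lemma PiM_truncated_integral:
  fixes G :: "'a::euclidean_space \<Rightarrow> real"
  assumes "G \<in> borel_measurable borel" "\<And>x. norm x > R \<Longrightarrow> G x = 0" "R \<ge> 0"
  shows "(LINT y|PiM Basis (\<lambda>_. density lborel (indicator {-R..R})). G (of_coords y)) = (LINT x|lborel. G x)"
proof -
  let ?M = "density lborel (indicator {-R..R}) :: real measure"
  have "emeasure ?M (space ?M) < \<infinity>"
    using assms(3) by (subst emeasure_density) auto
  then have fin: "finite_measure ?M" by (intro finite_measureI) auto
  have sf: "sigma_finite_measure (lborel :: real measure)" by (rule sigma_finite_lborel)
  have C: "PiE Basis (\<lambda>_. {-R..R}) \<in> sets (PiM (Basis :: 'a set) (\<lambda>_. lborel :: real measure))"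
    by (intro sets_PiM_I_finite) auto
  have G: "(\<lambda>y. G (of_coords y)) \<in> borel_measurable (PiM Basis (\<lambda>_. lborel))"
    using measurable_compose[OF of_coords_measurable, of G borel] assms(1) by simp
  have "(LINT y|PiM Basis (\<lambda>_. ?M). G (of_coords y)) =
      (LINT y|density (PiM Basis (\<lambda>_. lborel)) (\<lambda>y. ennreal (indicator (PiE Basis (\<lambda>_. {-R..R})) y)). G (of_coords y))"
    using PiM_density_indicator[OF sf _ finite_Basis[where 'a='a] fin] by (simp add: ennreal_indicator)
  also have "\<dots> = (LINT y|PiM Basis (\<lambda>_. lborel). indicator (PiE Basis (\<lambda>_. {-R..R})) y *\<^sub>R G (of_coords y))"
    using C G by (intro integral_density) auto
  also have "\<dots> = (LINT y|PiM Basis (\<lambda>_. lborel). G (of_coords y))"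
  proof (rule Bochner_Integration.integral_cong[OF refl])
    fix y :: "'a \<Rightarrow> real" assume y: "y \<in> space (PiM Basis (\<lambda>_. lborel))"
    show "indicator (PiE Basis (\<lambda>_. {-R..R})) y *\<^sub>R G (of_coords y) = G (of_coords y)"
    proof (cases "norm (of_coords y) > R")
      case False
      then have "\<bar>y e\<bar> \<le> R" if "e \<in> Basis" for e
        using Basis_le_norm[OF that, of "of_coords y"] of_coords_inner[OF that, of y] by simp
      then have "\<forall>e\<in>Basis. y e \<in> {-R..R}" by (auto simp: abs_le_iff minus_le_iff)
      moreover have "y \<in> extensional Basis" using y by (simp add: space_PiM PiE_iff)
      ultimately have "y \<in> PiE Basis (\<lambda>_. {-R..R})" unfolding PiE_iff by blast
      then show ?thesis by simp
    qed (use assms(2) in simp)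
  qed
  also have "\<dots> = (LINT x|lborel. G x)"
    using assms(1) of_coords_measurable
    by (subst (2) lborel_eq) (simp add: integral_distr of_coords_def[abs_def])
  finally show ?thesis .
qed

text \<open>On the line through a point in direction e, the fundamental theorem of calculus bounds
  |v| by the integral of |g|. Multiplying the N bounds, each raised to the power 1/(N - 1), gives
  |v|^(N/(N - 1)), and \<open>gridlines\<close> estimates the integral of the product of
  marginals.\<close>

lemma Gagliardo_Nirenberg:
  fixes v :: "'a::euclidean_space \<Rightarrow> real" and g :: "'a \<Rightarrow> 'a"
  assumes deriv: "\<And>x. (v has_derivative (\<lambda>h. g x \<bullet> h)) (at x)" and cont: "continuous_on UNIV g"
    and supp: "\<And>x. norm x \<ge> R \<Longrightarrow> v x = 0 \<and> g x = 0" and R: "R > 0" and N: "DIM('a) \<ge> 2"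
  shows "(LINT x|lborel. \<bar>v x\<bar> powr (real DIM('a) / (real DIM('a) - 1))) \<le>
    (LINT x|lborel. norm (g x)) powr (real DIM('a) / (real DIM('a) - 1))"
proof -
  \<comment> \<open>This p makes the exponent 1 - (N - 1) p of f in \<open>gridlines\<close> vanish,
    so that only the marginals remain.\<close>
  define p where "p = 1 / (real DIM('a) - 1)"
  define q where "q = real DIM('a) / (real DIM('a) - 1)"
  have p: "p > 0" "(real DIM('a) - 1) * p = 1" "1 + p = q" "q > 0" "real DIM('a) * p = q"
    using N by (auto simp: p_def q_def field_simps)
  let ?M = "density lborel (indicator {-R..R}) :: real measure"
  let ?P = "PiM (Basis :: 'a set) (\<lambda>_. ?M)"
  have "emeasure ?M (space ?M) < \<infinity>" using R by (subst emeasure_density) auto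
  then have fin: "finite_measure ?M" by (intro finite_measureI) auto
  interpret P: finite_measure ?P by (rule finite_measure_PiM[OF fin]) simp
  have oc: "of_coords \<in> borel_measurable ?P"
    using of_coords_measurable by (simp cong: measurable_cong_sets sets_PiM_cong)
  have g_meas: "g \<in> borel_measurable borel" using cont by (rule borel_measurable_continuous_onI)
  have v_meas: "v \<in> borel_measurable borel"
    by (rule borel_measurable_continuous_onI) (use deriv has_derivative_continuous in \<open>blast intro: continuous_at_imp_continuous_on\<close>)
  obtain B where B: "B > 0" "\<And>x. norm (g x) \<le> B"
    using compact_support_bounded[OF compact_cball[of 0 R] cont] supp by (metis mem_cball_0 less_imp_le not_le)
  \<comment> \<open>The line is entered at coordinate -R, where the norm is at least R and v is 0;
    for \<open>\<bar>y e\<bar> \<ge> R\<close> the left-hand side is 0.\<close>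
  have line: "\<bar>v (of_coords y)\<bar> \<le> marginal ?M e (\<lambda>y. norm (g (of_coords y))) y" if e: "e \<in> Basis" for y and e :: 'a
  proof (cases "\<bar>y e\<bar> < R")
    case False
    then have "norm (of_coords y) \<ge> R" using Basis_le_norm[OF e, of "of_coords y"] of_coords_inner[OF e, of y] by simp
    then show ?thesis using supp by (simp add: marginal_def)
  next
    case True
    have der: "((\<lambda>t. v (of_coords (y(e := t)))) has_vector_derivative (g (of_coords (y(e := t))) \<bullet> e)) (at t within S)" for t S
    proof -
      have "((\<lambda>t. of_coords y + (t - y e) *\<^sub>R e) has_derivative (\<lambda>h. h *\<^sub>R e)) (at t within S)"
        by (auto intro!: derivative_eq_intros)
      from has_derivative_compose[OF this deriv] show ?thesis
        unfolding of_coords_upd[OF e] has_vector_derivative_def by simp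
    qed
    have cont': "continuous_on T (\<lambda>t. g (of_coords (y(e := t))))" for T
      unfolding of_coords_upd[OF e]
      by (rule continuous_on_compose2[OF cont]) (auto intro!: continuous_intros)
    have start: "v (of_coords (y(e := -R))) = 0"
      using Basis_le_norm[OF e, of "of_coords (y(e := -R))"] of_coords_inner[OF e, of "y(e := -R)"] R supp by simp
    have "v (of_coords y) = v (of_coords (y(e := y e))) - v (of_coords (y(e := -R)))" using start by simp
    also have "\<dots> = (LINT t|lborel. indicator {-R..y e} t *\<^sub>R (g (of_coords (y(e := t))) \<bullet> e))"
    proof (rule integral_FTC_Icc[where F="\<lambda>t. v (of_coords (y(e := t)))", symmetric])
      show "- R \<le> y e" using True by simp
    qed (rule der, intro continuous_on_inner cont' continuous_on_const)
    finally have "\<bar>v (of_coords y)\<bar> \<le> (LINT t|lborel. \<bar>indicator {-R..y e} t *\<^sub>R (g (of_coords (y(e := t))) \<bullet> e)\<bar>)"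
      by (simp only: integral_abs_bound)
    also have "\<dots> \<le> (LINT t|lborel. indicator {-R..R} t *\<^sub>R norm (g (of_coords (y(e := t)))))"
    proof (rule integral_mono')
      show "integrable lborel (\<lambda>t. indicator {-R..R} t *\<^sub>R norm (g (of_coords (y(e := t)))))"
        by (rule borel_integrable_compact) (auto intro!: continuous_intros cont')
      fix t
      have "\<bar>g (of_coords (y(e := t))) \<bullet> e\<bar> \<le> norm (g (of_coords (y(e := t))))" by (rule Basis_le_norm[OF e])
      then show "\<bar>indicator {-R..y e} t *\<^sub>R (g (of_coords (y(e := t))) \<bullet> e)\<bar> \<le> indicator {-R..R} t *\<^sub>R norm (g (of_coords (y(e := t))))"
        using True by (auto simp: indicator_def)
    qed auto
    also have "\<dots> = marginal ?M e (\<lambda>y. norm (g (of_coords y))) y"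
    proof -
      have "(\<lambda>t. norm (g (of_coords (y(e := t))))) \<in> borel_measurable lborel"
        using cont'[of UNIV] by (auto intro!: borel_measurable_continuous_onI continuous_intros)
      then have "(LINT t|density lborel (\<lambda>t. ennreal (indicator {-R..R} t)). norm (g (of_coords (y(e := t))))) =
          (LINT t|lborel. indicator {-R..R} t *\<^sub>R norm (g (of_coords (y(e := t)))))"
        by (intro integral_density) auto
      then show ?thesis by (simp add: marginal_def ennreal_indicator)
    qed
    finally show ?thesis .
  qed
  define A where "A = (LINT x|lborel. norm (g x))"
  define V where "V = measure ?P (space ?P)"
  have gint: "integrable ?P (\<lambda>y. norm (g (of_coords y)))"
    by (rule P.integrable_const_bound[where B=B]) (use B measurable_compose[OF oc, of g borel] g_meas in auto)
  have A: "(LINT y|?P. norm (g (of_coords y))) = A"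
    unfolding A_def by (rule PiM_truncated_integral) (use g_meas supp R in auto)
  have bound: "(LINT x|lborel. \<bar>v x\<bar> powr q) \<le> (A + \<epsilon> * V) powr q" if \<epsilon>: "\<epsilon> > 0" for \<epsilon>
  proof -
    \<comment> \<open>The shift by \<epsilon> makes f positive, so that \<open>f y powr 0\<close> is
      1; at a zero of f it would be 0. The shift disappears in the limit \<epsilon> to 0.\<close>
    define f where "f y = norm (g (of_coords y)) + \<epsilon>" for y
    have f_meas: "f \<in> borel_measurable ?P"
      unfolding f_def[abs_def] using measurable_compose[OF oc, of g borel] g_meas by simp
    have f0: "f y > 0" for y using \<epsilon> by (simp add: f_def add_nonneg_pos)
    have fB: "f y \<le> B + \<epsilon>" for y using B by (simp add: f_def)
    have marg: "\<bar>v (of_coords y)\<bar> \<le> marginal ?M e f y" if y: "y \<in> space ?P" and e: "e \<in> Basis" for y e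
    proof -
      have "marginal ?M e (\<lambda>y. norm (g (of_coords y))) y \<le> marginal ?M e f y"
        unfolding marginal_def
      proof (rule integral_mono')
        show "integrable ?M (\<lambda>t. f (y(e := t)))"
          using slice_integrable[OF fin, of f e Basis "B + \<epsilon>" y] f_meas fB f0 e y
          by (simp add: insert_absorb abs_of_pos)
      qed (use f0 \<epsilon> in \<open>auto simp: f_def less_imp_le\<close>)
      then show ?thesis using line[OF e, of y] by simp
    qed
    have "(LINT x|lborel. \<bar>v x\<bar> powr q) = (LINT y|?P. \<bar>v (of_coords y)\<bar> powr q)"
      by (rule PiM_truncated_integral[symmetric]) (use v_meas supp R in auto)
    also have "\<dots> \<le> (LINT y|?P. f y powr (1 - (real DIM('a) - 1) * p) * (\<Prod>e\<in>Basis. marginal ?M e f y powr p))"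
    proof (rule integral_mono_AE')
      show "integrable ?P (\<lambda>y. f y powr (1 - (real DIM('a) - 1) * p) * (\<Prod>e\<in>Basis. marginal ?M e f y powr p))"
      proof (rule P.integrable_const_bound)
        show "(\<lambda>y. f y powr (1 - (real DIM('a) - 1) * p) * (\<Prod>e\<in>Basis. marginal ?M e f y powr p)) \<in> borel_measurable ?P"
          by (intro borel_measurable_times borel_measurable_prod powr_real_measurable f_meas marginal_measurable[OF fin f_meas]) auto
        have "(\<Prod>e\<in>Basis. marginal ?M e f y powr p) \<le> (\<Prod>e\<in>(Basis::'a set). ((B + \<epsilon>) * measure ?M (space ?M)) powr p)" for y
          using f0 fB p(1) by (intro prod_mono conjI powr_mono2 marginal_nonneg[OF fin] marginal_le[OF fin]) (auto simp: less_imp_le)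
        then show "AE y in ?P. norm (f y powr (1 - (real DIM('a) - 1) * p) * (\<Prod>e\<in>Basis. marginal ?M e f y powr p)) \<le>
            (\<Prod>e\<in>(Basis::'a set). ((B + \<epsilon>) * measure ?M (space ?M)) powr p)"
          using p(2) f0 by (simp add: prod_nonneg less_imp_neq[symmetric])
      qed
      show "AE y in ?P. \<bar>v (of_coords y)\<bar> powr q \<le> f y powr (1 - (real DIM('a) - 1) * p) * (\<Prod>e\<in>Basis. marginal ?M e f y powr p)"
      proof (rule AE_I2)
        fix y assume y: "y \<in> space ?P"
        have "\<bar>v (of_coords y)\<bar> powr q = (\<Prod>e\<in>(Basis::'a set). \<bar>v (of_coords y)\<bar> powr p)"
        proof (cases "v (of_coords y) = 0")
          case True
          then show ?thesis by (auto intro!: prod_zero[symmetric])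
        next
          case False
          then show ?thesis using p(5) by (simp add: powr_power mult.commute)
        qed
        also have "\<dots> \<le> (\<Prod>e\<in>Basis. marginal ?M e f y powr p)"
          using marg[OF y] p(1) by (intro prod_mono conjI powr_mono2) auto
        finally show "\<bar>v (of_coords y)\<bar> powr q \<le> f y powr (1 - (real DIM('a) - 1) * p) * (\<Prod>e\<in>Basis. marginal ?M e f y powr p)"
          using p(2) f0[of y] by simp
      qed
    qed (auto intro!: mult_nonneg_nonneg prod_nonneg)
    also have "\<dots> \<le> (LINT y|?P. f y) powr (1 + p)"
      by (rule gridlines[OF fin finite_Basis f_meas]) (use f0 fB p in \<open>auto simp: less_imp_le\<close>)
    also have "(LINT y|?P. f y) = A + \<epsilon> * V"
      unfolding f_def A[symmetric] V_def using gint by simp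
    finally show ?thesis unfolding p(3) .
  qed
  have "(LINT x|lborel. \<bar>v x\<bar> powr q) \<le> A powr q"
  proof (rule tendsto_lowerbound)
    have "((\<lambda>\<epsilon>. (A + \<epsilon> * V) powr q) \<longlongrightarrow> (A + 0 * V) powr q) (at_right 0)"
      using p(4) by (intro tendsto_powr' tendsto_intros)
        (auto simp: A_def V_def eventually_at_right_less intro!: eventually_at_rightI[of 0 1] add_nonneg_nonneg mult_nonneg_nonneg)
    then show "((\<lambda>\<epsilon>. (A + \<epsilon> * V) powr q) \<longlongrightarrow> A powr q) (at_right 0)" by simp
    show "\<forall>\<^sub>F \<epsilon> in at_right 0. (LINT x|lborel. \<bar>v x\<bar> powr q) \<le> (A + \<epsilon> * V) powr q"
      using bound by (auto intro!: eventually_at_rightI[of 0 1])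
  qed simp
  then show ?thesis unfolding q_def A_def .
qed

section \<open>The Sobolev inequality at the critical exponent\<close>

lemma crit_exp_props:
  assumes "N > 2"
  shows "crit_exp N > 2" "crit_exp N > 0" "2 / crit_exp N = (real N - 2) / real N" "crit_exp N / 2 = real N / (real N - 2)"
  using assms by (auto simp: crit_exp_def field_simps)

text \<open>With \<open>\<gamma> = 2 (N - 1) / (N - 2)\<close>, the \<open>W\<^sup>1\<^sup>,\<^sup>1\<close> inequality is applied to \<open>\<bar>\<phi>\<bar> powr \<gamma>\<close>; this choice makes both
  \<open>\<gamma> N / (N - 1)\<close> and \<open>2 (\<gamma> - 1)\<close> equal to the critical exponent.\<close>

definition sobolev_bound :: "nat \<Rightarrow> real" where
  "sobolev_bound N = (2 * (real N - 1) / (real N - 2))\<^sup>2"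

lemma sobolev_bound_pos: "N > 2 \<Longrightarrow> sobolev_bound N > 0"
  by (auto simp: sobolev_bound_def)

text \<open>Cauchy-Schwarz splits |\<nabla>v| = \<gamma> |\<phi>|^(\<gamma> - 1) |\<nabla>\<phi>|.
  The critical integral then stands on both sides and is absorbed, since on the right it occurs only
  to the power q/2 < 1.\<close>

lemma test_sobolev:
  fixes \<phi> :: "'a::euclidean_space \<Rightarrow> real"
  assumes \<phi>: "test_function \<Omega> \<phi>" and N: "DIM('a) > 2"
  shows "integrable lborel (\<lambda>x. \<bar>\<phi> x\<bar> powr crit_exp DIM('a))"
    "(LINT x|lborel. \<bar>\<phi> x\<bar> powr crit_exp DIM('a)) powr (2 / crit_exp DIM('a)) \<le>
      sobolev_bound DIM('a) * (LINT x|lborel. (norm (gradient \<phi> x))\<^sup>2)"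
proof -
  define n where "n = real DIM('a)"
  define \<gamma> where "\<gamma> = 2 * (n - 1) / (n - 2)"
  define q where "q = n / (n - 1)"
  define r where "r = crit_exp DIM('a)"
  have n: "n > 2" using N by (simp add: n_def)
  have r: "r = 2 * n / (n - 2)" by (simp add: r_def crit_exp_def n_def)
  define k where "k = n - 1"
  have "n = k + 1" "k > 1" using n by (auto simp: k_def)
  then have "\<gamma> * q = r" by (simp add: \<gamma>_def q_def r)
  \<comment> \<open>1 - q/2 > 0 allows the absorption, and (1 - q/2)(2/q) = 2/r is the exponent that
    it leaves on the critical integral.\<close>
  then have ex: "\<gamma> > 2" "\<gamma> > 1" "\<gamma> * q = r" "2 * (\<gamma> - 1) = r" "q > 0" "1 - q / 2 > 0" "(1 - q / 2) * (2 / q) = 2 / r" "r > 0"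
    using n by (auto simp: \<gamma>_def q_def r field_simps)
  obtain K where K: "compact K" "K \<subseteq> \<Omega>" "\<And>x. x \<notin> K \<Longrightarrow> \<phi> x = 0" "\<And>x. x \<notin> K \<Longrightarrow> gradient \<phi> x = 0"
    using test_support[OF \<phi>] by metis
  note cont = test_continuous[OF \<phi>] and gcont = test_gradient_continuous[OF \<phi>]
  have contr: "continuous_on UNIV (\<lambda>x. \<bar>\<phi> x\<bar> powr r)"
    using ex(8) by (intro continuous_on_powr' continuous_intros cont) auto
  show int: "integrable lborel (\<lambda>x. \<bar>\<phi> x\<bar> powr crit_exp DIM('a))"
    unfolding r_def[symmetric] by (rule compact_support_integrable[OF K(1) contr]) (simp add: K(3))
  obtain R where R: "R > 0" "\<And>x. x \<in> K \<Longrightarrow> norm x < R"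
    using compact_imp_bounded[OF K(1)] unfolding bounded_pos_less by auto
  define v where "v x = \<bar>\<phi> x\<bar> powr \<gamma>" for x
  define g where "g x = (\<gamma> * (\<bar>\<phi> x\<bar> powr (\<gamma> - 2) * \<phi> x)) *\<^sub>R gradient \<phi> x" for x
  have "(LINT x|lborel. \<bar>v x\<bar> powr (real DIM('a) / (real DIM('a) - 1))) \<le>
      (LINT x|lborel. norm (g x)) powr (real DIM('a) / (real DIM('a) - 1))"
  proof (rule Gagliardo_Nirenberg[where R=R])
    fix x
    have "(v has_derivative (\<lambda>h. (gradient \<phi> x \<bullet> h) * (\<gamma> * (\<bar>\<phi> x\<bar> powr (\<gamma> - 2) * \<phi> x)))) (at x)"
      using has_derivative_compose[OF test_has_derivative[OF \<phi>] abs_powr_DERIV[OF ex(2), unfolded has_field_derivative_def], of x]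
      by (simp add: v_def[abs_def] mult.commute)
    then show "(v has_derivative (\<lambda>h. g x \<bullet> h)) (at x)" by (simp add: g_def mult.commute)
    show "v x = 0 \<and> g x = 0" if "norm x \<ge> R"
      using K(3,4)[of x] R(2)[of x] that by (force simp: v_def g_def)
  next
    show "continuous_on UNIV g"
      unfolding g_def using ex(1) by (intro continuous_on_powr' continuous_intros cont gcont) auto
  qed (use R N in auto)
  moreover have "\<bar>v x\<bar> powr q = \<bar>\<phi> x\<bar> powr r" for x by (simp add: v_def powr_powr ex(3))
  ultimately have *: "(LINT x|lborel. \<bar>\<phi> x\<bar> powr r) \<le> (LINT x|lborel. norm (g x)) powr q"
    by (simp add: q_def n_def)
  define X where "X = (LINT x|lborel. \<bar>\<phi> x\<bar> powr r)"
  define D where "D = (LINT x|lborel. (norm (gradient \<phi> x))\<^sup>2)"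
  have X0: "X \<ge> 0" and D0: "D \<ge> 0" by (simp_all add: X_def D_def)
  have UD: "l2_inner UNIV (gradient \<phi>) (gradient \<phi>) = D"
    unfolding l2_inner_self_eq D_def
    by (rule lebesgue_on_integral_eq_lborel(1)) (auto intro!: borel_measurable_continuous_onI continuous_intros gcont)
  define w where "w x = \<bar>\<phi> x\<bar> powr (\<gamma> - 1)" for x
  have contw: "continuous_on UNIV w"
    unfolding w_def using ex(2) by (intro continuous_on_powr' continuous_intros cont) auto
  have w2: "w x * w x = \<bar>\<phi> x\<bar> powr r" for x
    unfolding w_def powr_add[symmetric] ex(4)[symmetric] by (simp add: algebra_simps)
  have UX: "l2_inner UNIV w w = X"
    unfolding l2_inner_def X_def inner_real_def w2
    by (rule lebesgue_on_integral_eq_lborel(1)) (auto intro!: borel_measurable_continuous_onI contr)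
  have wL2: "w \<in> L2_space UNIV"
    by (rule compact_support_L2[OF open_UNIV K(1) _ contw]) (simp_all add: w_def K(3))
  have gL2: "(\<lambda>x. norm (gradient \<phi> x)) \<in> L2_space UNIV"
    by (rule compact_support_L2[OF open_UNIV K(1)]) (auto intro!: continuous_intros gcont simp: K(4))
  have "l2_norm UNIV (\<lambda>x. norm (gradient \<phi> x)) = l2_norm UNIV (gradient \<phi>)"
    by (simp add: l2_norm_def l2_inner_def power2_norm_eq_inner flip: power2_eq_square)
  then have CS: "\<bar>l2_inner UNIV w (\<lambda>x. norm (gradient \<phi> x))\<bar> \<le> sqrt X * sqrt D"
    using l2_Cauchy_Schwarz[OF wL2 gL2] by (simp add: l2_norm_def UX UD)
  have ng: "norm (g x) = \<gamma> * (w x * norm (gradient \<phi> x))" for x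
  proof -
    have "\<bar>\<phi> x\<bar> powr (\<gamma> - 2) * \<bar>\<phi> x\<bar> = w x"
      using powr_add[of "\<bar>\<phi> x\<bar>" "\<gamma> - 2" 1] by (simp add: w_def)
    then show ?thesis using ex(1) by (simp add: g_def abs_mult)
  qed
  have "(LINT x|lborel. norm (g x)) = \<gamma> * l2_inner UNIV w (\<lambda>x. norm (gradient \<phi> x))"
  proof -
    have "l2_inner UNIV w (\<lambda>x. norm (gradient \<phi> x)) = (LINT x|lborel. w x * norm (gradient \<phi> x))"
      unfolding l2_inner_def inner_real_def
      by (rule lebesgue_on_integral_eq_lborel(1)) (auto intro!: borel_measurable_continuous_onI continuous_intros contw gcont)
    then show ?thesis by (simp add: ng)
  qed
  also have "\<dots> \<le> \<gamma> * (sqrt X * sqrt D)" using CS ex(1) by (intro mult_left_mono) auto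
  finally have "(LINT x|lborel. norm (g x)) powr q \<le> (\<gamma> * (sqrt X * sqrt D)) powr q"
    using ex(5) by (intro powr_mono2) (auto intro: Bochner_Integration.integral_nonneg)
  with * have XX: "X \<le> (\<gamma> * (sqrt X * sqrt D)) powr q" by (simp add: X_def)
  have "X powr (2 / r) \<le> \<gamma>\<^sup>2 * D"
  proof (cases "X = 0")
    case True
    then show ?thesis using D0 by simp
  next
    case False
    then have Xp: "X > 0" using X0 by simp
    have sq: "sqrt X = X powr (1/2)" "sqrt D = D powr (1/2)" using X0 D0 by (simp_all add: powr_half_sqrt)
    have "X \<le> \<gamma> powr q * (X powr (q / 2) * D powr (q / 2))"
      using XX ex(1) by (simp add: powr_mult powr_powr sq)
    then have "X / X powr (q / 2) \<le> \<gamma> powr q * D powr (q / 2)"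
      using Xp by (simp add: field_simps)
    then have "X powr (1 - q / 2) \<le> \<gamma> powr q * D powr (q / 2)"
      using Xp by (simp add: powr_diff)
    then have "(X powr (1 - q / 2)) powr (2 / q) \<le> (\<gamma> powr q * D powr (q / 2)) powr (2 / q)"
      using ex(5) by (intro powr_mono2) auto
    also have "\<dots> = \<gamma> powr 2 * D powr 1"
      using ex(1,5) by (simp add: powr_mult powr_powr)
    also have "\<dots> = \<gamma>\<^sup>2 * D" using ex(1) D0 by simp
    finally show ?thesis by (simp only: powr_powr ex(7))
  qed
  then show "(LINT x|lborel. \<bar>\<phi> x\<bar> powr crit_exp DIM('a)) powr (2 / crit_exp DIM('a)) \<le>
      sobolev_bound DIM('a) * (LINT x|lborel. (norm (gradient \<phi> x))\<^sup>2)"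
    by (simp add: sobolev_bound_def X_def D_def r_def \<gamma>_def n_def)
qed

context bounded_open
begin

lemma test_sobolev_\<Omega>:
  assumes "test_function \<Omega> \<phi>" "DIM('a) > 2"
  shows "integrable (lebesgue_on \<Omega>) (\<lambda>x. \<bar>\<phi> x\<bar> powr crit_exp DIM('a))"
    "(LINT x|lebesgue_on \<Omega>. \<bar>\<phi> x\<bar> powr crit_exp DIM('a)) powr (2 / crit_exp DIM('a)) \<le>
      sobolev_bound DIM('a) * l2_inner \<Omega> (gradient \<phi>) (gradient \<phi>)"
proof -
  obtain K where K: "compact K" "K \<subseteq> \<Omega>" "\<And>x. x \<notin> K \<Longrightarrow> \<phi> x = 0" "\<And>x. x \<notin> K \<Longrightarrow> gradient \<phi> x = 0"
    using test_support[OF assms(1)] by metis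
  have [measurable]: "\<phi> \<in> borel_measurable borel" "gradient \<phi> \<in> borel_measurable borel"
    using test_continuous[OF assms(1)] test_gradient_continuous[OF assms(1)] by (auto intro: borel_measurable_continuous_onI)
  have z: "\<phi> x = 0" "gradient \<phi> x = 0" if "x \<notin> \<Omega>" for x using K that by blast+
  note t = test_sobolev[OF assms]
  show "integrable (lebesgue_on \<Omega>) (\<lambda>x. \<bar>\<phi> x\<bar> powr crit_exp DIM('a))"
    using t(1) z by (subst lebesgue_on_integral_eq_lborel(2)[OF open_\<Omega>]) auto
  show "(LINT x|lebesgue_on \<Omega>. \<bar>\<phi> x\<bar> powr crit_exp DIM('a)) powr (2 / crit_exp DIM('a)) \<le>
      sobolev_bound DIM('a) * l2_inner \<Omega> (gradient \<phi>) (gradient \<phi>)"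
    unfolding l2_inner_self_eq using t(2) z by (simp add: lebesgue_on_integral_eq_lborel(1)[OF open_\<Omega>])
qed

text \<open>Integrability of the critical power of a limit jet is part of the claim, so Fatou's
  lemma is applied along an almost everywhere convergent sequence of test functions whose gradient
  norms converge.\<close>

theorem sobolev_inequality:
  assumes U: "U \<in> jet_space \<Omega>" and N: "DIM('a) > 2"
  shows "integrable (lebesgue_on \<Omega>) (\<lambda>x. \<bar>fst (U x)\<bar> powr crit_exp DIM('a))"
    "(LINT x|lebesgue_on \<Omega>. \<bar>fst (U x)\<bar> powr crit_exp DIM('a)) powr (2 / crit_exp DIM('a)) \<le>
      sobolev_bound DIM('a) * l2_inner \<Omega> (\<lambda>x. snd (U x)) (\<lambda>x. snd (U x))"
proof -
  let ?M = "lebesgue_on \<Omega>"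
  define r where "r = crit_exp DIM('a)"
  define C where "C = sobolev_bound DIM('a)"
  have r: "r > 0" unfolding r_def by (rule crit_exp_props(2)[OF N])
  have C: "C > 0" unfolding C_def by (rule sobolev_bound_pos[OF N])
  obtain \<phi> where \<phi>: "\<And>n::nat. test_function \<Omega> (\<phi> n)" "(\<lambda>n. l2_norm \<Omega> (\<lambda>x. jet (\<phi> n) x - U x)) \<longlonglongrightarrow> 0"
    using jet_space_sequence[OF U] by blast
  note UL2 = jet_space_L2[OF U]
  obtain k :: "nat \<Rightarrow> nat" where k: "strict_mono k" "AE x in ?M. (\<lambda>n. jet (\<phi> (k n)) x) \<longlonglongrightarrow> U x"
    using L2_AE_subseq[OF lmeasurable_\<Omega> jet_L2[OF \<phi>(1)] UL2 \<phi>(2)] by blast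
  define D where "D = l2_inner \<Omega> (\<lambda>x. snd (U x)) (\<lambda>x. snd (U x))"
  define D' where "D' n = l2_inner \<Omega> (gradient (\<phi> (k n))) (gradient (\<phi> (k n)))" for n
  have D'lim: "D' \<longlonglongrightarrow> D"
  proof -
    have "(\<lambda>n. l2_norm \<Omega> (\<lambda>x. gradient (\<phi> n) x - snd (U x))) \<longlonglongrightarrow> 0"
    proof (rule Lim_null_comparison[OF _ \<phi>(2)])
      have "l2_norm \<Omega> (\<lambda>x. gradient (\<phi> n) x - snd (U x)) \<le> l2_norm \<Omega> (\<lambda>x. jet (\<phi> n) x - U x)" for n
        using l2_norm_fst_snd_le(3)[OF L2_diff[OF jet_L2[OF \<phi>(1)[of n]] UL2]] by (simp add: jet_def)
      then show "\<forall>\<^sub>F n in sequentially. norm (l2_norm \<Omega> (\<lambda>x. gradient (\<phi> n) x - snd (U x))) \<le> l2_norm \<Omega> (\<lambda>x. jet (\<phi> n) x - U x)"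
        by simp
    qed
    then have "(\<lambda>n. l2_norm \<Omega> (gradient (\<phi> n))) \<longlonglongrightarrow> l2_norm \<Omega> (\<lambda>x. snd (U x))"
      by (rule l2_norm_tendsto[OF test_L2(2)[OF open_\<Omega> \<phi>(1)] L2_fst_snd(2)[OF UL2]])
    then have "(\<lambda>n. (l2_norm \<Omega> (gradient (\<phi> (k n))))\<^sup>2) \<longlonglongrightarrow> (l2_norm \<Omega> (\<lambda>x. snd (U x)))\<^sup>2"
      using LIMSEQ_subseq_LIMSEQ[OF _ k(1)] by (auto intro!: tendsto_power simp: o_def)
    then show ?thesis by (simp add: l2_norm_square D_def D'_def[abs_def])
  qed
  have D0: "D \<ge> 0" "D' n \<ge> 0" for n by (simp_all add: D_def D'_def)
  have [measurable]: "(\<lambda>x. fst (U x)) \<in> borel_measurable ?M" by (rule L2_measurable[OF L2_fst_snd(1)[OF UL2]])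
  have [measurable]: "\<phi> n \<in> borel_measurable ?M" for n by (rule L2_measurable[OF test_L2(1)[OF open_\<Omega> \<phi>(1)]])
  have "(\<integral>\<^sup>+x. ennreal (\<bar>fst (U x)\<bar> powr r) \<partial>?M) = (\<integral>\<^sup>+x. liminf (\<lambda>n. ennreal (\<bar>\<phi> (k n) x\<bar> powr r)) \<partial>?M)"
  proof (rule nn_integral_cong_AE)
    show "AE x in ?M. ennreal (\<bar>fst (U x)\<bar> powr r) = liminf (\<lambda>n. ennreal (\<bar>\<phi> (k n) x\<bar> powr r))"
      using k(2)
    proof eventually_elim
      case (elim x)
      have "(\<lambda>n. \<phi> (k n) x) \<longlonglongrightarrow> fst (U x)" using tendsto_fst[OF elim] by (simp add: jet_def)
      then have "(\<lambda>n. \<bar>\<phi> (k n) x\<bar> powr r) \<longlonglongrightarrow> \<bar>fst (U x)\<bar> powr r"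
        using r by (intro tendsto_powr' tendsto_intros) auto
      then have "(\<lambda>n. ennreal (\<bar>\<phi> (k n) x\<bar> powr r)) \<longlonglongrightarrow> ennreal (\<bar>fst (U x)\<bar> powr r)" by (rule tendsto_ennrealI)
      then show ?case by (rule lim_imp_Liminf[OF trivial_limit_sequentially, symmetric])
    qed
  qed
  also have "\<dots> \<le> liminf (\<lambda>n. \<integral>\<^sup>+x. ennreal (\<bar>\<phi> (k n) x\<bar> powr r) \<partial>?M)"
    by (rule nn_integral_liminf) measurable
  also have "\<dots> \<le> liminf (\<lambda>n. ennreal ((C * D' n) powr (r / 2)))"
  proof (rule Liminf_mono, intro always_eventually allI)
    fix n
    note s = test_sobolev_\<Omega>[OF \<phi>(1)[of "k n"] N, folded r_def C_def D'_def]
    define X where "X = (LINT x|?M. \<bar>\<phi> (k n) x\<bar> powr r)"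
    have "X \<ge> 0" by (simp add: X_def)
    have "(X powr (2 / r)) powr (r / 2) \<le> (C * D' n) powr (r / 2)"
      using s(2) r unfolding X_def by (intro powr_mono2) auto
    then have "X \<le> (C * D' n) powr (r / 2)" using r \<open>X \<ge> 0\<close> by (simp add: powr_powr)
    moreover have "(\<integral>\<^sup>+x. ennreal (\<bar>\<phi> (k n) x\<bar> powr r) \<partial>?M) = ennreal X"
      unfolding X_def using s(1) by (intro nn_integral_eq_integral) auto
    ultimately show "(\<integral>\<^sup>+x. ennreal (\<bar>\<phi> (k n) x\<bar> powr r) \<partial>?M) \<le> ennreal ((C * D' n) powr (r / 2))"
      by (simp add: ennreal_leI)
  qed
  also have "\<dots> = ennreal ((C * D) powr (r / 2))"
  proof (rule lim_imp_Liminf[OF trivial_limit_sequentially tendsto_ennrealI])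
    show "(\<lambda>n. (C * D' n) powr (r / 2)) \<longlonglongrightarrow> (C * D) powr (r / 2)"
      using r C D0 by (intro tendsto_powr' tendsto_intros D'lim) auto
  qed
  finally have le: "(\<integral>\<^sup>+x. ennreal (\<bar>fst (U x)\<bar> powr r) \<partial>?M) \<le> ennreal ((C * D) powr (r / 2))" .
  have int: "integrable ?M (\<lambda>x. \<bar>fst (U x)\<bar> powr r)"
    using le_less_trans[OF le] by (intro integrableI_nonneg) auto
  then show "integrable ?M (\<lambda>x. \<bar>fst (U x)\<bar> powr crit_exp DIM('a))" by (simp add: r_def)
  define X where "X = (LINT x|?M. \<bar>fst (U x)\<bar> powr r)"
  have X0: "X \<ge> 0" by (simp add: X_def)
  have "ennreal X \<le> ennreal ((C * D) powr (r / 2))"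
    using le nn_integral_eq_integral[OF int] by (simp add: X_def)
  then have "X powr (2 / r) \<le> ((C * D) powr (r / 2)) powr (2 / r)"
    using X0 r by (intro powr_mono2) (auto simp: ennreal_le_iff)
  also have "\<dots> = C * D" using r C D0 by (simp add: powr_powr)
  finally show "(LINT x|?M. \<bar>fst (U x)\<bar> powr crit_exp DIM('a)) powr (2 / crit_exp DIM('a)) \<le>
      sobolev_bound DIM('a) * l2_inner \<Omega> (\<lambda>x. snd (U x)) (\<lambda>x. snd (U x))"
    by (simp add: X_def r_def C_def D_def)
qed

end

section \<open>Compactness of the embedding into square-integrable functions\<close>

text \<open>Expand the nonnegative integral of (f - c)^2 over Q, with c the mean of f on Q.\<close>

lemma square_integral_indicator_le:
  fixes f :: "'a \<Rightarrow> real"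
  assumes Q: "Q \<in> fmeasurable M" "measure M Q > 0"
    and int: "integrable M (\<lambda>x. indicator Q x * f x)" "integrable M (\<lambda>x. indicator Q x * (f x)\<^sup>2)"
  shows "(LINT x|M. indicator Q x * f x)\<^sup>2 \<le> measure M Q * (LINT x|M. indicator Q x * (f x)\<^sup>2)"
proof -
  define V where "V = measure M Q"
  define m where "m = (LINT x|M. indicator Q x * f x)"
  define c where "c = m / V"
  have V: "V > 0" using Q by (simp add: V_def)
  have iQ: "integrable M (\<lambda>x. indicator Q x :: real)"
    using Q(1) by (intro integrable_real_indicator) (auto simp: fmeasurable_def)
  have "0 \<le> (LINT x|M. indicator Q x * (f x - c)\<^sup>2)" by (rule Bochner_Integration.integral_nonneg) simp
  also have "\<dots> = (LINT x|M. indicator Q x * (f x)\<^sup>2 - 2 * c * (indicator Q x * f x) + c\<^sup>2 * indicator Q x)"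
    by (rule Bochner_Integration.integral_cong) (auto simp: power2_diff algebra_simps)
  also have "\<dots> = (LINT x|M. indicator Q x * (f x)\<^sup>2) - 2 * c * m + c\<^sup>2 * V"
    using int iQ Q(1) by (simp add: m_def V_def fmeasurable_def)
  finally have "2 * c * m - c\<^sup>2 * V \<le> (LINT x|M. indicator Q x * (f x)\<^sup>2)" by simp
  moreover have "2 * c * m - c\<^sup>2 * V = m\<^sup>2 / V" using V by (simp add: c_def power2_eq_square field_simps)
  ultimately show ?thesis using V by (simp add: m_def V_def field_simps)
qed

text \<open>Fundamental theorem of calculus on the segment from x to x + z, Cauchy-Schwarz over the
  unit interval, then Fubini and translation invariance. Nonnegative extended integrals avoid an
  integrability check on the product.\<close>

lemma test_translation_estimate:
  fixes w :: "'a::euclidean_space \<Rightarrow> real"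
  assumes w: "test_function \<Omega> w"
  shows "(\<integral>\<^sup>+x. ennreal ((w (x + z) - w x)\<^sup>2) \<partial>lborel) \<le>
    ennreal ((norm z)\<^sup>2 * (LINT x|lborel. (norm (gradient w x))\<^sup>2))"
proof -
  note cont = test_continuous[OF w] and gcont = test_gradient_continuous[OF w]
  have gm [measurable]: "gradient w \<in> borel_measurable borel" using gcont by (rule borel_measurable_continuous_onI)
  have gint: "integrable lborel (\<lambda>x. (norm (gradient w x))\<^sup>2)"
    by (rule compact_support_integrable[OF test_compact_support[OF w]])
      (auto intro!: continuous_intros gcont simp: test_gradient_zero_outside[OF w])
  have pt: "ennreal ((w (x + z) - w x)\<^sup>2) \<le>
      (\<integral>\<^sup>+t. indicator {0..1} t * ennreal ((norm z)\<^sup>2 * (norm (gradient w (x + t *\<^sub>R z)))\<^sup>2) \<partial>lborel)" for x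
  proof -
    define f where "f t = gradient w (x + t *\<^sub>R z) \<bullet> z" for t :: real
    have gc: "continuous_on T (\<lambda>t. gradient w (x + t *\<^sub>R z))" for T
      by (rule continuous_on_compose2[OF gcont[of UNIV]]) (auto intro!: continuous_intros)
    have fc: "continuous_on T f" for T unfolding f_def[abs_def] by (intro continuous_on_inner gc continuous_on_const)
    have der: "((\<lambda>t. w (x + t *\<^sub>R z)) has_vector_derivative f t) (at t within S)" for t S
    proof -
      have "((\<lambda>t. x + t *\<^sub>R z) has_derivative (\<lambda>h. h *\<^sub>R z)) (at t within S)"
        by (auto intro!: derivative_eq_intros)
      from has_derivative_compose[OF this test_has_derivative[OF w]] show ?thesis
        by (simp add: has_vector_derivative_def f_def)
    qed
    have FTC: "(LINT t|lborel. indicator {0..1} t *\<^sub>R f t) = w (x + 1 *\<^sub>R z) - w (x + 0 *\<^sub>R z)"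
      by (rule integral_FTC_Icc[where F="\<lambda>t. w (x + t *\<^sub>R z)"]) (simp, rule der, rule fc)
    have int: "integrable lborel (\<lambda>t. indicator {0..1::real} t * g t)" if "continuous_on {0..1} g" for g :: "real \<Rightarrow> real"
      using borel_integrable_compact[OF _ that] by simp
    have f2c: "continuous_on {0..1} (\<lambda>t. (f t)\<^sup>2)" by (intro continuous_on_power fc)
    have bc: "continuous_on {0..1} (\<lambda>t. (norm z)\<^sup>2 * (norm (gradient w (x + t *\<^sub>R z)))\<^sup>2)"
      by (intro continuous_on_mult continuous_on_const continuous_on_power continuous_on_norm gc)
    have "(w (x + z) - w x)\<^sup>2 = (LINT t|lborel. indicator {0..1} t * f t)\<^sup>2" using FTC by simp
    also have "\<dots> \<le> measure lborel {0..1::real} * (LINT t|lborel. indicator {0..1} t * (f t)\<^sup>2)"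
      by (rule square_integral_indicator_le) (auto intro!: int fc f2c simp: fmeasurable_def)
    also have "\<dots> \<le> (LINT t|lborel. indicator {0..1} t * ((norm z)\<^sup>2 * (norm (gradient w (x + t *\<^sub>R z)))\<^sup>2))"
    proof -
      have "(f t)\<^sup>2 \<le> (norm z)\<^sup>2 * (norm (gradient w (x + t *\<^sub>R z)))\<^sup>2" for t
        using abs_le_square_iff[of "f t" "norm (gradient w (x + t *\<^sub>R z)) * norm z"]
          Cauchy_Schwarz_ineq2[of "gradient w (x + t *\<^sub>R z)" z] by (simp add: f_def power_mult_distrib mult.commute)
      then show ?thesis
        by (simp, intro integral_mono int f2c bc) (auto simp: indicator_def)
    qed
    finally have le: "(w (x + z) - w x)\<^sup>2 \<le> (LINT t|lborel. indicator {0..1} t * ((norm z)\<^sup>2 * (norm (gradient w (x + t *\<^sub>R z)))\<^sup>2))" .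
    have "ennreal (LINT t|lborel. indicator {0..1} t * ((norm z)\<^sup>2 * (norm (gradient w (x + t *\<^sub>R z)))\<^sup>2)) =
       (\<integral>\<^sup>+t. ennreal (indicator {0..1} t * ((norm z)\<^sup>2 * (norm (gradient w (x + t *\<^sub>R z)))\<^sup>2)) \<partial>lborel)"
      by (rule nn_integral_eq_integral[symmetric]) (auto intro!: int bc)
    also have "\<dots> = (\<integral>\<^sup>+t. indicator {0..1} t * ennreal ((norm z)\<^sup>2 * (norm (gradient w (x + t *\<^sub>R z)))\<^sup>2) \<partial>lborel)"
      by (rule nn_integral_cong) (simp add: ennreal_mult' ennreal_indicator)
    finally show ?thesis using ennreal_leI[OF le] by simp
  qed
  have "(\<integral>\<^sup>+x. ennreal ((w (x + z) - w x)\<^sup>2) \<partial>lborel) \<le>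
      (\<integral>\<^sup>+x. \<integral>\<^sup>+t. indicator {0..1} t * ennreal ((norm z)\<^sup>2 * (norm (gradient w (x + t *\<^sub>R z)))\<^sup>2) \<partial>lborel \<partial>lborel)"
    by (rule nn_integral_mono) (rule pt)
  also have "\<dots> = (\<integral>\<^sup>+t. \<integral>\<^sup>+x. indicator {0..1} t * ennreal ((norm z)\<^sup>2 * (norm (gradient w (x + t *\<^sub>R z)))\<^sup>2) \<partial>lborel \<partial>lborel)"
    by (rule lborel_pair.Fubini') measurable
  also have "\<dots> = (\<integral>\<^sup>+t. indicator {0..1::real} t * ennreal ((norm z)\<^sup>2 * (LINT x|lborel. (norm (gradient w x))\<^sup>2)) \<partial>lborel)"
  proof (rule nn_integral_cong)
    fix t :: real
    have "(\<integral>\<^sup>+x. indicator {0..1} t * ennreal ((norm z)\<^sup>2 * (norm (gradient w (x + t *\<^sub>R z)))\<^sup>2) \<partial>lborel) =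
        indicator {0..1} t * (\<integral>\<^sup>+x. ennreal ((norm z)\<^sup>2 * (norm (gradient w (x + t *\<^sub>R z)))\<^sup>2) \<partial>lborel)"
      by (rule nn_integral_cmult) measurable
    also have "(\<integral>\<^sup>+x. ennreal ((norm z)\<^sup>2 * (norm (gradient w (x + t *\<^sub>R z)))\<^sup>2) \<partial>lborel) =
        (\<integral>\<^sup>+x. ennreal ((norm z)\<^sup>2 * (norm (gradient w x))\<^sup>2) \<partial>lborel)"
      by (rule lborel_nn_integral_translation[where f="\<lambda>x. ennreal ((norm z)\<^sup>2 * (norm (gradient w x))\<^sup>2)"]) measurable
    also have "\<dots> = ennreal ((norm z)\<^sup>2 * (LINT x|lborel. (norm (gradient w x))\<^sup>2))"
      using gint by (subst nn_integral_eq_integral) auto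
    finally show "(\<integral>\<^sup>+x. indicator {0..1} t * ennreal ((norm z)\<^sup>2 * (norm (gradient w (x + t *\<^sub>R z)))\<^sup>2) \<partial>lborel) =
      indicator {0..1} t * ennreal ((norm z)\<^sup>2 * (LINT x|lborel. (norm (gradient w x))\<^sup>2))" .
  qed
  also have "\<dots> = ennreal ((norm z)\<^sup>2 * (LINT x|lborel. (norm (gradient w x))\<^sup>2))"
    by (subst nn_integral_multc) auto
  finally show ?thesis .
qed

text \<open>For h > 0, the half-open cube of side h with corner in the lattice h Z^N that contains
  x. Floors make the cells a partition, each given by finitely many integers.\<close>

definition grid_cell :: "real \<Rightarrow> 'a::euclidean_space \<Rightarrow> 'a set" where
  "grid_cell h x = {y. \<forall>e\<in>Basis. \<lfloor>y \<bullet> e / h\<rfloor> = \<lfloor>x \<bullet> e / h\<rfloor>}"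

lemma grid_cell_borel: "grid_cell h x \<in> sets borel"
proof -
  have "{y \<in> space borel. \<forall>e\<in>Basis. \<lfloor>y \<bullet> e / h\<rfloor> = \<lfloor>x \<bullet> e / h\<rfloor>} \<in> sets borel" by measurable
  then show ?thesis by (simp add: grid_cell_def)
qed

text \<open>The cell is squeezed between an open and a closed box of the same volume.\<close>

lemma grid_cell_measure:
  fixes x :: "'a::euclidean_space"
  assumes "h > 0"
  shows "grid_cell h x \<in> fmeasurable lborel" "measure lborel (grid_cell h x) = h ^ DIM('a)"
proof -
  define a where "a = (\<Sum>e\<in>Basis. (h * of_int \<lfloor>x \<bullet> e / h\<rfloor>) *\<^sub>R e :: 'a)"
  define b where "b = (\<Sum>e\<in>Basis. (h * (of_int \<lfloor>x \<bullet> e / h\<rfloor> + 1)) *\<^sub>R e :: 'a)"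
  have ab: "a \<bullet> e = h * of_int \<lfloor>x \<bullet> e / h\<rfloor>" "b \<bullet> e = h * (of_int \<lfloor>x \<bullet> e / h\<rfloor> + 1)" if "e \<in> Basis" for e
    using that by (simp_all add: a_def b_def)
  have cell: "y \<in> grid_cell h x \<longleftrightarrow> (\<forall>e\<in>Basis. a \<bullet> e \<le> y \<bullet> e \<and> y \<bullet> e < b \<bullet> e)" for y
    using assms by (auto simp: grid_cell_def ab floor_eq_iff field_simps)
  have le: "box a b \<subseteq> grid_cell h x" "grid_cell h x \<subseteq> cbox a b"
    by (auto simp: cell mem_box less_imp_le)
  have diff: "b \<bullet> e - a \<bullet> e = h" if "e \<in> Basis" for e using ab[OF that] by (simp add: algebra_simps)
  have lab: "a \<bullet> e \<le> b \<bullet> e" if "e \<in> Basis" for e using diff[OF that] assms by linarith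
  have ph: "(\<Prod>e\<in>Basis. (b - a) \<bullet> e) = h ^ DIM('a)" by (simp add: inner_diff_left diff)
  have "emeasure lborel (grid_cell h x) \<le> emeasure lborel (cbox a b)"
    by (rule emeasure_mono[OF le(2)]) simp
  also have "\<dots> = ennreal (h ^ DIM('a))"
    using emeasure_lborel_cbox[OF lab] ph by simp
  finally have 1: "emeasure lborel (grid_cell h x) \<le> ennreal (h ^ DIM('a))" .
  have "ennreal (h ^ DIM('a)) = emeasure lborel (box a b)"
    using emeasure_lborel_box[OF lab] ph by simp
  also have "\<dots> \<le> emeasure lborel (grid_cell h x)"
    by (rule emeasure_mono[OF le(1)]) (simp add: grid_cell_borel)
  finally have "emeasure lborel (grid_cell h x) = ennreal (h ^ DIM('a))" using 1 by simp
  then show "grid_cell h x \<in> fmeasurable lborel" "measure lborel (grid_cell h x) = h ^ DIM('a)"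
    using assms by (auto simp: fmeasurable_def grid_cell_borel measure_def)
qed

lemma finite_grid_cells:
  fixes S :: "'a::euclidean_space set"
  assumes "bounded S" "h > 0"
  shows "finite (grid_cell h ` S)"
proof -
  obtain R where R: "\<And>x. x \<in> S \<Longrightarrow> norm x \<le> R" using assms(1) by (auto simp: bounded_iff)
  let ?I = "{\<lfloor>-R / h\<rfloor>..\<lfloor>R / h\<rfloor>}"
  have "grid_cell h ` S \<subseteq> (\<lambda>c. {y. \<forall>e\<in>Basis. \<lfloor>y \<bullet> e / h\<rfloor> = c e}) ` (Basis \<rightarrow>\<^sub>E ?I)"
  proof
    fix Q assume "Q \<in> grid_cell h ` S"
    then obtain x where x: "x \<in> S" "Q = grid_cell h x" by auto
    define c where "c = restrict (\<lambda>e. \<lfloor>x \<bullet> e / h\<rfloor>) Basis"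
    have "c \<in> Basis \<rightarrow>\<^sub>E ?I"
    proof (rule PiE_I)
      fix e :: 'a assume e: "e \<in> Basis"
      have "\<bar>x \<bullet> e\<bar> \<le> R" using Basis_le_norm[OF e, of x] R[OF x(1)] by simp
      then have "- R \<le> x \<bullet> e" "x \<bullet> e \<le> R" by auto
      then have "- R / h \<le> x \<bullet> e / h" "x \<bullet> e / h \<le> R / h"
        using assms(2) by (auto intro!: divide_right_mono simp del: divide_minus_left)
      then show "c e \<in> ?I" using e by (auto simp: c_def intro!: floor_mono)
    qed (simp add: c_def)
    moreover have "Q = {y. \<forall>e\<in>Basis. \<lfloor>y \<bullet> e / h\<rfloor> = c e}" by (simp add: x grid_cell_def c_def)
    ultimately show "Q \<in> (\<lambda>c. {y. \<forall>e\<in>Basis. \<lfloor>y \<bullet> e / h\<rfloor> = c e}) ` (Basis \<rightarrow>\<^sub>E ?I)" by blast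
  qed
  then show ?thesis by (rule finite_subset) (intro finite_imageI finite_PiE finite_Basis, simp)
qed

lemma grid_cell_subset:
  fixes x y :: "'a::euclidean_space"
  assumes "h > 0" "y \<in> grid_cell h x"
  shows "y - x \<in> cbox (- h *\<^sub>R One) (h *\<^sub>R One)"
proof -
  have "\<bar>(y - x) \<bullet> e\<bar> \<le> h" if e: "e \<in> Basis" for e
  proof -
    have "\<lfloor>y \<bullet> e / h\<rfloor> = \<lfloor>x \<bullet> e / h\<rfloor>" using assms(2) e by (simp add: grid_cell_def)
    then have "\<bar>y \<bullet> e / h - x \<bullet> e / h\<bar> < 1" by linarith
    then have "\<bar>(y - x) \<bullet> e / h\<bar> < 1" by (simp add: inner_diff_left diff_divide_distrib)
    then show ?thesis using assms(1) by (simp add: abs_divide field_simps)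
  qed
  then show ?thesis by (auto simp: mem_box abs_le_iff minus_le_iff)
qed

section \<open>Rellich's theorem by cell averages\<close>

context bounded_open
begin

text \<open>On the cell of x, w(x) is the mean of w(x) - w(y) plus the mean of w. The second part is
  bounded by hypothesis; the first is handled by \<open>test_translation_estimate\<close> for the
  shifts z = y - x, which all lie in the cube of half-side h.\<close>

lemma cell_estimate:
  assumes w: "test_function \<Omega> w" and h: "h > 0" and c: "c \<ge> 0"
    and avg: "\<And>x. x \<in> \<Omega> \<Longrightarrow> \<bar>LINT y|lborel. indicator (grid_cell h x) y * w y\<bar> \<le> c * h ^ DIM('a)"
  shows "l2_inner \<Omega> w w \<le> 2 ^ Suc DIM('a) * real DIM('a) * h\<^sup>2 * l2_inner \<Omega> (gradient w) (gradient w)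
    + 2 * c\<^sup>2 * measure lebesgue \<Omega>"
proof -
  define V where "V = h ^ DIM('a)"
  define D where "D = (LINT x|lborel. (norm (gradient w x))\<^sup>2)"
  define C where "C = (cbox (- h *\<^sub>R One) (h *\<^sub>R One) :: 'a set)"
  have V: "V > 0" using h by (simp add: V_def)
  obtain K where K: "compact K" "K \<subseteq> \<Omega>" "\<And>x. x \<notin> K \<Longrightarrow> w x = 0" "\<And>x. x \<notin> K \<Longrightarrow> gradient w x = 0"
    using test_support[OF w] by metis
  note cont = test_continuous[OF w] and gcont = test_gradient_continuous[OF w]
  have [measurable]: "w \<in> borel_measurable borel" "gradient w \<in> borel_measurable borel"
    using cont gcont by (auto intro: borel_measurable_continuous_onI)
  have z: "w x = 0" "gradient w x = 0" if "x \<notin> \<Omega>" for x using K that by blast+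
  have "l2_inner \<Omega> (gradient w) (gradient w) = D"
    unfolding l2_inner_self_eq D_def using z by (intro lebesgue_on_integral_eq_lborel(1)[OF open_\<Omega>]) auto
  have wsq: "integrable lborel (\<lambda>x. (w x)\<^sup>2)"
    by (rule compact_support_integrable[OF K(1)]) (auto intro!: continuous_intros cont simp: K(3))
  have ww: "l2_inner \<Omega> w w = (LINT x|lborel. (w x)\<^sup>2)"
    unfolding l2_inner_self_eq real_norm_def power2_abs using z by (intro lebesgue_on_integral_eq_lborel(1)[OF open_\<Omega>]) auto
  obtain B where B: "B > 0" "\<And>x. \<bar>w x\<bar> \<le> B" using test_bounded[OF w] by metis
  \<comment> \<open>Enlarging the cell to x + C makes the set of shifts independent of x, which
    permits Fubini.\<close>
  define G where "G x = (\<integral>\<^sup>+z. indicator C z * ennreal ((w (x + z) - w x)\<^sup>2) \<partial>lborel)" for x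
  have G_meas [measurable]: "G \<in> borel_measurable lborel"
  proof -
    have "C \<in> sets borel" by (simp add: C_def)
    then have "(\<lambda>(x, z). indicator C z * ennreal ((w (x + z) - w x)\<^sup>2)) \<in> borel_measurable (lborel \<Otimes>\<^sub>M lborel)"
      by measurable
    from lborel.borel_measurable_nn_integral[OF this] show ?thesis unfolding G_def by simp
  qed
  have pt: "ennreal ((w x)\<^sup>2) \<le> ennreal (2 / V) * G x + ennreal (2 * c\<^sup>2) * indicator \<Omega> x" for x
  proof (cases "x \<in> \<Omega>")
    case False
    then show ?thesis using z by simp
  next
    case True
    let ?Q = "grid_cell h x"
    define f where "f y = w x - w y" for y
    have f_meas [measurable]: "f \<in> borel_measurable borel" unfolding f_def by measurable
    note Q = grid_cell_measure[OF h, of x]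
    have [measurable]: "?Q \<in> sets borel" by (rule grid_cell_borel)
    have iQ: "integrable lborel (\<lambda>y. indicator ?Q y :: real)"
      using Q(1) by (intro integrable_real_indicator) (auto simp: fmeasurable_def)
    have fB: "\<bar>f y\<bar> \<le> 2 * B" for y using B(2)[of x] B(2)[of y] by (simp add: f_def)
    have intb: "integrable lborel (\<lambda>y. indicator ?Q y * u y)"
      if "u \<in> borel_measurable borel" "\<And>y. \<bar>u y\<bar> \<le> L" for u :: "'a \<Rightarrow> real" and L
    proof (rule Bochner_Integration.integrable_bound)
      show "integrable lborel (\<lambda>y. L * indicator ?Q y)" using iQ by simp
      have "0 \<le> L" using that(2)[of undefined] by (rule order_trans[OF abs_ge_zero])
      then show "AE y in lborel. norm (indicator ?Q y * u y) \<le> norm (L * indicator ?Q y)"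
        using that(2) by (auto simp: indicator_def)
    qed (use that(1) in measurable)
    have int1: "integrable lborel (\<lambda>y. indicator ?Q y * f y)" by (rule intb[OF f_meas fB])
    have int2: "integrable lborel (\<lambda>y. indicator ?Q y * (f y)\<^sup>2)"
    proof (rule intb)
      show "\<bar>(f y)\<^sup>2\<bar> \<le> (2 * B)\<^sup>2" for y using power_mono[OF fB abs_ge_zero, of y 2] by simp
    qed measurable
    have int3: "integrable lborel (\<lambda>y. indicator ?Q y * w y)" by (rule intb[OF _ B(2)]) measurable
    define m where "m = (LINT y|lborel. indicator ?Q y * w y)"
    define F where "F = (LINT y|lborel. indicator ?Q y * f y)"
    have "F = (LINT y|lborel. w x * indicator ?Q y - indicator ?Q y * w y)"
      unfolding F_def f_def by (rule Bochner_Integration.integral_cong) (auto simp: algebra_simps)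
    also have "\<dots> = w x * V - m" using iQ int3 Q by (simp add: m_def V_def fmeasurable_def)
    finally have wx: "w x = F / V + m / V" using V by (simp add: field_simps)
    have "\<bar>m / V\<bar> \<le> c" using avg[OF True] V unfolding m_def[symmetric] V_def[symmetric] by (simp add: abs_divide field_simps)
    then have mV: "(m / V)\<^sup>2 \<le> c\<^sup>2" using c by (simp add: abs_le_square_iff[symmetric])
    have "F\<^sup>2 \<le> V * (LINT y|lborel. indicator ?Q y * (f y)\<^sup>2)"
      unfolding F_def V_def using square_integral_indicator_le[OF Q(1) _ int1 int2] Q(2) h by simp
    then have FV: "(F / V)\<^sup>2 \<le> (LINT y|lborel. indicator ?Q y * (f y)\<^sup>2) / V"
      using V by (simp add: power_divide power2_eq_square field_simps)
    have "(w x)\<^sup>2 \<le> 2 * (F / V)\<^sup>2 + 2 * (m / V)\<^sup>2"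
      using sum_squares_bound[of "F / V" "m / V"] unfolding wx by (simp add: power2_sum)
    also have "\<dots> \<le> 2 / V * (LINT y|lborel. indicator ?Q y * (f y)\<^sup>2) + 2 * c\<^sup>2"
      using FV mV by simp
    finally have "ennreal ((w x)\<^sup>2) \<le> ennreal (2 / V * (LINT y|lborel. indicator ?Q y * (f y)\<^sup>2) + 2 * c\<^sup>2)"
      by (rule ennreal_leI)
    also have "\<dots> = ennreal (2 / V) * ennreal (LINT y|lborel. indicator ?Q y * (f y)\<^sup>2) + ennreal (2 * c\<^sup>2)"
    proof -
      have I0: "0 \<le> (LINT y|lborel. indicator ?Q y * (f y)\<^sup>2)" by (rule Bochner_Integration.integral_nonneg) simp
      have "ennreal (2 / V * (LINT y|lborel. indicator ?Q y * (f y)\<^sup>2)) =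
          ennreal (2 / V) * ennreal (LINT y|lborel. indicator ?Q y * (f y)\<^sup>2)"
        by (rule ennreal_mult) (use V I0 in auto)
      moreover have "0 \<le> 2 / V * (LINT y|lborel. indicator ?Q y * (f y)\<^sup>2)"
        using V I0 by (intro mult_nonneg_nonneg) auto
      ultimately show ?thesis using ennreal_plus[of _ "2 * c\<^sup>2"] by simp
    qed
    also have "ennreal (LINT y|lborel. indicator ?Q y * (f y)\<^sup>2) = (\<integral>\<^sup>+y. ennreal (indicator ?Q y * (f y)\<^sup>2) \<partial>lborel)"
      using int2 by (intro nn_integral_eq_integral[symmetric]) auto
    also have "\<dots> \<le> (\<integral>\<^sup>+y. indicator C (y - x) * ennreal ((w y - w x)\<^sup>2) \<partial>lborel)"
    proof (rule nn_integral_mono)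
      fix y
      show "ennreal (indicator ?Q y * (f y)\<^sup>2) \<le> indicator C (y - x) * ennreal ((w y - w x)\<^sup>2)"
        using grid_cell_subset[OF h, of y x]
        by (cases "y \<in> ?Q") (simp_all add: C_def f_def power2_commute)
    qed
    also have "\<dots> = (\<integral>\<^sup>+z. indicator C ((z + x) - x) * ennreal ((w (z + x) - w x)\<^sup>2) \<partial>lborel)"
    proof -
      have [measurable]: "C \<in> sets borel" by (simp add: C_def)
      have "(\<lambda>y. indicator C (y - x) * ennreal ((w y - w x)\<^sup>2)) \<in> borel_measurable borel" by measurable
      from lborel_nn_integral_translation[OF this, of x, symmetric] show ?thesis .
    qed
    also have "\<dots> = G x" unfolding G_def by (simp add: add.commute)
    finally show ?thesis using True by (simp add: mult_left_mono add_right_mono)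
  qed
  have Gint: "(\<integral>\<^sup>+x. G x \<partial>lborel) \<le> ennreal (real DIM('a) * h\<^sup>2 * D * (2 * h) ^ DIM('a))"
  proof -
    have Cm [measurable]: "C \<in> sets borel" by (simp add: C_def)
    have D0: "D \<ge> 0" by (simp add: D_def)
    have "(\<integral>\<^sup>+x. G x \<partial>lborel) = (\<integral>\<^sup>+z. \<integral>\<^sup>+x. indicator C z * ennreal ((w (x + z) - w x)\<^sup>2) \<partial>lborel \<partial>lborel)"
      unfolding G_def by (rule lborel_pair.Fubini') measurable
    also have "\<dots> = (\<integral>\<^sup>+z. indicator C z * (\<integral>\<^sup>+x. ennreal ((w (x + z) - w x)\<^sup>2) \<partial>lborel) \<partial>lborel)"
      by (intro nn_integral_cong nn_integral_cmult) measurable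
    also have "\<dots> \<le> (\<integral>\<^sup>+z. indicator C z * ennreal (real DIM('a) * h\<^sup>2 * D) \<partial>lborel)"
    proof (rule nn_integral_mono)
      fix z :: 'a
      show "indicator C z * (\<integral>\<^sup>+x. ennreal ((w (x + z) - w x)\<^sup>2) \<partial>lborel) \<le> indicator C z * ennreal (real DIM('a) * h\<^sup>2 * D)"
      proof (cases "z \<in> C")
        case True
        have "(z \<bullet> e)\<^sup>2 \<le> h\<^sup>2" if "e \<in> Basis" for e
          using True that h by (auto simp: C_def mem_box abs_le_square_iff[symmetric] abs_le_iff minus_le_iff)
        then have "(\<Sum>e\<in>Basis. (z \<bullet> e)\<^sup>2) \<le> (\<Sum>e\<in>(Basis::'a set). h\<^sup>2)" by (rule sum_mono)
        then have "(norm z)\<^sup>2 \<le> real DIM('a) * h\<^sup>2"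
          by (simp add: euclidean_inner[of z z] power2_norm_eq_inner flip: power2_eq_square)
        then have "(norm z)\<^sup>2 * D \<le> real DIM('a) * h\<^sup>2 * D" using D0 by (rule mult_right_mono)
        then have "(\<integral>\<^sup>+x. ennreal ((w (x + z) - w x)\<^sup>2) \<partial>lborel) \<le> ennreal (real DIM('a) * h\<^sup>2 * D)"
          using test_translation_estimate[OF w, of z] unfolding D_def by (meson ennreal_leI order_trans)
        then show ?thesis by (rule mult_left_mono) simp
      qed simp
    qed
    also have "\<dots> = emeasure lborel C * ennreal (real DIM('a) * h\<^sup>2 * D)"
      by (subst nn_integral_multc) auto
    also have "emeasure lborel C = ennreal ((2 * h) ^ DIM('a))"
    proof -
      have "(\<Prod>e\<in>(Basis :: 'a set). (h *\<^sub>R One - (- h *\<^sub>R One)) \<bullet> e) = (\<Prod>e\<in>(Basis :: 'a set). 2 * h)"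
        by (rule prod.cong) (simp_all add: inner_diff_left inner_add_left)
      then show ?thesis
        unfolding C_def using h emeasure_lborel_cbox[of "- h *\<^sub>R One" "h *\<^sub>R One :: 'a"] by simp
    qed
    finally show ?thesis using D0 h by (simp add: ennreal_mult[symmetric] mult.commute)
  qed
  have em: "emeasure lborel \<Omega> = ennreal (measure lebesgue \<Omega>)"
  proof -
    have "emeasure lebesgue \<Omega> = emeasure lborel \<Omega>" using open_\<Omega> by (simp add: emeasure_completion)
    then show ?thesis using emeasure_eq_measure2[OF lmeasurable_\<Omega>] by simp
  qed
  have "ennreal (l2_inner \<Omega> w w) = (\<integral>\<^sup>+x. ennreal ((w x)\<^sup>2) \<partial>lborel)"
    unfolding ww using wsq by (intro nn_integral_eq_integral[symmetric]) auto
  also have "\<dots> \<le> (\<integral>\<^sup>+x. ennreal (2 / V) * G x + ennreal (2 * c\<^sup>2) * indicator \<Omega> x \<partial>lborel)"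
    by (rule nn_integral_mono) (rule pt)
  also have "\<dots> = ennreal (2 / V) * (\<integral>\<^sup>+x. G x \<partial>lborel) + ennreal (2 * c\<^sup>2) * emeasure lborel \<Omega>"
    using open_\<Omega> by (subst nn_integral_add) (auto simp: nn_integral_cmult nn_integral_cmult_indicator)
  also have "\<dots> \<le> ennreal (2 / V) * ennreal (real DIM('a) * h\<^sup>2 * D * (2 * h) ^ DIM('a)) + ennreal (2 * c\<^sup>2) * emeasure lborel \<Omega>"
    by (intro add_right_mono mult_left_mono Gint) auto
  also have "\<dots> = ennreal (2 / V * (real DIM('a) * h\<^sup>2 * D * (2 * h) ^ DIM('a)) + 2 * c\<^sup>2 * measure lebesgue \<Omega>)"
    unfolding em using V h by (simp add: ennreal_mult[symmetric] D_def)
  finally have "l2_inner \<Omega> w w \<le> 2 / V * (real DIM('a) * h\<^sup>2 * D * (2 * h) ^ DIM('a)) + 2 * c\<^sup>2 * measure lebesgue \<Omega>"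
    using V h by (subst (asm) ennreal_le_iff) (auto simp: D_def)
  \<comment> \<open>One factor 2 comes from (\<alpha> + \<beta>)^2 \<le> 2 \<alpha>^2 + 2 \<beta>^2,
    N h^2 bounds |z|^2 on C, and 2^N is the ratio of the volumes of C and of a cell.\<close>
  also have "2 / V * (real DIM('a) * h\<^sup>2 * D * (2 * h) ^ DIM('a)) = 2 ^ Suc DIM('a) * real DIM('a) * h\<^sup>2 * D"
    using V by (simp add: V_def power_mult_distrib)
  finally show ?thesis unfolding \<open>l2_inner \<Omega> (gradient w) (gradient w) = D\<close> .
qed

end

text \<open>Bolzano-Weierstrass refines the subsequence at stage i. Convergence of row i depends
  only on a tail, and from stage i on the diagonal is a subsequence of that refinement.\<close>

lemma diagonal_convergent_subsequence:
  fixes a :: "nat \<Rightarrow> nat \<Rightarrow> real"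
  assumes "\<And>i n. \<bar>a i n\<bar> \<le> C"
  obtains r :: "nat \<Rightarrow> nat" where "strict_mono r" "\<And>i. convergent (\<lambda>n. a i (r n))"
proof -
  interpret subseqs "\<lambda>i s. convergent (\<lambda>n. a i (s n))"
  proof
    fix i and s :: "nat \<Rightarrow> nat" assume "strict_mono s"
    have "bounded (range (\<lambda>n. a i (s n)))" using assms by (auto simp: bounded_iff)
    from bounded_imp_convergent_subsequence[OF this]
    obtain l r where "strict_mono r" "((\<lambda>n. a i (s n)) \<circ> r) \<longlonglongrightarrow> l" by blast
    then show "\<exists>r'. strict_mono r' \<and> convergent (\<lambda>n. a i ((s \<circ> r') n))"
      by (auto simp: convergent_def o_def)
  qed
  have "convergent (\<lambda>n. a i (diagseq n))" for i
  proof -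
    have "convergent (\<lambda>n. a i ((diagseq \<circ> (+) (Suc i)) n))"
    proof (rule diagseq_holds)
      fix n and s r :: "nat \<Rightarrow> nat" assume "convergent (\<lambda>k. a n (s k))" "strict_mono r"
      then show "convergent (\<lambda>k. a n ((s \<circ> r) k))"
        using convergent_subseq_convergent[of "\<lambda>k. a n (s k)" r] by (simp add: o_def)
    qed
    then have "convergent (\<lambda>n. a i (diagseq (n + Suc i)))" by (simp add: add.commute)
    then show ?thesis by (subst (asm) convergent_ignore_initial_segment)
  qed
  with subseq_diagseq show ?thesis by (rule that)
qed

context bounded_open
begin

text \<open>For each mesh size there are finitely many cells meeting \<Omega>, over all meshes 1/(k
  + 1) countably many, and the averages on them are bounded. A diagonal subsequence makes all
  averages Cauchy, and \<open>cell_estimate\<close> turns this into L2 smallness of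
  differences.\<close>

lemma test_rellich:
  assumes \<phi>: "\<And>n::nat. test_function \<Omega> (\<phi> n)"
    and K: "\<And>n. l2_norm \<Omega> (\<phi> n) \<le> K" "\<And>n. l2_norm \<Omega> (gradient (\<phi> n)) \<le> K"
  obtains r :: "nat \<Rightarrow> nat" where "strict_mono r"
    "\<And>\<epsilon>. \<epsilon> > 0 \<Longrightarrow> \<exists>N. \<forall>m\<ge>N. \<forall>n\<ge>N. l2_norm \<Omega> (\<lambda>x. \<phi> (r m) x - \<phi> (r n) x) < \<epsilon>"
proof -
  have K0: "K \<ge> 0" using K(1)[of 0] l2_norm_nonneg order_trans by blast
  define h where "h k = inverse (real (Suc k))" for k
  have h: "h k > 0" for k by (simp add: h_def)
  \<comment> \<open>The empty set keeps S nonempty, as \<open>from_nat_into\<close> requires, when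
    \<Omega> is empty.\<close>
  define S where "S = (\<Union>k. grid_cell (h k) ` \<Omega>) \<union> {{}}"
  have "countable (\<Union>k. grid_cell (h k) ` \<Omega>)"
  proof (rule countable_UN)
    show "countable (grid_cell (h k) ` \<Omega>)" for k by (rule countable_finite[OF finite_grid_cells[OF bounded_\<Omega> h]])
  qed simp
  then have S: "countable S" "S \<noteq> {}" by (auto simp: S_def)
  have Sb: "Q \<in> sets borel" if "Q \<in> S" for Q using that grid_cell_borel by (auto simp: S_def)
  define J where "J Q n = (LINT y|lborel. indicator Q y * \<phi> n y)" for Q n
  have Jb: "\<bar>J Q n\<bar> \<le> sqrt (measure lebesgue \<Omega>) * K" if "Q \<in> sets borel" for Q n
  proof -
    obtain L where L: "compact L" "L \<subseteq> \<Omega>" "\<And>x. x \<notin> L \<Longrightarrow> \<phi> n x = 0" using test_support[OF \<phi>[of n]] by metis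
    have m: "\<phi> n \<in> borel_measurable borel" using test_continuous[OF \<phi>] by (rule borel_measurable_continuous_onI)
    have int: "integrable lborel (\<lambda>y. \<bar>\<phi> n y\<bar>)"
      by (rule compact_support_integrable[OF L(1)]) (auto intro!: continuous_intros test_continuous[OF \<phi>] simp: L(3))
    have "\<bar>J Q n\<bar> \<le> (LINT y|lborel. \<bar>indicator Q y * \<phi> n y\<bar>)" unfolding J_def by (rule integral_abs_bound)
    also have "\<dots> \<le> (LINT y|lborel. \<bar>\<phi> n y\<bar>)"
      by (rule integral_mono'[OF int]) (auto simp: indicator_def)
    also have "\<dots> = (LINT y|lebesgue_on \<Omega>. norm (\<phi> n y))"
      using L m by (simp, intro lebesgue_on_integral_eq_lborel(1)[OF open_\<Omega>, symmetric]) auto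
    also have "\<dots> \<le> sqrt (measure lebesgue \<Omega>) * l2_norm \<Omega> (\<phi> n)"
      by (rule L2_imp_integrable(2)[OF lmeasurable_\<Omega> test_L2(1)[OF open_\<Omega> \<phi>]])
    also have "\<dots> \<le> sqrt (measure lebesgue \<Omega>) * K" by (rule mult_left_mono[OF K(1)]) simp
    finally show ?thesis .
  qed
  obtain r :: "nat \<Rightarrow> nat" where r: "strict_mono r" "\<And>i. convergent (\<lambda>n. J (from_nat_into S i) (r n))"
    by (rule diagonal_convergent_subsequence[of "\<lambda>i. J (from_nat_into S i)" "sqrt (measure lebesgue \<Omega>) * K"])
      (use Jb[OF Sb[OF from_nat_into[OF S(2)]]] in auto)
  have Jconv: "Cauchy (\<lambda>n. J Q (r n))" if "Q \<in> S" for Q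
    using from_nat_into_surj[OF S(1) that] r(2) convergent_Cauchy by metis
  have "\<exists>N. \<forall>m\<ge>N. \<forall>n\<ge>N. l2_norm \<Omega> (\<lambda>x. \<phi> (r m) x - \<phi> (r n) x) < \<epsilon>" if \<epsilon>: "\<epsilon> > 0" for \<epsilon>
  proof -
    \<comment> \<open>The difference of two terms has gradient norm at most 2 K; A is the resulting
      coefficient of h^2 in \<open>cell_estimate\<close>.\<close>
    define A where "A = 2 ^ Suc DIM('a) * real DIM('a) * (2 * K)\<^sup>2"
    define B where "B = 2 * measure lebesgue \<Omega>"
    have AB: "A \<ge> 0" "B \<ge> 0" by (auto simp: A_def B_def)
    have "(\<lambda>k. A * (h k)\<^sup>2) \<longlonglongrightarrow> A * 0\<^sup>2"
      unfolding h_def by (intro tendsto_intros LIMSEQ_inverse_real_of_nat)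
    then have "(\<lambda>k. A * (h k)\<^sup>2) \<longlonglongrightarrow> 0" by simp
    moreover have "\<epsilon>\<^sup>2 / 2 > 0" using \<epsilon> by simp
    ultimately obtain k where "norm (A * (h k)\<^sup>2 - 0) < \<epsilon>\<^sup>2 / 2" using LIMSEQ_D by blast
    then have k: "A * (h k)\<^sup>2 < \<epsilon>\<^sup>2 / 2" by simp
    \<comment> \<open>With this tolerance the averages contribute at most \<epsilon>^2 / 4; B + 1 in
      place of B covers the case of measure 0.\<close>
    define c where "c = \<epsilon> / (2 * sqrt (B + 1))"
    have c: "c > 0" using \<epsilon> AB by (simp add: c_def)
    have "2 * c\<^sup>2 * measure lebesgue \<Omega> = \<epsilon>\<^sup>2 / 4 * (B / (B + 1))"
    proof -
      have "c\<^sup>2 = \<epsilon>\<^sup>2 / (4 * (B + 1))" using AB by (simp add: c_def power_divide power_mult_distrib)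
      moreover have "2 * c\<^sup>2 * measure lebesgue \<Omega> = c\<^sup>2 * B" by (simp add: B_def)
      ultimately show ?thesis by simp
    qed
    also have "\<dots> \<le> \<epsilon>\<^sup>2 / 4 * 1" using AB by (intro mult_left_mono) auto
    also have "\<dots> < \<epsilon>\<^sup>2 / 2" using \<epsilon> by simp
    finally have cB: "2 * c\<^sup>2 * measure lebesgue \<Omega> < \<epsilon>\<^sup>2 / 2" .
    have "\<forall>Q\<in>grid_cell (h k) ` \<Omega>. \<exists>N. \<forall>m\<ge>N. \<forall>n\<ge>N. \<bar>J Q (r m) - J Q (r n)\<bar> < c * h k ^ DIM('a)"
    proof
      fix Q assume "Q \<in> grid_cell (h k) ` \<Omega>"
      then have "Q \<in> S" by (auto simp: S_def)
      moreover have "c * h k ^ DIM('a) > 0" using c h by simp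
      ultimately show "\<exists>N. \<forall>m\<ge>N. \<forall>n\<ge>N. \<bar>J Q (r m) - J Q (r n)\<bar> < c * h k ^ DIM('a)"
        using CauchyD[OF Jconv] by fastforce
    qed
    then obtain NQ where NQ: "\<And>Q m n. Q \<in> grid_cell (h k) ` \<Omega> \<Longrightarrow> m \<ge> NQ Q \<Longrightarrow> n \<ge> NQ Q \<Longrightarrow>
        \<bar>J Q (r m) - J Q (r n)\<bar> < c * h k ^ DIM('a)" by metis
    define N where "N = Max (insert 0 (NQ ` grid_cell (h k) ` \<Omega>))"
    have N: "NQ Q \<le> N" if "Q \<in> grid_cell (h k) ` \<Omega>" for Q
      unfolding N_def using finite_grid_cells[OF bounded_\<Omega> h] that by (intro Max_ge) auto
    show ?thesis
    proof (intro exI allI impI)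
      fix m n assume mn: "m \<ge> N" "n \<ge> N"
      define w where "w x = \<phi> (r m) x - \<phi> (r n) x" for x
      have w: "test_function \<Omega> w"
        using test_add[OF \<phi>[of "r m"] test_scale[OF \<phi>[of "r n"], of "-1"]] by (simp add: w_def[abs_def])
      have gw: "gradient w = (\<lambda>x. gradient (\<phi> (r m)) x - gradient (\<phi> (r n)) x)"
        using gradient_add[OF \<phi>[of "r m"] test_scale[OF \<phi>[of "r n"], of "-1"]] gradient_scale[OF \<phi>[of "r n"], of "-1"]
        by (simp add: w_def[abs_def] fun_eq_iff)
      have "l2_norm \<Omega> (gradient w) \<le> l2_norm \<Omega> (gradient (\<phi> (r m))) + l2_norm \<Omega> (\<lambda>x. - 1 *\<^sub>R gradient (\<phi> (r n)) x)"
        unfolding gw using l2_norm_triangle[OF test_L2(2)[OF open_\<Omega> \<phi>[of "r m"]] L2_scale[OF test_L2(2)[OF open_\<Omega> \<phi>[of "r n"]], of "-1"]]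
        by simp
      also have "\<dots> \<le> 2 * K" unfolding l2_norm_scale using K(2)[of "r m"] K(2)[of "r n"] by simp
      finally have "(l2_norm \<Omega> (gradient w))\<^sup>2 \<le> (2 * K)\<^sup>2" by (intro power_mono) auto
      then have gwK: "l2_inner \<Omega> (gradient w) (gradient w) \<le> (2 * K)\<^sup>2" by (simp add: l2_norm_square)
      have "\<bar>LINT y|lborel. indicator (grid_cell (h k) x) y * w y\<bar> \<le> c * h k ^ DIM('a)" if x: "x \<in> \<Omega>" for x
      proof -
        let ?Q = "grid_cell (h k) x"
        have Q: "?Q \<in> grid_cell (h k) ` \<Omega>" using x by simp
        have int: "integrable lborel (\<lambda>y. indicator ?Q y * \<phi> i y)" for i
        proof -
          have "integrable lborel (\<phi> i)"
            by (rule compact_support_integrable[OF test_compact_support[OF \<phi>] test_continuous[OF \<phi>] test_zero_outside[OF \<phi>]])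
          from integrable_mult_indicator[OF _ this, of ?Q] show ?thesis by (simp add: grid_cell_borel)
        qed
        have "(LINT y|lborel. indicator ?Q y * w y) = J ?Q (r m) - J ?Q (r n)"
          unfolding J_def w_def using int by (simp add: right_diff_distrib)
        then show ?thesis using NQ[OF Q order_trans[OF N[OF Q] mn(1)] order_trans[OF N[OF Q] mn(2)]] by simp
      qed
      from cell_estimate[OF w h less_imp_le[OF c] this]
      have "l2_inner \<Omega> w w \<le> 2 ^ Suc DIM('a) * real DIM('a) * (h k)\<^sup>2 * l2_inner \<Omega> (gradient w) (gradient w) +
          2 * c\<^sup>2 * measure lebesgue \<Omega>" .
      also have "2 ^ Suc DIM('a) * real DIM('a) * (h k)\<^sup>2 * l2_inner \<Omega> (gradient w) (gradient w) \<le>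
          2 ^ Suc DIM('a) * real DIM('a) * (h k)\<^sup>2 * (2 * K)\<^sup>2"
        by (intro mult_left_mono gwK) auto
      also have "\<dots> = A * (h k)\<^sup>2" by (simp add: A_def)
      finally have "(l2_norm \<Omega> w)\<^sup>2 < \<epsilon>\<^sup>2" using k cB by (simp add: l2_norm_square)
      then show "l2_norm \<Omega> (\<lambda>x. \<phi> (r m) x - \<phi> (r n) x) < \<epsilon>"
        using \<epsilon> unfolding w_def[abs_def] by (simp add: power_less_imp_less_base)
    qed
  qed
  with r(1) show ?thesis by (rule that)
qed

text \<open>Each \<open>U n\<close> is replaced by a test function within 1/(n + 1) in the jet norm;
  this error vanishes in the limit.\<close>

theorem rellich:
  assumes U: "\<And>n::nat. U n \<in> jet_space \<Omega>" and K: "\<And>n. l2_norm \<Omega> (U n) \<le> K"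
  obtains r :: "nat \<Rightarrow> nat" and u where "strict_mono r" "u \<in> L2_space \<Omega>"
    "(\<lambda>n. l2_norm \<Omega> (\<lambda>x. fst (U (r n) x) - u x)) \<longlonglongrightarrow> 0"
proof -
  have "\<forall>n. \<exists>\<phi>. test_function \<Omega> \<phi> \<and> l2_norm \<Omega> (\<lambda>x. jet \<phi> x - U n x) < inverse (real (Suc n))"
    using U unfolding jet_space_def by (auto simp del: of_nat_Suc)
  then obtain \<phi> where \<phi>: "\<And>n. test_function \<Omega> (\<phi> n)" and
    near: "\<And>n. l2_norm \<Omega> (\<lambda>x. jet (\<phi> n) x - U n x) < inverse (real (Suc n))" by metis
  have fstU: "(\<lambda>x. fst (U n x)) \<in> L2_space \<Omega>" for n by (rule L2_fst_snd(1)[OF jet_space_L2[OF U]])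
  have jetK: "l2_norm \<Omega> (jet (\<phi> n)) \<le> K + 1" for n
  proof -
    have "inverse (real (Suc n)) \<le> 1" by (simp add: field_simps)
    then show ?thesis
      using l2_norm_le_add_diff[OF jet_L2[OF \<phi>[of n]] jet_space_L2[OF U[of n]]] K[of n] near[of n] by linarith
  qed
  have K1: "l2_norm \<Omega> (\<phi> n) \<le> K + 1" "l2_norm \<Omega> (gradient (\<phi> n)) \<le> K + 1" for n
    using l2_norm_fst_snd_le(2,3)[OF jet_L2[OF \<phi>[of n]]] jetK[of n] by (simp_all add: jet_def)
  obtain r :: "nat \<Rightarrow> nat" where r: "strict_mono r"
    "\<And>\<epsilon>. \<epsilon> > 0 \<Longrightarrow> \<exists>N. \<forall>m\<ge>N. \<forall>n\<ge>N. l2_norm \<Omega> (\<lambda>x. \<phi> (r m) x - \<phi> (r n) x) < \<epsilon>"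
    using test_rellich[of \<phi> "K + 1", OF \<phi> K1] by blast
  have \<phi>L2: "\<phi> n \<in> L2_space \<Omega>" for n by (rule test_L2(1)[OF open_\<Omega> \<phi>])
  obtain u where u: "u \<in> L2_space \<Omega>" "(\<lambda>n. l2_norm \<Omega> (\<lambda>x. \<phi> (r n) x - u x)) \<longlonglongrightarrow> 0"
    using L2_complete[OF lmeasurable_\<Omega>, of "\<lambda>n. \<phi> (r n)", OF \<phi>L2 r(2)] by blast
  have "(\<lambda>n. l2_norm \<Omega> (\<lambda>x. fst (U (r n) x) - u x)) \<longlonglongrightarrow> 0"
  proof (rule Lim_null_comparison)
    have "(\<lambda>n. inverse (real (Suc (r n)))) \<longlonglongrightarrow> 0"
      using LIMSEQ_subseq_LIMSEQ[OF LIMSEQ_inverse_real_of_nat r(1)] by (simp add: o_def)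
    from tendsto_add[OF this u(2)]
    show "(\<lambda>n. inverse (real (Suc (r n))) + l2_norm \<Omega> (\<lambda>x. \<phi> (r n) x - u x)) \<longlonglongrightarrow> 0" by simp
    show "\<forall>\<^sub>F n in sequentially. norm (l2_norm \<Omega> (\<lambda>x. fst (U (r n) x) - u x)) \<le>
        inverse (real (Suc (r n))) + l2_norm \<Omega> (\<lambda>x. \<phi> (r n) x - u x)"
    proof (intro always_eventually allI)
      fix n
      have "l2_norm \<Omega> (\<lambda>x. \<phi> (r n) x - fst (U (r n) x)) \<le> inverse (real (Suc (r n)))"
        using l2_norm_fst_snd_le(2)[OF L2_diff[OF jet_L2[OF \<phi>[of "r n"]] jet_space_L2[OF U[of "r n"]]]] near[of "r n"]
        by (simp add: jet_def)
      then show "norm (l2_norm \<Omega> (\<lambda>x. fst (U (r n) x) - u x)) \<le>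
        inverse (real (Suc (r n))) + l2_norm \<Omega> (\<lambda>x. \<phi> (r n) x - u x)"
        using l2_norm_diff_triangle[OF fstU[of "r n"] \<phi>L2[of "r n"] u(1)]
          l2_norm_minus_commute[of \<Omega> "\<lambda>x. fst (U (r n) x)" "\<phi> (r n)"] by simp
    qed
  qed
  with r(1) u(1) show ?thesis by (rule that)
qed

end

section \<open>The first eigenvalue and weak limits\<close>

text \<open>The Dirichlet form on jets, with the gradient read off the second component instead of
  chosen by \<open>weak_gradient\<close>.\<close>

definition grad_inner :: "'a::euclidean_space set \<Rightarrow> ('a \<Rightarrow> real \<times> 'a) \<Rightarrow> ('a \<Rightarrow> real \<times> 'a) \<Rightarrow> real" where
  "grad_inner \<Omega> U V = l2_inner \<Omega> (\<lambda>x. snd (U x)) (\<lambda>x. snd (V x))"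

definition val_inner :: "'a::euclidean_space set \<Rightarrow> ('a \<Rightarrow> real \<times> 'a) \<Rightarrow> ('a \<Rightarrow> real \<times> 'a) \<Rightarrow> real" where
  "val_inner \<Omega> U V = l2_inner \<Omega> (\<lambda>x. fst (U x)) (\<lambda>x. fst (V x))"

lemma grad_inner_nonneg [simp]: "0 \<le> grad_inner \<Omega> U U"
  by (simp add: grad_inner_def)

lemma val_inner_nonneg [simp]: "0 \<le> val_inner \<Omega> U U"
  by (simp add: val_inner_def)

lemma grad_inner_scale: "grad_inner \<Omega> (\<lambda>x. c *\<^sub>R U x) (\<lambda>x. c *\<^sub>R U x) = c\<^sup>2 * grad_inner \<Omega> U U"
  by (simp add: grad_inner_def l2_inner_self_scale)

lemma val_inner_scale: "val_inner \<Omega> (\<lambda>x. c *\<^sub>R U x) (\<lambda>x. c *\<^sub>R U x) = c\<^sup>2 * val_inner \<Omega> U U"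
  using l2_inner_self_scale[of \<Omega> c "\<lambda>x. fst (U x)"] by (simp add: val_inner_def)

lemma l2_inner_jets: "U \<in> L2_space \<Omega> \<Longrightarrow> l2_inner \<Omega> U U = val_inner \<Omega> U U + grad_inner \<Omega> U U"
  by (simp add: l2_norm_fst_snd_le(1) val_inner_def grad_inner_def)

lemma
  assumes "U \<in> L2_space \<Omega>" "V \<in> L2_space \<Omega>"
  shows grad_inner_add: "grad_inner \<Omega> (\<lambda>x. U x + c *\<^sub>R V x) (\<lambda>x. U x + c *\<^sub>R V x) =
      grad_inner \<Omega> U U + 2 * c * grad_inner \<Omega> U V + c\<^sup>2 * grad_inner \<Omega> V V"
    and val_inner_add: "val_inner \<Omega> (\<lambda>x. U x + c *\<^sub>R V x) (\<lambda>x. U x + c *\<^sub>R V x) =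
      val_inner \<Omega> U U + 2 * c * val_inner \<Omega> U V + c\<^sup>2 * val_inner \<Omega> V V"
  using l2_inner_self_add[OF L2_fst_snd(2)[OF assms(1)] L2_scale[OF L2_fst_snd(2)[OF assms(2)], of c]]
    l2_inner_self_add[OF L2_fst_snd(1)[OF assms(1)] L2_scale[OF L2_fst_snd(1)[OF assms(2)], of c]]
  by (simp_all only: grad_inner_def val_inner_def snd_add snd_scaleR fst_add fst_scaleR l2_inner_self_scale
      l2_inner_scale_right mult.assoc)

lemma
  assumes "U \<in> L2_space \<Omega>" "V \<in> L2_space \<Omega>"
  shows grad_inner_parallelogram: "grad_inner \<Omega> (\<lambda>x. U x - V x) (\<lambda>x. U x - V x) =
      2 * grad_inner \<Omega> U U + 2 * grad_inner \<Omega> V V - grad_inner \<Omega> (\<lambda>x. U x + V x) (\<lambda>x. U x + V x)"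
    and val_inner_parallelogram: "val_inner \<Omega> (\<lambda>x. U x - V x) (\<lambda>x. U x - V x) =
      2 * val_inner \<Omega> U U + 2 * val_inner \<Omega> V V - val_inner \<Omega> (\<lambda>x. U x + V x) (\<lambda>x. U x + V x)"
  using grad_inner_add[OF assms, of 1] grad_inner_add[OF assms, of "-1"]
    val_inner_add[OF assms, of 1] val_inner_add[OF assms, of "-1"] by simp_all

text \<open>At t = -\<alpha>/k with k > \<beta> the linear term dominates and makes the expression
  negative unless \<alpha> = 0. Gives the first-order condition at the minimum of a
  quadratic.\<close>

lemma linear_term_zero:
  fixes \<alpha> \<beta> :: real
  assumes "\<And>t. 0 \<le> 2 * t * \<alpha> + t\<^sup>2 * \<beta>"
  shows "\<alpha> = 0"
proof (rule ccontr)
  assume "\<alpha> \<noteq> 0"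
  define k where "k = \<bar>\<beta>\<bar> + 1"
  define t where "t = - \<alpha> / k"
  have k: "k > 0" "\<beta> \<le> k" by (auto simp: k_def)
  then have "2 * t * \<alpha> + t\<^sup>2 * \<beta> = \<alpha>\<^sup>2 / k * (\<beta> / k - 2)"
    by (simp add: t_def power2_eq_square field_simps)
  also have "\<dots> < 0"
  proof (rule mult_pos_neg)
    show "\<alpha>\<^sup>2 / k > 0" using \<open>\<alpha> \<noteq> 0\<close> k by simp
    have "\<beta> / k \<le> 1" using k by simp
    then show "\<beta> / k - 2 < 0" by simp
  qed
  finally show False using assms[of t] by simp
qed

context bounded_open
begin

lemma jet_space_snd_tendsto:
  assumes U: "\<And>n. U n \<in> jet_space \<Omega>" and V: "V \<in> jet_space \<Omega>"
    and lim: "(\<lambda>n. l2_norm \<Omega> (\<lambda>x. U n x - V x)) \<longlonglongrightarrow> 0"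
  shows "(\<lambda>n. grad_inner \<Omega> (U n) (U n)) \<longlonglongrightarrow> grad_inner \<Omega> V V"
    "(\<lambda>n. val_inner \<Omega> (U n) (U n)) \<longlonglongrightarrow> val_inner \<Omega> V V"
    "(\<lambda>n. l2_norm \<Omega> (\<lambda>x. fst (U n x) - fst (V x))) \<longlonglongrightarrow> 0"
proof -
  note L2 = jet_space_L2[OF U] jet_space_L2[OF V]
  have le: "l2_norm \<Omega> (\<lambda>x. fst (U n x) - fst (V x)) \<le> l2_norm \<Omega> (\<lambda>x. U n x - V x)"
    "l2_norm \<Omega> (\<lambda>x. snd (U n x) - snd (V x)) \<le> l2_norm \<Omega> (\<lambda>x. U n x - V x)" for n
    using l2_norm_fst_snd_le(2,3)[OF L2_diff[OF L2(1)[of n] L2(2)]] by simp_all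
  show 1: "(\<lambda>n. l2_norm \<Omega> (\<lambda>x. fst (U n x) - fst (V x))) \<longlonglongrightarrow> 0"
    by (rule Lim_null_comparison[OF _ lim]) (use le in simp)
  have 2: "(\<lambda>n. l2_norm \<Omega> (\<lambda>x. snd (U n x) - snd (V x))) \<longlonglongrightarrow> 0"
    by (rule Lim_null_comparison[OF _ lim]) (use le in simp)
  have "(\<lambda>n. (l2_norm \<Omega> (\<lambda>x. fst (U n x)))\<^sup>2) \<longlonglongrightarrow> (l2_norm \<Omega> (\<lambda>x. fst (V x)))\<^sup>2"
    by (intro tendsto_power l2_norm_tendsto[OF L2_fst_snd(1)[OF L2(1)] L2_fst_snd(1)[OF L2(2)] 1])
  then show "(\<lambda>n. val_inner \<Omega> (U n) (U n)) \<longlonglongrightarrow> val_inner \<Omega> V V"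
    by (simp add: val_inner_def l2_norm_square)
  have "(\<lambda>n. (l2_norm \<Omega> (\<lambda>x. snd (U n x)))\<^sup>2) \<longlonglongrightarrow> (l2_norm \<Omega> (\<lambda>x. snd (V x)))\<^sup>2"
    by (intro tendsto_power l2_norm_tendsto[OF L2_fst_snd(2)[OF L2(1)] L2_fst_snd(2)[OF L2(2)] 2])
  then show "(\<lambda>n. grad_inner \<Omega> (U n) (U n)) \<longlonglongrightarrow> grad_inner \<Omega> V V"
    by (simp add: grad_inner_def l2_norm_square)
qed

text \<open>Phrased with \<open>val_inner\<close> and \<open>grad_inner\<close> because the
  parallelogram arguments deliver Cauchy estimates of this form.\<close>

lemma jet_space_complete:
  assumes U: "\<And>n::nat. U n \<in> jet_space \<Omega>"
    and Cauchy: "\<And>\<epsilon>. \<epsilon> > 0 \<Longrightarrow> \<exists>N. \<forall>m\<ge>N. \<forall>n\<ge>N. val_inner \<Omega> (\<lambda>x. U m x - U n x) (\<lambda>x. U m x - U n x)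
        + grad_inner \<Omega> (\<lambda>x. U m x - U n x) (\<lambda>x. U m x - U n x) < \<epsilon>"
  obtains V where "V \<in> jet_space \<Omega>" "(\<lambda>n. l2_norm \<Omega> (\<lambda>x. U n x - V x)) \<longlonglongrightarrow> 0"
proof -
  have "\<exists>N. \<forall>m\<ge>N. \<forall>n\<ge>N. l2_norm \<Omega> (\<lambda>x. U m x - U n x) < e" if "e > 0" for e
  proof -
    have "e\<^sup>2 > 0" using that by simp
    from Cauchy[OF this] obtain N where N: "\<And>m n. m \<ge> N \<Longrightarrow> n \<ge> N \<Longrightarrow> val_inner \<Omega> (\<lambda>x. U m x - U n x) (\<lambda>x. U m x - U n x)
        + grad_inner \<Omega> (\<lambda>x. U m x - U n x) (\<lambda>x. U m x - U n x) < e\<^sup>2" by blast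
    have "l2_norm \<Omega> (\<lambda>x. U m x - U n x) < e" if "m \<ge> N" "n \<ge> N" for m n
    proof -
      have "(l2_norm \<Omega> (\<lambda>x. U m x - U n x))\<^sup>2 < e\<^sup>2"
        using N[OF that] unfolding l2_norm_square l2_inner_jets[OF L2_diff[OF jet_space_L2[OF U[of m]] jet_space_L2[OF U[of n]]]] .
      then show ?thesis by (rule power_less_imp_less_base) (use \<open>e > 0\<close> in simp)
    qed
    then show ?thesis by blast
  qed
  from L2_complete[OF lmeasurable_\<Omega> jet_space_L2[OF U] this]
  obtain V where V: "V \<in> L2_space \<Omega>" "(\<lambda>n. l2_norm \<Omega> (\<lambda>x. U n x - V x)) \<longlonglongrightarrow> 0" by blast
  with jet_space_closed[OF U V] show ?thesis by (intro that)
qed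

text \<open>A normalized bump on a box inside \<Omega>. It shows that the infima taken below range
  over nonempty sets.\<close>

lemma jet_space_nontrivial:
  assumes "\<Omega> \<noteq> {}"
  obtains U where "U \<in> jet_space \<Omega>" "val_inner \<Omega> U U = 1"
proof -
  obtain x where "x \<in> \<Omega>" using assms by auto
  then obtain a b where ab: "\<forall>e\<in>Basis. a \<bullet> e < b \<bullet> e" "cbox a b \<subseteq> \<Omega>"
    using open_contains_cbox[OF open_\<Omega>] by metis
  let ?\<phi> = "box_bump 1 a b"
  have t: "test_function \<Omega> ?\<phi>" by (rule box_bump_test[OF _ ab(2)]) simp
  have "val_inner \<Omega> (jet ?\<phi>) (jet ?\<phi>) \<noteq> 0"
  proof
    assume "val_inner \<Omega> (jet ?\<phi>) (jet ?\<phi>) = 0"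
    then have "l2_norm \<Omega> ?\<phi> = 0" by (simp add: val_inner_def jet_def l2_norm_def)
    then have "AE y in lebesgue_on \<Omega>. ?\<phi> y = 0"
      using l2_norm_zero_iff[OF test_L2(1)[OF open_\<Omega> t]] by (simp add: ae_eq_def)
    then have "AE y in lebesgue. y \<in> \<Omega> \<longrightarrow> ?\<phi> y = 0"
      using fmeasurableD[OF lmeasurable_\<Omega>] by (simp add: AE_restrict_space_iff)
    then have "AE y in lebesgue. y \<notin> box a b"
      by eventually_elim (use ab(2) box_subset_cbox[of a b] box_bump_nonzero_iff[of 1 a b] in auto)
    then have "AE y in lborel. y \<notin> box a b" by (simp add: AE_completion_iff)
    then have "box a b \<in> null_sets lborel" using AE_iff_null_sets[of "box a b" lborel] by simp
    then have "emeasure lborel (box a b) = 0" by auto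
    moreover have "emeasure lborel (box a b) > 0"
    proof -
      have "(\<Prod>e\<in>Basis. (b - a) \<bullet> e) > 0" using ab(1) by (intro prod_pos) (simp add: inner_diff_left)
      then show ?thesis using emeasure_lborel_box[of a b] ab(1) by (simp add: less_imp_le)
    qed
    ultimately show False by simp
  qed
  then have pos: "val_inner \<Omega> (jet ?\<phi>) (jet ?\<phi>) > 0" using val_inner_nonneg[of \<Omega> "jet ?\<phi>"] by linarith
  define c where "c = 1 / sqrt (val_inner \<Omega> (jet ?\<phi>) (jet ?\<phi>))"
  have "val_inner \<Omega> (\<lambda>x. c *\<^sub>R jet ?\<phi> x) (\<lambda>x. c *\<^sub>R jet ?\<phi> x) = 1"
    using pos by (simp add: val_inner_scale c_def power_divide)
  with jet_space_scale[OF jet_in_jet_space[OF t]] show ?thesis by (rule that)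
qed

text \<open>A minimizing sequence of the Rayleigh quotient converges in \<open>L\<^sup>2\<close> along a subsequence; by the
  parallelogram law it then also converges in the gradient norm.\<close>

lemma rayleigh_minimizer:
  assumes "\<Omega> \<noteq> {}"
  obtains V \<mu> where "V \<in> jet_space \<Omega>" "val_inner \<Omega> V V = 1" "grad_inner \<Omega> V V = \<mu>"
    "\<And>U. U \<in> jet_space \<Omega> \<Longrightarrow> \<mu> * val_inner \<Omega> U U \<le> grad_inner \<Omega> U U"
proof -
  define A where "A = {grad_inner \<Omega> U U |U. U \<in> jet_space \<Omega> \<and> val_inner \<Omega> U U = 1}"
  define \<mu> where "\<mu> = Inf A"
  have A: "A \<noteq> {}" using jet_space_nontrivial[OF assms] unfolding A_def by blast
  have bdd: "bdd_below A" unfolding A_def by (rule bdd_belowI[of _ 0]) auto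
  have \<mu>0: "\<mu> \<ge> 0" unfolding \<mu>_def using A by (intro cInf_greatest) (auto simp: A_def)
  have lower: "\<mu> * val_inner \<Omega> U U \<le> grad_inner \<Omega> U U" if U: "U \<in> jet_space \<Omega>" for U
  proof (cases "val_inner \<Omega> U U = 0")
    case False
    then have pos: "val_inner \<Omega> U U > 0" using val_inner_nonneg[of \<Omega> U] by linarith
    define c where "c = 1 / sqrt (val_inner \<Omega> U U)"
    have c2: "c\<^sup>2 = 1 / val_inner \<Omega> U U" using pos by (simp add: c_def power_divide)
    have "val_inner \<Omega> (\<lambda>x. c *\<^sub>R U x) (\<lambda>x. c *\<^sub>R U x) = 1"
      using pos by (simp add: val_inner_scale c2)
    then have "\<mu> \<le> grad_inner \<Omega> (\<lambda>x. c *\<^sub>R U x) (\<lambda>x. c *\<^sub>R U x)"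
      unfolding \<mu>_def using jet_space_scale[OF U] by (intro cInf_lower[OF _ bdd]) (auto simp: A_def)
    then show ?thesis using pos by (simp add: grad_inner_scale c2 field_simps)
  qed simp
  have "\<exists>U. U \<in> jet_space \<Omega> \<and> val_inner \<Omega> U U = 1 \<and> grad_inner \<Omega> U U < \<mu> + inverse (real (Suc n))" for n
  proof -
    have "Inf A < \<mu> + inverse (real (Suc n))" by (simp add: \<mu>_def)
    from cInf_lessD[OF A this] show ?thesis by (auto simp: A_def)
  qed
  then obtain U where U: "\<And>n. U n \<in> jet_space \<Omega>" "\<And>n. val_inner \<Omega> (U n) (U n) = 1"
    "\<And>n. grad_inner \<Omega> (U n) (U n) < \<mu> + inverse (real (Suc n))" by metis
  note UL2 = jet_space_L2[OF U(1)]
  have bound: "l2_norm \<Omega> (U n) \<le> sqrt (\<mu> + 2)" for n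
  proof -
    have "inverse (real (Suc n)) \<le> 1" by (simp add: field_simps)
    then show ?thesis unfolding l2_norm_def l2_inner_jets[OF UL2] U(2) using U(3)[of n] by simp
  qed
  obtain r :: "nat \<Rightarrow> nat" and u where r: "strict_mono r" "u \<in> L2_space \<Omega>"
    "(\<lambda>n. l2_norm \<Omega> (\<lambda>x. fst (U (r n) x) - u x)) \<longlonglongrightarrow> 0" by (rule rellich[OF U(1) bound])
  have fU: "(\<lambda>x. fst (U n x)) \<in> L2_space \<Omega>" for n by (rule L2_fst_snd(1)[OF UL2])
  \<comment> \<open>One null sequence bounds both the L2 distance to u and, as
    \<open>r n \<ge> n\<close>, the excess of the Rayleigh quotient over \<mu>.\<close>
  define \<delta> where "\<delta> n = (l2_norm \<Omega> (\<lambda>x. fst (U (r n) x) - u x)) + inverse (real (Suc n))" for n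
  have \<delta>: "\<delta> \<longlonglongrightarrow> 0"
    unfolding \<delta>_def[abs_def] using tendsto_add[OF r(3) LIMSEQ_inverse_real_of_nat] by simp
  have est: "val_inner \<Omega> (\<lambda>x. U (r m) x - U (r n) x) (\<lambda>x. U (r m) x - U (r n) x)
        + grad_inner \<Omega> (\<lambda>x. U (r m) x - U (r n) x) (\<lambda>x. U (r m) x - U (r n) x)
      \<le> (1 + \<mu>) * (\<delta> m + \<delta> n)\<^sup>2 + 2 * (\<delta> m + \<delta> n)" for m n
  proof -
    let ?W = "\<lambda>x. U (r m) x - U (r n) x" and ?S = "\<lambda>x. U (r m) x + U (r n) x"
    have W: "?W \<in> jet_space \<Omega>" "?S \<in> jet_space \<Omega>" using jet_space_diff jet_space_add U(1) by blast+
    have inv0: "0 \<le> inverse (real (Suc k))" for k by simp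
    have inv: "inverse (real (Suc (r k))) \<le> inverse (real (Suc k))" for k
      using seq_suble[OF r(1), of k] by (simp add: le_imp_inverse_le)
    have g: "grad_inner \<Omega> (U (r k)) (U (r k)) \<le> \<mu> + \<delta> k" for k
      unfolding \<delta>_def using U(3)[of "r k"] inv[of k] l2_norm_nonneg[of \<Omega> "\<lambda>x. fst (U (r k) x) - u x"] by linarith
    have "l2_norm \<Omega> (\<lambda>x. fst (U (r m) x) - fst (U (r n) x)) \<le> \<delta> m + \<delta> n"
      using l2_norm_diff_triangle[OF fU[of "r m"] r(2) fU[of "r n"]] l2_norm_minus_commute[of \<Omega> u "\<lambda>x. fst (U (r n) x)"]
        inv0[of m] inv0[of n] unfolding \<delta>_def by linarith
    then have "(l2_norm \<Omega> (\<lambda>x. fst (U (r m) x) - fst (U (r n) x)))\<^sup>2 \<le> (\<delta> m + \<delta> n)\<^sup>2" by (rule power_mono) simp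
    then have v: "val_inner \<Omega> ?W ?W \<le> (\<delta> m + \<delta> n)\<^sup>2" by (simp add: val_inner_def l2_norm_square)
    have "grad_inner \<Omega> ?W ?W = 2 * grad_inner \<Omega> (U (r m)) (U (r m)) + 2 * grad_inner \<Omega> (U (r n)) (U (r n)) - grad_inner \<Omega> ?S ?S"
      by (rule grad_inner_parallelogram[OF UL2 UL2])
    \<comment> \<open>The Rayleigh quotient of the sum is at least \<mu>, and by the parallelogram
      law the squared L2 norm of the sum is nearly 4; little is left for the gradient of the
      difference.\<close>
    also have "\<dots> \<le> 2 * (\<mu> + \<delta> m) + 2 * (\<mu> + \<delta> n) - \<mu> * val_inner \<Omega> ?S ?S"
      using g[of m] g[of n] lower[OF W(2)] by argo
    also have "val_inner \<Omega> ?S ?S = 4 - val_inner \<Omega> ?W ?W"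
      using val_inner_parallelogram[OF UL2[of "r m"] UL2[of "r n"]] by (simp add: U(2))
    finally have "grad_inner \<Omega> ?W ?W \<le> 2 * (\<delta> m + \<delta> n) + \<mu> * val_inner \<Omega> ?W ?W" by (simp add: algebra_simps)
    also have "\<dots> \<le> 2 * (\<delta> m + \<delta> n) + \<mu> * (\<delta> m + \<delta> n)\<^sup>2" using mult_left_mono[OF v \<mu>0] by simp
    finally show ?thesis using v by (simp add: algebra_simps)
  qed
  have Cauchy: "\<exists>N. \<forall>m\<ge>N. \<forall>n\<ge>N. val_inner \<Omega> (\<lambda>x. U (r m) x - U (r n) x) (\<lambda>x. U (r m) x - U (r n) x)
        + grad_inner \<Omega> (\<lambda>x. U (r m) x - U (r n) x) (\<lambda>x. U (r m) x - U (r n) x) < \<epsilon>" if \<epsilon>: "\<epsilon> > 0" for \<epsilon>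
  proof -
    \<comment> \<open>Halving leaves room for the two terms \<open>\<delta> m\<close> and
      \<open>\<delta> n\<close>; the bound 1 on their sum lets its square be estimated by the sum
      itself.\<close>
    define t where "t = min 1 (\<epsilon> / (3 + \<mu>)) / 2"
    have t: "t > 0" "2 * t \<le> 1" "(3 + \<mu>) * (2 * t) \<le> \<epsilon>"
    proof -
      show "t > 0" "2 * t \<le> 1" using \<epsilon> \<mu>0 by (auto simp: t_def)
      have "2 * t \<le> \<epsilon> / (3 + \<mu>)" by (simp add: t_def)
      then show "(3 + \<mu>) * (2 * t) \<le> \<epsilon>" using \<mu>0 by (simp add: pos_le_divide_eq mult.commute)
    qed
    from LIMSEQ_D[OF \<delta> t(1)] obtain N where N: "\<And>n. n \<ge> N \<Longrightarrow> \<bar>\<delta> n\<bar> < t" by auto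
    have d0: "\<delta> n \<ge> 0" for n by (simp add: \<delta>_def)
    have "(1 + \<mu>) * (\<delta> m + \<delta> n)\<^sup>2 + 2 * (\<delta> m + \<delta> n) < \<epsilon>" if "m \<ge> N" "n \<ge> N" for m n
    proof -
      have s: "0 \<le> \<delta> m + \<delta> n" "\<delta> m + \<delta> n < 2 * t" using N[OF that(1)] N[OF that(2)] d0[of m] d0[of n] by auto
      then have "(\<delta> m + \<delta> n)\<^sup>2 \<le> \<delta> m + \<delta> n" using t(2) by (simp add: power2_eq_square mult_left_le)
      then have "(1 + \<mu>) * (\<delta> m + \<delta> n)\<^sup>2 \<le> (1 + \<mu>) * (\<delta> m + \<delta> n)" using \<mu>0 by (intro mult_left_mono) auto
      then have "(1 + \<mu>) * (\<delta> m + \<delta> n)\<^sup>2 + 2 * (\<delta> m + \<delta> n) \<le> (3 + \<mu>) * (\<delta> m + \<delta> n)" by (simp add: algebra_simps)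
      also have "\<dots> < (3 + \<mu>) * (2 * t)" using s \<mu>0 by (intro mult_strict_left_mono) auto
      finally show ?thesis using t(3) by linarith
    qed
    then show ?thesis using est le_less_trans by blast
  qed
  obtain V where V: "V \<in> jet_space \<Omega>" "(\<lambda>n. l2_norm \<Omega> (\<lambda>x. U (r n) x - V x)) \<longlonglongrightarrow> 0"
    by (rule jet_space_complete[of "\<lambda>n. U (r n)", OF U(1) Cauchy])
  note lims = jet_space_snd_tendsto[of "\<lambda>n. U (r n)", OF U(1) V]
  have val: "val_inner \<Omega> V V = 1" using lims(2) U(2) by (simp add: LIMSEQ_const_iff)
  have "grad_inner \<Omega> V V \<le> \<mu>"
  proof (rule LIMSEQ_le[OF lims(1)])
    have "(\<lambda>n. \<mu> + inverse (real (Suc (r n)))) \<longlonglongrightarrow> \<mu> + 0"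
      using LIMSEQ_subseq_LIMSEQ[OF LIMSEQ_inverse_real_of_nat r(1)] by (intro tendsto_intros) (simp add: o_def)
    then show "(\<lambda>n. \<mu> + inverse (real (Suc (r n)))) \<longlonglongrightarrow> \<mu>" by simp
    show "\<exists>N. \<forall>n\<ge>N. grad_inner \<Omega> (U (r n)) (U (r n)) \<le> \<mu> + inverse (real (Suc (r n)))"
      using U(3) less_imp_le by blast
  qed
  moreover have "\<mu> \<le> grad_inner \<Omega> V V" using lower[OF V(1)] val by simp
  ultimately show ?thesis using that[OF V(1) val _ lower] by simp
qed

section \<open>Transfer to the Dirichlet form and the first eigenvalue\<close>

lemma dirichlet_form_eq:
  assumes "U \<in> jet_space \<Omega>" "v \<in> H10 \<Omega>"
  shows "dirichlet_form \<Omega> (\<lambda>x. fst (U x)) v = grad_inner \<Omega> U (\<lambda>x. (v x, weak_gradient \<Omega> v x))"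
proof -
  let ?u = "\<lambda>x. fst (U x)"
  note u = jet_space_imp_H10[OF assms(1)]
  have wu: "weak_gradient \<Omega> ?u \<in> L2_space \<Omega>" using u(1) H1_weak_gradient(2) by (simp add: H10_def)
  have wv: "weak_gradient \<Omega> v \<in> L2_space \<Omega>" using assms(2) H1_weak_gradient(2) by (simp add: H10_def)
  have "dirichlet_form \<Omega> ?u v = l2_inner \<Omega> (weak_gradient \<Omega> ?u) (weak_gradient \<Omega> v)"
    by (simp add: dirichlet_form_def l2_inner_def)
  also have "\<dots> = l2_inner \<Omega> (\<lambda>x. snd (U x)) (weak_gradient \<Omega> v)"
    by (rule l2_inner_cong[OF wu wv L2_fst_snd(2)[OF jet_space_L2[OF assms(1)]] wv u(2)]) (simp add: ae_eq_def)
  finally show ?thesis by (simp add: grad_inner_def)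
qed

lemma weak_gradient_norm_eq:
  assumes "U \<in> jet_space \<Omega>"
  shows "(LINT x|lebesgue_on \<Omega>. (norm (weak_gradient \<Omega> (\<lambda>x. fst (U x)) x))\<^sup>2) = grad_inner \<Omega> U U"
proof -
  note u = jet_space_imp_H10[OF assms]
  have wu: "weak_gradient \<Omega> (\<lambda>x. fst (U x)) \<in> L2_space \<Omega>" using u(1) H1_weak_gradient(2) by (simp add: H10_def)
  have L: "(\<lambda>x. snd (U x)) \<in> L2_space \<Omega>" by (rule L2_fst_snd(2)[OF jet_space_L2[OF assms]])
  show ?thesis
    unfolding l2_inner_self_eq[symmetric] grad_inner_def by (rule l2_inner_cong[OF wu wu L L u(2) u(2)])
qed

text \<open>A Rayleigh minimizer satisfies the eigenvalue equation, and every eigenvalue is the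
  Rayleigh quotient of its eigenfunction, hence at least \<mu>. In particular the
  \<open>LEAST\<close> in \<open>first_eigenvalue\<close> is attained.\<close>

theorem first_eigenfunction:
  assumes "\<Omega> \<noteq> {}"
  obtains V where "V \<in> jet_space \<Omega>" "val_inner \<Omega> V V = 1" "grad_inner \<Omega> V V = first_eigenvalue \<Omega>"
proof -
  obtain V \<mu> where V: "V \<in> jet_space \<Omega>" "val_inner \<Omega> V V = 1" "grad_inner \<Omega> V V = \<mu>"
    and lower: "\<And>U. U \<in> jet_space \<Omega> \<Longrightarrow> \<mu> * val_inner \<Omega> U U \<le> grad_inner \<Omega> U U"
    using rayleigh_minimizer[OF assms] by metis
  note VL2 = jet_space_L2[OF V(1)]
  have EL: "grad_inner \<Omega> V W = \<mu> * val_inner \<Omega> V W" if W: "W \<in> jet_space \<Omega>" for W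
  proof -
    note WL2 = jet_space_L2[OF W]
    have "0 \<le> 2 * t * (grad_inner \<Omega> V W - \<mu> * val_inner \<Omega> V W) + t\<^sup>2 * (grad_inner \<Omega> W W - \<mu> * val_inner \<Omega> W W)" for t
      using lower[OF jet_space_add[OF V(1) jet_space_scale[OF W, of t]]]
      unfolding grad_inner_add[OF VL2 WL2] val_inner_add[OF VL2 WL2] V(2,3) by (simp add: algebra_simps)
    from linear_term_zero[OF this] show ?thesis by simp
  qed
  have "first_eigenvalue \<Omega> = \<mu>"
    unfolding first_eigenvalue_def
  proof (rule Least_equality)
    let ?u = "\<lambda>x. fst (V x)"
    have "\<not> ae_eq \<Omega> ?u (\<lambda>x. 0)"
      using l2_norm_zero_iff[OF L2_fst_snd(1)[OF VL2]] V(2) by (simp add: val_inner_def l2_norm_def)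
    moreover have "dirichlet_form \<Omega> ?u v = \<mu> * (LINT x|lebesgue_on \<Omega>. ?u x * v x)" if v: "v \<in> H10 \<Omega>" for v
      using EL[OF H10_imp_jet_space[OF v]] by (simp add: dirichlet_form_eq[OF V(1) v] val_inner_def l2_inner_def)
    ultimately show "dirichlet_eigenvalue \<Omega> \<mu>"
      unfolding dirichlet_eigenvalue_def using jet_space_imp_H10(1)[OF V(1)] by blast
  next
    fix \<nu> assume "dirichlet_eigenvalue \<Omega> \<nu>"
    then obtain u where u: "u \<in> H10 \<Omega>" "\<not> ae_eq \<Omega> u (\<lambda>x. 0)"
      "dirichlet_form \<Omega> u u = \<nu> * (LINT x|lebesgue_on \<Omega>. u x * u x)"
      unfolding dirichlet_eigenvalue_def by blast
    let ?U = "\<lambda>x. (u x, weak_gradient \<Omega> u x)"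
    note U = H10_imp_jet_space[OF u(1)]
    have "grad_inner \<Omega> ?U ?U = \<nu> * val_inner \<Omega> ?U ?U"
      using u(3) by (simp add: dirichlet_form_def grad_inner_def val_inner_def l2_inner_def)
    then have "\<mu> * val_inner \<Omega> ?U ?U \<le> \<nu> * val_inner \<Omega> ?U ?U" using lower[OF U] by simp
    moreover have "val_inner \<Omega> ?U ?U \<noteq> 0"
      using l2_norm_zero_iff[OF L2_fst_snd(1)[OF jet_space_L2[OF U]]] u(2) by (simp add: val_inner_def l2_norm_def)
    then have "val_inner \<Omega> ?U ?U > 0" using val_inner_nonneg[of \<Omega> ?U] by linarith
    ultimately show "\<mu> \<le> \<nu>" by simp
  qed
  with V show ?thesis using that by simp
qed

text \<open>The limit is found, without weak compactness, among the elements of least gradient norm that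
  are \<open>L\<^sup>2\<close>-close to \<open>u\<close>.\<close>

lemma jet_space_L2_limit:
  assumes U: "\<And>n::nat. U n \<in> jet_space \<Omega>" and K: "\<And>n. grad_inner \<Omega> (U n) (U n) \<le> K"
    and u: "u \<in> L2_space \<Omega>" "(\<lambda>n. l2_norm \<Omega> (\<lambda>x. fst (U n x) - u x)) \<longlonglongrightarrow> 0"
  obtains V where "V \<in> jet_space \<Omega>" "(\<lambda>n. l2_norm \<Omega> (\<lambda>x. fst (U n x) - fst (V x))) \<longlonglongrightarrow> 0"
proof -
  have fst_L2: "(\<lambda>x. fst (W x)) \<in> L2_space \<Omega>" if "W \<in> jet_space \<Omega>" for W
    by (rule L2_fst_snd(1)[OF jet_space_L2[OF that]])
  define \<epsilon> where "\<epsilon> k = inverse (real (Suc k))" for k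
  have \<epsilon>: "\<epsilon> k > 0" for k by (simp add: \<epsilon>_def)
  have \<epsilon>_lim: "\<epsilon> \<longlonglongrightarrow> 0" unfolding \<epsilon>_def[abs_def] by (rule LIMSEQ_inverse_real_of_nat)
  have \<epsilon>_mono: "\<epsilon> j \<le> \<epsilon> k" if "k \<le> j" for j k using that by (simp add: \<epsilon>_def le_imp_inverse_le)
  define C where "C k = {W \<in> jet_space \<Omega>. l2_norm \<Omega> (\<lambda>x. fst (W x) - u x) \<le> \<epsilon> k}" for k
  define d where "d k = Inf ((\<lambda>W. grad_inner \<Omega> W W) ` C k)" for k
  have bdd: "bdd_below ((\<lambda>W. grad_inner \<Omega> W W) ` C k)" for k by (rule bdd_belowI[of _ 0]) auto
  have d_le: "d k \<le> grad_inner \<Omega> W W" if "W \<in> C k" for W k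
    unfolding d_def using that by (intro cInf_lower[OF _ bdd]) auto
  have CU: "\<exists>n. U n \<in> C k" for k
    using LIMSEQ_D[OF u(2) \<epsilon>[of k]] U by (auto simp: C_def intro: less_imp_le)
  have dK: "d k \<le> K" for k using CU[of k] d_le K order_trans by blast
  have C_anti: "C j \<subseteq> C k" if "k \<le> j" for j k using \<epsilon>_mono[OF that] by (auto simp: C_def)
  \<comment> \<open>The sets \<open>C k\<close> shrink, so their infima increase. Each
    \<open>C k\<close> contains a member of the sequence, which bounds the infima by K and makes
    them converge.\<close>
  have "incseq d"
  proof (rule incseq_SucI)
    fix k
    show "d k \<le> d (Suc k)" unfolding d_def
      using CU[of "Suc k"] C_anti[of k "Suc k"] by (intro cInf_superset_mono[OF _ bdd]) auto
  qed
  then obtain dl where dl: "d \<longlonglongrightarrow> dl" using incseq_convergent[of d K] dK by blast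
  have "\<exists>W. W \<in> C k \<and> grad_inner \<Omega> W W < d k + \<epsilon> k" for k
  proof -
    have ne: "(\<lambda>W. grad_inner \<Omega> W W) ` C k \<noteq> {}" using CU[of k] by auto
    have "Inf ((\<lambda>W. grad_inner \<Omega> W W) ` C k) < d k + \<epsilon> k" using \<epsilon> by (simp add: d_def)
    from cInf_lessD[OF ne this] show ?thesis by blast
  qed
  then obtain W where W: "\<And>k. W k \<in> C k" "\<And>k. grad_inner \<Omega> (W k) (W k) < d k + \<epsilon> k" by metis
  have WJ: "W k \<in> jet_space \<Omega>" for k using W(1)[of k] by (simp add: C_def)
  note WL2 = jet_space_L2[OF WJ]
  have Wu: "l2_norm \<Omega> (\<lambda>x. fst (W k x) - u x) \<le> \<epsilon> k" for k using W(1)[of k] by (simp add: C_def)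
  have est: "val_inner \<Omega> (\<lambda>x. W k x - W j x) (\<lambda>x. W k x - W j x) + grad_inner \<Omega> (\<lambda>x. W k x - W j x) (\<lambda>x. W k x - W j x)
      \<le> (2 * \<epsilon> k)\<^sup>2 + 2 * (d j - d k) + 4 * \<epsilon> k" if kj: "k \<le> j" for j k
  proof -
    let ?X = "\<lambda>x. W k x - W j x" and ?S = "\<lambda>x. W k x + W j x"
    have jk: "l2_norm \<Omega> (\<lambda>x. fst (W j x) - u x) \<le> \<epsilon> k" using Wu[of j] \<epsilon>_mono[OF kj] by linarith
    have "l2_norm \<Omega> (\<lambda>x. fst (W k x) - fst (W j x)) \<le> 2 * \<epsilon> k"
      using l2_norm_diff_triangle[OF fst_L2[OF WJ[of k]] u(1) fst_L2[OF WJ[of j]]]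
        l2_norm_minus_commute[of \<Omega> u "\<lambda>x. fst (W j x)"] Wu[of k] jk by simp
    then have "(l2_norm \<Omega> (\<lambda>x. fst (W k x) - fst (W j x)))\<^sup>2 \<le> (2 * \<epsilon> k)\<^sup>2" by (rule power_mono) simp
    then have v: "val_inner \<Omega> ?X ?X \<le> (2 * \<epsilon> k)\<^sup>2" by (simp add: val_inner_def l2_norm_square)
    \<comment> \<open>\<open>C k\<close> is convex, so the midpoint is admissible and its squared
      gradient norm is at least \<open>d k\<close>; this bounds the subtracted term in the
      parallelogram law from below.\<close>
    have "(\<lambda>x. (1/2) *\<^sub>R ?S x) \<in> C k"
    proof -
      have "l2_norm \<Omega> (\<lambda>x. (1/2) *\<^sub>R ((fst (W k x) - u x) + (fst (W j x) - u x))) \<le> \<epsilon> k"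
        unfolding l2_norm_scale
        using l2_norm_triangle[OF L2_diff[OF fst_L2[OF WJ[of k]] u(1)] L2_diff[OF fst_L2[OF WJ[of j]] u(1)]] Wu[of k] jk
        by simp
      moreover have "(\<lambda>x. (1/2) *\<^sub>R ((fst (W k x) - u x) + (fst (W j x) - u x))) = (\<lambda>x. fst ((1/2) *\<^sub>R ?S x) - u x)"
        by (simp add: fun_eq_iff algebra_simps)
      ultimately show ?thesis
        unfolding C_def using jet_space_scale[OF jet_space_add[OF WJ[of k] WJ[of j]], of "1/2"] by simp
    qed
    from d_le[OF this] have "4 * d k \<le> grad_inner \<Omega> ?S ?S" by (simp only: grad_inner_scale) (simp add: power2_eq_square)
    moreover have "grad_inner \<Omega> ?X ?X = 2 * grad_inner \<Omega> (W k) (W k) + 2 * grad_inner \<Omega> (W j) (W j) - grad_inner \<Omega> ?S ?S"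
      by (rule grad_inner_parallelogram[OF WL2 WL2])
    ultimately have "grad_inner \<Omega> ?X ?X \<le> 2 * (d k + \<epsilon> k) + 2 * (d j + \<epsilon> j) - 4 * d k"
      using W(2)[of k] W(2)[of j] by argo
    also have "\<dots> \<le> 2 * (d j - d k) + 4 * \<epsilon> k" using \<epsilon>_mono[OF kj] by simp
    finally show ?thesis using v by linarith
  qed
  have Cauchy: "\<exists>N. \<forall>m\<ge>N. \<forall>n\<ge>N. val_inner \<Omega> (\<lambda>x. W m x - W n x) (\<lambda>x. W m x - W n x)
        + grad_inner \<Omega> (\<lambda>x. W m x - W n x) (\<lambda>x. W m x - W n x) < e" if e: "e > 0" for e
  proof -
    have "(\<lambda>k. (2 * \<epsilon> k)\<^sup>2 + 2 * (dl - d k) + 4 * \<epsilon> k) \<longlonglongrightarrow> (2 * 0)\<^sup>2 + 2 * (dl - dl) + 4 * 0"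
      by (intro tendsto_intros \<epsilon>_lim dl)
    then have "(\<lambda>k. (2 * \<epsilon> k)\<^sup>2 + 2 * (dl - d k) + 4 * \<epsilon> k) \<longlonglongrightarrow> 0" by simp
    from LIMSEQ_D[OF this e] obtain N where N: "\<And>k. k \<ge> N \<Longrightarrow> \<bar>(2 * \<epsilon> k)\<^sup>2 + 2 * (dl - d k) + 4 * \<epsilon> k\<bar> < e" by auto
    have d_dl: "d j \<le> dl" for j using incseq_le[OF \<open>incseq d\<close> dl] .
    define Q where "Q m n = val_inner \<Omega> (\<lambda>x. W m x - W n x) (\<lambda>x. W m x - W n x) + grad_inner \<Omega> (\<lambda>x. W m x - W n x) (\<lambda>x. W m x - W n x)" for m n
    have sym: "Q m n = Q n m" for m n
      unfolding Q_def using val_inner_scale[of \<Omega> "-1" "\<lambda>x. W m x - W n x"] grad_inner_scale[of \<Omega> "-1" "\<lambda>x. W m x - W n x"] by simp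
    have *: "Q k j < e"
      if "k \<ge> N" "k \<le> j" for k j
    proof -
      have "(2 * \<epsilon> k)\<^sup>2 + 2 * (d j - d k) + 4 * \<epsilon> k \<le> (2 * \<epsilon> k)\<^sup>2 + 2 * (dl - d k) + 4 * \<epsilon> k"
        using d_dl[of j] by simp
      moreover have "(2 * \<epsilon> k)\<^sup>2 + 2 * (dl - d k) + 4 * \<epsilon> k < e" using N[OF that(1)] by simp
      ultimately show ?thesis unfolding Q_def by (rule le_less_trans[OF order_trans[OF est[OF that(2)]]])
    qed
    have "Q m n < e" if "m \<ge> N" "n \<ge> N" for m n
      using *[of m n] *[of n m] that sym[of m n] by (cases "m \<le> n") auto
    then show ?thesis unfolding Q_def by blast
  qed
  obtain V where V: "V \<in> jet_space \<Omega>" "(\<lambda>n. l2_norm \<Omega> (\<lambda>x. W n x - V x)) \<longlonglongrightarrow> 0"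
    by (rule jet_space_complete[OF WJ Cauchy])
  have zero: "l2_norm \<Omega> (\<lambda>x. u x - fst (V x)) \<le> 0"
  proof (rule LIMSEQ_le_const)
    show "(\<lambda>n. \<epsilon> n + l2_norm \<Omega> (\<lambda>x. fst (W n x) - fst (V x))) \<longlonglongrightarrow> 0"
      using tendsto_add[OF \<epsilon>_lim jet_space_snd_tendsto(3)[OF WJ V]] by simp
    have "l2_norm \<Omega> (\<lambda>x. u x - fst (V x)) \<le> \<epsilon> n + l2_norm \<Omega> (\<lambda>x. fst (W n x) - fst (V x))" for n
      using l2_norm_diff_triangle[OF u(1) fst_L2[OF WJ[of n]] fst_L2[OF V(1)]]
        l2_norm_minus_commute[of \<Omega> u "\<lambda>x. fst (W n x)"] Wu[of n] by simp
    then show "\<exists>N. \<forall>n\<ge>N. l2_norm \<Omega> (\<lambda>x. u x - fst (V x)) \<le> \<epsilon> n + l2_norm \<Omega> (\<lambda>x. fst (W n x) - fst (V x))" by blast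
  qed
  have "(\<lambda>n. l2_norm \<Omega> (\<lambda>x. fst (U n x) - fst (V x))) \<longlonglongrightarrow> 0"
  proof (rule Lim_null_comparison[OF _ u(2)])
    have "l2_norm \<Omega> (\<lambda>x. fst (U n x) - fst (V x)) \<le> l2_norm \<Omega> (\<lambda>x. fst (U n x) - u x)" for n
      using l2_norm_diff_triangle[OF fst_L2[OF U[of n]] u(1) fst_L2[OF V(1)]] zero by linarith
    then show "\<forall>\<^sub>F n in sequentially. norm (l2_norm \<Omega> (\<lambda>x. fst (U n x) - fst (V x))) \<le> l2_norm \<Omega> (\<lambda>x. fst (U n x) - u x)"
      by simp
  qed
  with V(1) show ?thesis by (rule that)
qed

text \<open>Integration by parts against the test functions \<partial>_e \<phi>. The right-hand side
  is minus the L2 product of the value component with the Laplacian of \<phi>, and no gradient of X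
  is left in it.\<close>

lemma grad_inner_test:
  assumes X: "X \<in> jet_space \<Omega>" and \<phi>: "test_function \<Omega> \<phi>"
  shows "grad_inner \<Omega> X (jet \<phi>) = - (\<Sum>e\<in>Basis. l2_inner \<Omega> (\<lambda>x. fst (X x)) (\<lambda>x. gradient (\<lambda>x. gradient \<phi> x \<bullet> e) x \<bullet> e))"
proof -
  note sX = L2_fst_snd(2)[OF jet_space_L2[OF X]]
  have "grad_inner \<Omega> X (jet \<phi>) = (LINT x|lebesgue_on \<Omega>. (\<Sum>e\<in>Basis. (snd (X x) \<bullet> e) * (gradient \<phi> x \<bullet> e)))"
    unfolding grad_inner_def l2_inner_def jet_def snd_conv
    by (rule Bochner_Integration.integral_cong[OF refl]) (rule euclidean_inner)
  also have "\<dots> = (\<Sum>e\<in>Basis. LINT x|lebesgue_on \<Omega>. (snd (X x) \<bullet> e) * (gradient \<phi> x \<bullet> e))"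
    using L2_inner_integrable[OF L2_component[OF sX] L2_component[OF test_L2(2)[OF open_\<Omega> \<phi>]]]
    by (intro Bochner_Integration.integral_sum) simp
  also have "\<dots> = (\<Sum>e\<in>Basis. - l2_inner \<Omega> (\<lambda>x. fst (X x)) (\<lambda>x. gradient (\<lambda>x. gradient \<phi> x \<bullet> e) x \<bullet> e))"
  proof (rule sum.cong[OF refl])
    fix e :: 'a assume e: "e \<in> Basis"
    show "(LINT x|lebesgue_on \<Omega>. (snd (X x) \<bullet> e) * (gradient \<phi> x \<bullet> e)) =
        - l2_inner \<Omega> (\<lambda>x. fst (X x)) (\<lambda>x. gradient (\<lambda>x. gradient \<phi> x \<bullet> e) x \<bullet> e)"
      using jet_space_weak_gradient[OF X, unfolded is_weak_gradient_def, rule_format, OF test_partial[OF \<phi> e] e]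
      by (simp add: l2_inner_def)
  qed
  finally show ?thesis by (simp add: sum_negf)
qed

text \<open>Against a test jet the derivatives move onto the test function, where L2 convergence of
  the values suffices; density of test jets and the uniform gradient bound extend this to Z.\<close>

lemma grad_inner_weak_convergence:
  assumes X: "\<And>n::nat. X n \<in> jet_space \<Omega>" and K: "\<And>n. grad_inner \<Omega> (X n) (X n) \<le> K"
    and lim: "(\<lambda>n. l2_norm \<Omega> (\<lambda>x. fst (X n x))) \<longlonglongrightarrow> 0" and Z: "Z \<in> jet_space \<Omega>"
  shows "(\<lambda>n. grad_inner \<Omega> (X n) Z) \<longlonglongrightarrow> 0"
proof (rule LIMSEQ_I)
  fix \<epsilon> :: real assume \<epsilon>: "\<epsilon> > 0"
  have K0: "K \<ge> 0" using K[of 0] grad_inner_nonneg order_trans by blast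
  define \<eta> where "\<eta> = \<epsilon> / (2 * (sqrt K + 1))"
  have \<eta>: "\<eta> > 0" using \<epsilon> K0 by (simp add: \<eta>_def add_nonneg_pos)
  obtain \<phi> where \<phi>: "test_function \<Omega> \<phi>" "l2_norm \<Omega> (\<lambda>x. jet \<phi> x - Z x) < \<eta>"
    using jet_space_approx[OF Z \<eta>] by metis
  note sX = L2_fst_snd(2)[OF jet_space_L2[OF X]] and fX = L2_fst_snd(1)[OF jet_space_L2[OF X]]
  note sZ = L2_fst_snd(2)[OF jet_space_L2[OF Z]]
  have "(\<lambda>n. grad_inner \<Omega> (X n) (jet \<phi>)) \<longlonglongrightarrow> - (\<Sum>e\<in>(Basis::'a set). l2_inner \<Omega> (\<lambda>x. 0) (\<lambda>x. gradient (\<lambda>x. gradient \<phi> x \<bullet> e) x \<bullet> e))"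
    unfolding grad_inner_test[OF X \<phi>(1)]
  proof (intro tendsto_minus tendsto_sum)
    fix e :: 'a assume e: "e \<in> Basis"
    show "(\<lambda>n. l2_inner \<Omega> (\<lambda>x. fst (X n x)) (\<lambda>x. gradient (\<lambda>x. gradient \<phi> x \<bullet> e) x \<bullet> e)) \<longlonglongrightarrow>
        l2_inner \<Omega> (\<lambda>x. 0) (\<lambda>x. gradient (\<lambda>x. gradient \<phi> x \<bullet> e) x \<bullet> e)"
      by (rule l2_inner_tendsto[OF fX L2_zero test_L2(1)[OF open_\<Omega> test_partial[OF test_partial[OF \<phi>(1) e] e]]]) (use lim in simp)
  qed
  then have "(\<lambda>n. grad_inner \<Omega> (X n) (jet \<phi>)) \<longlonglongrightarrow> 0" by (simp add: l2_inner_def)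
  from LIMSEQ_D[OF this, of "\<epsilon>/2"] \<epsilon> obtain N where N: "\<And>n. n \<ge> N \<Longrightarrow> \<bar>grad_inner \<Omega> (X n) (jet \<phi>)\<bar> < \<epsilon>/2" by auto
  have "\<bar>grad_inner \<Omega> (X n) Z\<bar> < \<epsilon>" if "n \<ge> N" for n
  proof -
    note g\<phi> = test_L2(2)[OF open_\<Omega> \<phi>(1)]
    have "l2_norm \<Omega> (\<lambda>x. gradient \<phi> x - snd (Z x)) \<le> \<eta>"
      using l2_norm_fst_snd_le(3)[OF L2_diff[OF jet_L2[OF \<phi>(1)] jet_space_L2[OF Z]]] \<phi>(2) by (simp add: jet_def)
    moreover have "l2_norm \<Omega> (\<lambda>x. snd (X n x)) \<le> sqrt K" using K[of n] by (simp add: l2_norm_def grad_inner_def)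
    ultimately have "l2_norm \<Omega> (\<lambda>x. snd (X n x)) * l2_norm \<Omega> (\<lambda>x. gradient \<phi> x - snd (Z x)) \<le> sqrt K * \<eta>"
      by (intro mult_mono) (use K0 in auto)
    also have "\<dots> \<le> (sqrt K + 1) * \<eta>" using \<eta> by simp
    also have "\<dots> = \<epsilon>/2"
    proof -
      have "s * (\<epsilon> / (2 * s)) = \<epsilon> / 2" if "s \<noteq> 0" for s using that by simp
      moreover have "sqrt K + 1 \<noteq> 0" using K0 by (simp add: add_nonneg_eq_0_iff)
      ultimately show ?thesis unfolding \<eta>_def by blast
    qed
    finally have "\<bar>l2_inner \<Omega> (\<lambda>x. snd (X n x)) (\<lambda>x. gradient \<phi> x - snd (Z x))\<bar> \<le> \<epsilon>/2"
      using l2_Cauchy_Schwarz[OF sX L2_diff[OF g\<phi> sZ]] order_trans by blast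
    moreover have "l2_inner \<Omega> (\<lambda>x. snd (X n x)) (\<lambda>x. gradient \<phi> x - snd (Z x)) = grad_inner \<Omega> (X n) (jet \<phi>) - grad_inner \<Omega> (X n) Z"
      using l2_inner_diff_right[OF g\<phi> sZ sX[of n]] by (simp add: grad_inner_def jet_def)
    ultimately show ?thesis using N[OF that] by linarith
  qed
  then show "\<exists>N. \<forall>n\<ge>N. norm (grad_inner \<Omega> (X n) Z - 0) < \<epsilon>" by auto
qed

end

section \<open>The energy and its minimizer\<close>

text \<open>Case split at |x| = d |y| with (1 + d)^p = 1 + \<epsilon>: below, the sum is at most (1
  + d) |y|; above, y is absorbed into a multiple of x.\<close>

lemma powr_add_le:
  fixes p \<epsilon> :: real
  assumes "p > 0" "\<epsilon> > 0"
  obtains C where "C \<ge> 0" "\<And>x y::real. \<bar>x + y\<bar> powr p \<le> (1 + \<epsilon>) * \<bar>y\<bar> powr p + C * \<bar>x\<bar> powr p"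
proof -
  define d where "d = (1 + \<epsilon>) powr (1 / p) - 1"
  have "1 < (1 + \<epsilon>) powr (1 / p)" using assms by (simp add: gr_one_powr)
  then have d: "d > 0" by (simp add: d_def)
  have dp: "(1 + d) powr p = 1 + \<epsilon>" using assms by (simp add: d_def powr_powr)
  have "\<bar>x + y\<bar> powr p \<le> (1 + \<epsilon>) * \<bar>y\<bar> powr p + (1 + 1 / d) powr p * \<bar>x\<bar> powr p" for x y :: real
  proof (cases "\<bar>x\<bar> \<le> d * \<bar>y\<bar>")
    case True
    then have "\<bar>x + y\<bar> \<le> (1 + d) * \<bar>y\<bar>" by (simp add: algebra_simps)
    then have "\<bar>x + y\<bar> powr p \<le> ((1 + d) * \<bar>y\<bar>) powr p" using assms by (intro powr_mono2) auto
    also have "\<dots> = (1 + \<epsilon>) * \<bar>y\<bar> powr p" using d by (simp add: powr_mult dp)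
    finally show ?thesis by (simp add: add_increasing2)
  next
    case False
    then have "\<bar>y\<bar> \<le> 1 / d * \<bar>x\<bar>" using d by (simp add: field_simps)
    then have "\<bar>x + y\<bar> \<le> (1 + 1 / d) * \<bar>x\<bar>" by (simp add: algebra_simps)
    then have "\<bar>x + y\<bar> powr p \<le> ((1 + 1 / d) * \<bar>x\<bar>) powr p" using assms by (intro powr_mono2) auto
    also have "\<dots> = (1 + 1 / d) powr p * \<bar>x\<bar> powr p" using d by (simp add: powr_mult)
    finally show ?thesis using assms by (simp add: add_increasing)
  qed
  then show ?thesis by (intro that[of "(1 + 1 / d) powr p"]) auto
qed

lemma integrable_powr_add:
  fixes u v :: "'a \<Rightarrow> real"
  assumes "p > 0" and [measurable]: "u \<in> borel_measurable M" "v \<in> borel_measurable M"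
    and "integrable M (\<lambda>x. \<bar>u x\<bar> powr p)" "integrable M (\<lambda>x. \<bar>v x\<bar> powr p)"
  shows "integrable M (\<lambda>x. \<bar>u x + v x\<bar> powr p)"
proof -
  obtain C where C: "C \<ge> 0" "\<And>x y::real. \<bar>x + y\<bar> powr p \<le> (1 + 1) * \<bar>y\<bar> powr p + C * \<bar>x\<bar> powr p"
    using powr_add_le[OF assms(1), of 1] by auto
  show ?thesis
  proof (rule Bochner_Integration.integrable_bound)
    show "integrable M (\<lambda>x. (1 + 1) * \<bar>v x\<bar> powr p + C * \<bar>u x\<bar> powr p)" using assms by auto
    show "AE x in M. norm (\<bar>u x + v x\<bar> powr p) \<le> norm ((1 + 1) * \<bar>v x\<bar> powr p + C * \<bar>u x\<bar> powr p)"
      using C(2) order_trans[OF C(2) abs_ge_self] by (intro AE_I2) simp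
  qed measurable
qed

text \<open>The upper half of the Brezis--Lieb lemma, with a loss of \<open>\<epsilon>\<close>, suffices for lower
  semicontinuity of the energy.\<close>

lemma Brezis_Lieb_upper:
  fixes u :: "'a \<Rightarrow> real" and v :: "nat \<Rightarrow> 'a \<Rightarrow> real"
  assumes p: "p > 0" and \<epsilon>: "\<epsilon> > 0"
    and [measurable]: "u \<in> borel_measurable M" "\<And>n. v n \<in> borel_measurable M"
    and int: "integrable M (\<lambda>x. \<bar>u x\<bar> powr p)" "\<And>n. integrable M (\<lambda>x. \<bar>v n x\<bar> powr p)"
    and lim: "AE x in M. (\<lambda>n. v n x) \<longlonglongrightarrow> 0"
  shows "\<exists>\<delta>. \<delta> \<longlonglongrightarrow> 0 \<and>
    (\<forall>n. (LINT x|M. \<bar>u x + v n x\<bar> powr p) \<le> (1 + \<epsilon>) * (LINT x|M. \<bar>v n x\<bar> powr p) + (LINT x|M. \<bar>u x\<bar> powr p) + \<delta> n)"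
proof -
  obtain C where C: "C \<ge> 0" "\<And>x y::real. \<bar>x + y\<bar> powr p \<le> (1 + \<epsilon>) * \<bar>y\<bar> powr p + C * \<bar>x\<bar> powr p"
    using powr_add_le[OF p \<epsilon>] by metis
  \<comment> \<open>The positive part of the excess over the claimed bound. It tends to 0 almost
    everywhere and is dominated by C |u|^p, so its integrals serve as \<delta>.\<close>
  define W where "W n x = max 0 (\<bar>u x + v n x\<bar> powr p - (1 + \<epsilon>) * \<bar>v n x\<bar> powr p - \<bar>u x\<bar> powr p)" for n x
  have [measurable]: "W n \<in> borel_measurable M" for n unfolding W_def by measurable
  have W0: "0 \<le> W n x" for n x by (simp add: W_def)
  have WC: "W n x \<le> C * \<bar>u x\<bar> powr p" for n x
  proof -
    have "0 \<le> C * \<bar>u x\<bar> powr p" using C(1) by simp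
    then show ?thesis using C(2)[of "u x" "v n x"] powr_ge_zero[of "\<bar>u x\<bar>" p] unfolding W_def by linarith
  qed
  have dom: "integrable M (\<lambda>x. C * \<bar>u x\<bar> powr p)" using int by simp
  have Wint: "integrable M (W n)" for n
    by (rule Bochner_Integration.integrable_bound[OF dom]) (use W0 WC C in \<open>auto intro!: AE_I2\<close>)
  have "(\<lambda>n. LINT x|M. W n x) \<longlonglongrightarrow> (LINT x|M. 0)"
  proof (rule integral_dominated_convergence[OF _ _ dom])
    show "AE x in M. (\<lambda>n. W n x) \<longlonglongrightarrow> 0"
      using lim
    proof eventually_elim
      case (elim x)
      have "(\<lambda>n. W n x) \<longlonglongrightarrow> max 0 (\<bar>u x + 0\<bar> powr p - (1 + \<epsilon>) * \<bar>0\<bar> powr p - \<bar>u x\<bar> powr p)"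
        unfolding W_def using p by (intro tendsto_intros tendsto_powr' elim) auto
      then show ?case by simp
    qed
    show "AE x in M. norm (W n x) \<le> C * \<bar>u x\<bar> powr p" for n using W0 WC by auto
  qed auto
  then have lim0: "(\<lambda>n. LINT x|M. W n x) \<longlonglongrightarrow> 0" by simp
  have "(LINT x|M. \<bar>u x + v n x\<bar> powr p) \<le>
      (1 + \<epsilon>) * (LINT x|M. \<bar>v n x\<bar> powr p) + (LINT x|M. \<bar>u x\<bar> powr p) + (LINT x|M. W n x)" for n
  proof -
    have "(LINT x|M. \<bar>u x + v n x\<bar> powr p) \<le> (LINT x|M. (1 + \<epsilon>) * \<bar>v n x\<bar> powr p + \<bar>u x\<bar> powr p + W n x)"
    proof (rule integral_mono)
      show "integrable M (\<lambda>x. \<bar>u x + v n x\<bar> powr p)" by (rule integrable_powr_add) (use p int in auto)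
      show "integrable M (\<lambda>x. (1 + \<epsilon>) * \<bar>v n x\<bar> powr p + \<bar>u x\<bar> powr p + W n x)" using int Wint by auto
    qed (simp add: W_def)
    also have "\<dots> = (1 + \<epsilon>) * (LINT x|M. \<bar>v n x\<bar> powr p) + (LINT x|M. \<bar>u x\<bar> powr p) + (LINT x|M. W n x)"
      using int Wint by simp
    finally show ?thesis .
  qed
  with lim0 show ?thesis by blast
qed

text \<open>Mean value theorem on [-L, L], where the derivative is at most p L^(p - 1) in absolute
  value.\<close>

lemma abs_powr_lipschitz:
  fixes x y :: real
  assumes "p > 1" "\<bar>x\<bar> \<le> L" "\<bar>y\<bar> \<le> L"
  shows "\<bar>\<bar>x\<bar> powr p - \<bar>y\<bar> powr p\<bar> \<le> p * L powr (p - 1) * \<bar>x - y\<bar>"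
proof -
  have "norm (\<bar>x\<bar> powr p - \<bar>y\<bar> powr p) \<le> p * L powr (p - 1) * norm (x - y)"
  proof (rule field_differentiable_bound[of "{-L..L}" "\<lambda>t. \<bar>t\<bar> powr p" "\<lambda>t. p * (\<bar>t\<bar> powr (p - 2) * t)"])
    fix t assume t: "t \<in> {-L..L}"
    show "((\<lambda>t. \<bar>t\<bar> powr p) has_real_derivative p * (\<bar>t\<bar> powr (p - 2) * t)) (at t within {-L..L})"
      by (rule has_field_derivative_at_within[OF abs_powr_DERIV[OF assms(1)]])
    have "\<bar>t\<bar> powr (p - 2) * \<bar>t\<bar> = \<bar>t\<bar> powr (p - 1)" using powr_add[of "\<bar>t\<bar>" "p - 2" 1] by simp
    moreover have "\<bar>t\<bar> powr (p - 1) \<le> L powr (p - 1)" using t assms by (intro powr_mono2) auto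
    ultimately show "norm (p * (\<bar>t\<bar> powr (p - 2) * t)) \<le> p * L powr (p - 1)"
      using assms by (simp add: abs_mult)
  qed (use assms in auto)
  then show ?thesis by simp
qed

text \<open>Dominated convergence for the difference quotients along an arbitrary null sequence of
  parameters; the local Lipschitz bound for the power supplies the dominating function.\<close>

lemma integral_powr_DERIV:
  fixes v z :: "'a \<Rightarrow> real"
  assumes p: "p > 1" and [measurable]: "v \<in> borel_measurable M" "z \<in> borel_measurable M"
    and int: "integrable M (\<lambda>x. \<bar>v x\<bar> powr p)" "integrable M (\<lambda>x. \<bar>z x\<bar> powr p)"
  shows "((\<lambda>t. LINT x|M. \<bar>v x + t * z x\<bar> powr p) has_real_derivative
    p * (LINT x|M. \<bar>v x\<bar> powr (p - 2) * v x * z x)) (at 0)"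
proof -
  have scaled: "integrable M (\<lambda>x. \<bar>t * z x\<bar> powr p)" for t
    using int(2) by (simp add: abs_mult powr_mult)
  have pint: "integrable M (\<lambda>x. \<bar>v x + t * z x\<bar> powr p)" for t
    by (rule integrable_powr_add) (use p int scaled in auto)
  have "((\<lambda>t. ((LINT x|M. \<bar>v x + t * z x\<bar> powr p) - (LINT x|M. \<bar>v x + 0 * z x\<bar> powr p)) / (t - 0)) \<longlongrightarrow>
      (LINT x|M. p * (\<bar>v x\<bar> powr (p - 2) * v x) * z x)) (at 0)"
    unfolding tendsto_at_iff_sequentially
  proof (intro allI impI)
    fix X :: "nat \<Rightarrow> real" assume X: "\<forall>i. X i \<in> UNIV - {0}" "X \<longlonglongrightarrow> 0"
    obtain T0 where T0: "\<And>i. \<bar>X i\<bar> \<le> T0"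
      using convergent_imp_Bseq[of X] X(2) by (auto simp: convergent_def Bseq_def)
    \<comment> \<open>T bounds the parameters, so that |v + X i z| \<le> |v| + T |z|. With T \<ge> 1
      also |z| \<le> |v| + T |z|, which turns the Lipschitz bound into the p-th power w.\<close>
    define T where "T = max 1 T0"
    have T: "T \<ge> 1" "\<And>i. \<bar>X i\<bar> \<le> T" using T0 by (auto simp: T_def le_max_iff_disj)
    define w where "w x = p * \<bar>\<bar>v x\<bar> + T * \<bar>z x\<bar>\<bar> powr p" for x
    have wint: "integrable M w"
    proof -
      have "integrable M (\<lambda>x. \<bar>\<bar>v x\<bar> + T * \<bar>z x\<bar>\<bar> powr p)"
        by (rule integrable_powr_add) (use p int scaled[of T] in \<open>auto simp: abs_mult\<close>)
      then show ?thesis by (simp add: w_def[abs_def])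
    qed
    have "(\<lambda>i. LINT x|M. (\<bar>v x + X i * z x\<bar> powr p - \<bar>v x + 0 * z x\<bar> powr p) / X i) \<longlonglongrightarrow>
        (LINT x|M. p * (\<bar>v x\<bar> powr (p - 2) * v x) * z x)"
    proof (rule integral_dominated_convergence[OF _ _ wint])
      show "AE x in M. (\<lambda>i. (\<bar>v x + X i * z x\<bar> powr p - \<bar>v x + 0 * z x\<bar> powr p) / X i) \<longlonglongrightarrow>
          p * (\<bar>v x\<bar> powr (p - 2) * v x) * z x"
      proof (rule AE_I2)
        fix x
        have "((\<lambda>t. v x + t * z x) has_real_derivative z x) (at 0)" by (auto intro!: derivative_eq_intros)
        from DERIV_chain2[OF abs_powr_DERIV[OF p] this]
        have "((\<lambda>t. \<bar>v x + t * z x\<bar> powr p) has_real_derivative p * (\<bar>v x\<bar> powr (p - 2) * v x) * z x) (at 0)" by simp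
        then have "((\<lambda>t. (\<bar>v x + t * z x\<bar> powr p - \<bar>v x + 0 * z x\<bar> powr p) / (t - 0)) \<longlongrightarrow>
            p * (\<bar>v x\<bar> powr (p - 2) * v x) * z x) (at 0)"
          unfolding has_field_derivative_iff .
        from this[unfolded tendsto_at_iff_sequentially, rule_format, of X] X
        show "(\<lambda>i. (\<bar>v x + X i * z x\<bar> powr p - \<bar>v x + 0 * z x\<bar> powr p) / X i) \<longlonglongrightarrow>
          p * (\<bar>v x\<bar> powr (p - 2) * v x) * z x"
          by (simp add: o_def)
      qed
      fix i
      show "AE x in M. norm ((\<bar>v x + X i * z x\<bar> powr p - \<bar>v x + 0 * z x\<bar> powr p) / X i) \<le> w x"
      proof (rule AE_I2)
        fix x
        define L where "L = \<bar>v x\<bar> + T * \<bar>z x\<bar>"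
        have L0: "L \<ge> 0" using T by (simp add: L_def)
        have zL: "\<bar>z x\<bar> \<le> L" using T(1) mult_right_mono[of 1 T "\<bar>z x\<bar>"] unfolding L_def by simp
        have "\<bar>X i * z x\<bar> \<le> T * \<bar>z x\<bar>" unfolding abs_mult using T by (intro mult_right_mono) auto
        then have "\<bar>v x + X i * z x\<bar> \<le> L" "\<bar>v x\<bar> \<le> L" using T by (auto simp: L_def)
        from abs_powr_lipschitz[OF p this]
        have "\<bar>\<bar>v x + X i * z x\<bar> powr p - \<bar>v x\<bar> powr p\<bar> \<le> p * L powr (p - 1) * (\<bar>X i\<bar> * \<bar>z x\<bar>)"
          by (simp add: abs_mult)
        then have "norm ((\<bar>v x + X i * z x\<bar> powr p - \<bar>v x + 0 * z x\<bar> powr p) / X i) \<le> p * L powr (p - 1) * \<bar>z x\<bar>"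
          using X(1) by (simp add: abs_divide pos_divide_le_eq mult_ac)
        also have "\<dots> \<le> p * L powr (p - 1) * L" using zL p by (intro mult_left_mono) auto
        also have "\<dots> = w x" using powr_add[of L "p - 1" 1] L0 by (simp add: w_def L_def)
        finally show "norm ((\<bar>v x + X i * z x\<bar> powr p - \<bar>v x + 0 * z x\<bar> powr p) / X i) \<le> w x" .
      qed
    qed measurable
    then show "((\<lambda>t. ((LINT x|M. \<bar>v x + t * z x\<bar> powr p) - (LINT x|M. \<bar>v x + 0 * z x\<bar> powr p)) / (t - 0)) \<circ> X) \<longlonglongrightarrow>
      (LINT x|M. p * (\<bar>v x\<bar> powr (p - 2) * v x) * z x)"
      using pint pint[of 0] by (simp add: o_def)
  qed
  moreover have "(LINT x|M. p * (\<bar>v x\<bar> powr (p - 2) * v x) * z x) = p * (LINT x|M. \<bar>v x\<bar> powr (p - 2) * v x * z x)"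
    by (simp add: mult.assoc)
  ultimately show ?thesis unfolding has_field_derivative_iff by simp
qed

text \<open>G is the point where A g^\<alpha> and \<beta> g^2 balance: beyond it the square wins
  since \<alpha> < 2, below it the power is at most its value at G.\<close>

lemma powr_le_square_plus_const:
  fixes A \<beta> \<alpha> :: real
  assumes "A \<ge> 0" "\<beta> > 0" "0 < \<alpha>" "\<alpha> < 2"
  obtains C where "C \<ge> 0" "\<And>g. g \<ge> 0 \<Longrightarrow> A * g powr \<alpha> \<le> \<beta> * g\<^sup>2 + C"
proof -
  define G where "G = (A / \<beta>) powr (1 / (2 - \<alpha>))"
  have "A * g powr \<alpha> \<le> \<beta> * g\<^sup>2 + A * G powr \<alpha>" if g: "g \<ge> 0" for g
  proof (cases "g \<le> G")
    case True
    then have "A * g powr \<alpha> \<le> A * G powr \<alpha>" using assms g by (intro mult_left_mono powr_mono2) auto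
    then show ?thesis using assms by (simp add: add_increasing)
  next
    case False
    then have "G powr (2 - \<alpha>) \<le> g powr (2 - \<alpha>)" using assms by (intro powr_mono2) (auto simp: G_def)
    moreover have "G powr (2 - \<alpha>) = A / \<beta>" using assms by (simp add: G_def powr_powr)
    ultimately have "A \<le> \<beta> * g powr (2 - \<alpha>)" using assms by (simp add: field_simps)
    then have "A * g powr \<alpha> \<le> \<beta> * g powr (2 - \<alpha>) * g powr \<alpha>" by (rule mult_right_mono) simp
    also have "\<dots> = \<beta> * g\<^sup>2" using g by (simp add: mult.assoc powr_add[symmetric])
    finally show ?thesis using assms by (simp add: add_increasing2)
  qed
  then show ?thesis using assms by (intro that[of "A * G powr \<alpha>"]) auto
qed

text \<open>With \<open>q = 2 / (N - 2)\<close>, the hypothesis of the theorem says that \<open>a + b s > S powr (- N / (N - 2)) s powr q\<close> for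
  all \<open>s\<close> (weighted AM-GM with weights \<open>1 - q\<close> and \<open>q\<close>). What the energy needs is the integrated form of this, which
  follows from AM-GM applied to \<open>a + b s / 2\<close> and from \<open>2 powr q \<le> 1 + q\<close>.\<close>

lemma energy_threshold:
  fixes a b S :: real
  assumes N: "N \<ge> 5" and "a \<ge> 0" "b > 0" "S > 0" "s \<ge> 0"
    and cond: "a ^ (N - 4) * b\<^sup>2 > 4 * real (N - 4) ^ (N - 4) / real (N - 2) ^ (N - 2) * S powi (- int N)"
  shows "S powr (- (crit_exp N / 2)) * s powr (crit_exp N / 2) / crit_exp N \<le> a / 2 * s + b / 4 * s\<^sup>2"
proof (cases "s = 0")
  case False
  then have s: "s > 0" using assms by simp
  define n where "n = real N"
  define q where "q = 2 / (n - 2)"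
  have n: "n \<ge> 5" using N by (simp add: n_def)
  have nat: "real (N - 4) = n - 4" "real (N - 2) = n - 2" using N by (simp_all add: n_def of_nat_diff)
  have q: "0 < q" "q < 1" "1 - q = (n - 4) / (n - 2)" using n by (auto simp: q_def field_simps)
  have p: "crit_exp N / 2 = q + 1" "crit_exp N = 2 * (q + 1)" using n by (auto simp: crit_exp_def q_def n_def field_simps)
  have "0 < 4 * real (N - 4) ^ (N - 4) / real (N - 2) ^ (N - 2) * S powi (- int N)"
    using n \<open>S > 0\<close> unfolding nat by (intro mult_pos_pos divide_pos_pos zero_less_power) auto
  then have "0 < a ^ (N - 4) * b\<^sup>2" using cond by linarith
  \<comment> \<open>The right-hand side of \<open>cond\<close> is positive and N - 4 \<ge> 1, so a =
    0 is impossible; the real powers of a below rely on this.\<close>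
  then have a: "a > 0" using \<open>a \<ge> 0\<close> N by (cases "a = 0") (auto simp: power_0_left)
  \<comment> \<open>X^(1/(n - 2)) is the constant (a/(1 - q))^(1 - q) (b/q)^q of the weighted mean
    inequality, because 1 - q = (n - 4)/(n - 2) and q = 2/(n - 2). After clearing factors the
    hypothesis reads S^(-N) < X.\<close>
  define X where "X = (a * (n - 2) / (n - 4)) ^ (N - 4) * (b * (n - 2) / 2)\<^sup>2"
  have X0: "X > 0" using a \<open>b > 0\<close> n by (simp add: X_def)
  have "S powi (- int N) < X"
  proof -
    have e: "N - 2 = (N - 4) + 2" using N by simp
    have pos: "(n - 2) ^ (N - 2) > 0" "(n - 4) ^ (N - 4) > 0" using n by auto
    have "X = a ^ (N - 4) * b\<^sup>2 * ((n - 2) ^ (N - 2) / (4 * (n - 4) ^ (N - 4)))"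
      by (subst e, subst power_add) (simp add: X_def power_divide power_mult_distrib mult_ac)
    also have "\<dots> > 4 * (n - 4) ^ (N - 4) / (n - 2) ^ (N - 2) * S powi (- int N) * ((n - 2) ^ (N - 2) / (4 * (n - 4) ^ (N - 4)))"
      using cond pos unfolding nat by (intro mult_strict_right_mono) auto
    also have "4 * (n - 4) ^ (N - 4) / (n - 2) ^ (N - 2) * S powi (- int N) * ((n - 2) ^ (N - 2) / (4 * (n - 4) ^ (N - 4))) =
        S powi (- int N)"
    proof -
      have "4 * x / y * z * (y / (4 * x)) = z" if "x > 0" "y > 0" for x y z :: real using that by simp
      from this[OF pos(2,1)] show ?thesis .
    qed
    finally show ?thesis .
  qed
  then have "S powr (- n) < X"
    using \<open>S > 0\<close> by (simp add: n_def powr_minus powr_realpow power_int_minus)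
  then have "(S powr (- n)) powr (1 / (n - 2)) \<le> X powr (1 / (n - 2))"
    using n by (intro powr_mono2) auto
  moreover have "(S powr (- n)) powr (1 / (n - 2)) = S powr (- (q + 1))"
  proof -
    have "- n * (1 / (n - 2)) = - (q + 1)" using n by (simp add: q_def field_simps)
    then show ?thesis by (simp only: powr_powr)
  qed
  moreover have "X powr (1 / (n - 2)) = (a / (1 - q)) powr (1 - q) * (b / q) powr q"
  proof -
    have "(a / (1 - q)) powr (1 - q) = ((a * (n - 2) / (n - 4)) ^ (N - 4)) powr (1 / (n - 2))"
      using a n nat(1) by (simp add: q(3) powr_realpow[symmetric] powr_powr)
    moreover have "(b / q) powr q = ((b * (n - 2) / 2)\<^sup>2) powr (1 / (n - 2))"
      using \<open>b > 0\<close> n powr_realpow[of "b * (n - 2) / 2" 2] powr_powr[of "b * (n - 2) / 2" 2 "1 / (n - 2)"]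
      by (simp add: q_def)
    ultimately show ?thesis using a \<open>b > 0\<close> n unfolding X_def by (subst powr_mult) auto
  qed
  ultimately have K: "S powr (- (q + 1)) \<le> (a / (1 - q)) powr (1 - q) * (b / q) powr q" by simp
  \<comment> \<open>Young's inequality for the numbers 2 and 1 with weights q and 1 - q.\<close>
  have two: "2 powr q \<le> 1 + q"
    using Youngs_inequality_0[of q "1 - q" 2 1] q by simp
  have "S powr (- (q + 1)) * s powr q \<le> (a / (1 - q)) powr (1 - q) * (b / q) powr q * s powr q"
    using K by (rule mult_right_mono) simp
  \<comment> \<open>Halving b s costs the factor 2^q and leads to a + b s / 2, which is 2/s times
    the right-hand side of the claim.\<close>
  also have "\<dots> = 2 powr q * ((a / (1 - q)) powr (1 - q) * (b * s / (2 * q)) powr q)"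
    using s q \<open>b > 0\<close> by (simp add: powr_mult powr_divide)
  also have "\<dots> \<le> 2 powr q * ((1 - q) * (a / (1 - q)) + q * (b * s / (2 * q)))"
  proof -
    have "a / (1 - q) > 0" "b * s / (2 * q) > 0" using a s q(1,2) \<open>b > 0\<close> by simp_all
    then show ?thesis using q(1,2) by (intro mult_left_mono Youngs_inequality_0) auto
  qed
  also have "\<dots> = 2 powr q * (a + b * s / 2)" using q(1,2) by simp
  also have "\<dots> \<le> (1 + q) * (a + b * s / 2)"
    using two a s \<open>b > 0\<close> by (intro mult_right_mono) auto
  finally have "S powr (- (q + 1)) * s powr q * s \<le> (1 + q) * (a + b * s / 2) * s"
    using s by (intro mult_right_mono) auto
  then have "S powr (- (q + 1)) * s powr (q + 1) \<le> (1 + q) * (a + b * s / 2) * s"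
    using s by (simp add: powr_add mult.assoc)
  also have "\<dots> = (a / 2 * s + b / 4 * s\<^sup>2) * (2 * (q + 1))" by (simp add: field_simps power2_eq_square)
  finally have "S powr (- (q + 1)) * s powr (q + 1) / (2 * (q + 1)) \<le> a / 2 * s + b / 4 * s\<^sup>2"
    using q(1) by (subst pos_divide_le_eq) simp_all
  then show ?thesis unfolding p(1) unfolding p(2) .
qed simp

section \<open>The energy functional on jets\<close>

definition crit_integral :: "'a::euclidean_space set \<Rightarrow> ('a \<Rightarrow> real \<times> 'a) \<Rightarrow> real" where
  "crit_integral \<Omega> U = (LINT x|lebesgue_on \<Omega>. \<bar>fst (U x)\<bar> powr crit_exp DIM('a))"

definition energy :: "'a::euclidean_space set \<Rightarrow> real \<Rightarrow> real \<Rightarrow> real \<Rightarrow> ('a \<Rightarrow> real \<times> 'a) \<Rightarrow> real" where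
  "energy \<Omega> a b lam U = a / 2 * grad_inner \<Omega> U U + b / 4 * (grad_inner \<Omega> U U)\<^sup>2 - lam / 2 * val_inner \<Omega> U U
    - crit_integral \<Omega> U / crit_exp DIM('a)"

lemma crit_integral_nonneg [simp]: "0 \<le> crit_integral \<Omega> U"
  by (simp add: crit_integral_def)

lemma crit_integral_scale:
  fixes U :: "'a::euclidean_space \<Rightarrow> real \<times> 'a"
  shows "crit_integral \<Omega> (\<lambda>x. c *\<^sub>R U x) = \<bar>c\<bar> powr crit_exp DIM('a) * crit_integral \<Omega> U"
  by (simp add: crit_integral_def abs_mult powr_mult)

context bounded_open
begin

lemma jet_fst_measurable: "U \<in> jet_space \<Omega> \<Longrightarrow> (\<lambda>x. fst (U x)) \<in> borel_measurable (lebesgue_on \<Omega>)"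
  by (rule L2_measurable[OF L2_fst_snd(1)[OF jet_space_L2]])

lemma crit_integral_pos:
  assumes U: "U \<in> jet_space \<Omega>" and N: "DIM('a) > 2" and "\<not> ae_eq \<Omega> (\<lambda>x. fst (U x)) (\<lambda>x. 0)"
  shows "crit_integral \<Omega> U > 0"
proof -
  have "crit_integral \<Omega> U \<noteq> 0"
  proof
    assume "crit_integral \<Omega> U = 0"
    then have "AE x in lebesgue_on \<Omega>. \<bar>fst (U x)\<bar> powr crit_exp DIM('a) = 0"
      using integral_nonneg_eq_0_iff_AE[OF sobolev_inequality(1)[OF U N]] by (simp add: crit_integral_def)
    then have "AE x in lebesgue_on \<Omega>. fst (U x) = 0" by eventually_elim simp
    with assms(3) show False by (simp add: ae_eq_def)
  qed
  then show ?thesis using crit_integral_nonneg[of \<Omega> U] by linarith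
qed

lemma crit_integral_zero:
  assumes "ae_eq \<Omega> (\<lambda>x. fst (U x)) (\<lambda>x. 0)"
  shows "crit_integral \<Omega> U = 0"
  unfolding crit_integral_def
  by (rule integral_eq_zero_AE) (use assms in \<open>auto simp: ae_eq_def elim: eventually_mono\<close>)

text \<open>\<open>sobolev_inequality\<close> bounds every quotient in the infimum below by the
  reciprocal of \<open>sobolev_bound\<close>.\<close>

lemma sobolev_const_pos:
  assumes N: "DIM('a) > 2" and "\<Omega> \<noteq> {}"
  shows "sobolev_const \<Omega> > 0"
proof -
  let ?p = "crit_exp DIM('a)" and ?C = "sobolev_bound DIM('a)"
  have C: "?C > 0" by (rule sobolev_bound_pos[OF N])
  have "1 / ?C \<le> sobolev_const \<Omega>"
    unfolding sobolev_const_def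
  proof (rule cINF_greatest)
    obtain U where U: "U \<in> jet_space \<Omega>" "val_inner \<Omega> U U = 1" using jet_space_nontrivial[OF assms(2)] by metis
    have "\<not> ae_eq \<Omega> (\<lambda>x. fst (U x)) (\<lambda>x. 0)"
      using l2_norm_zero_iff[OF L2_fst_snd(1)[OF jet_space_L2[OF U(1)]]] U(2) by (simp add: val_inner_def l2_norm_def)
    then show "{u \<in> H10 \<Omega>. \<not> ae_eq \<Omega> u (\<lambda>x. 0)} \<noteq> {}" using jet_space_imp_H10(1)[OF U(1)] by blast
    fix u assume "u \<in> {u \<in> H10 \<Omega>. \<not> ae_eq \<Omega> u (\<lambda>x. 0)}"
    then have u: "u \<in> H10 \<Omega>" "\<not> ae_eq \<Omega> u (\<lambda>x. 0)" by auto
    let ?U = "\<lambda>x. (u x, weak_gradient \<Omega> u x)"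
    have J: "?U \<in> jet_space \<Omega>" by (rule H10_imp_jet_space[OF u(1)])
    have P: "(LINT x|lebesgue_on \<Omega>. \<bar>u x\<bar> powr ?p) > 0"
      using crit_integral_pos[OF J N] u(2) by (simp add: crit_integral_def)
    have "(LINT x|lebesgue_on \<Omega>. \<bar>u x\<bar> powr ?p) powr (2 / ?p) \<le> ?C * (LINT x|lebesgue_on \<Omega>. (norm (weak_gradient \<Omega> u x))\<^sup>2)"
      using sobolev_inequality(2)[OF J N] by (simp add: l2_inner_self_eq)
    then show "1 / ?C \<le> (LINT x|lebesgue_on \<Omega>. (norm (weak_gradient \<Omega> u x))\<^sup>2) /
        (LINT x|lebesgue_on \<Omega>. \<bar>u x\<bar> powr ?p) powr (2 / ?p)"
      using C P by (simp add: field_simps)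
  qed
  moreover have "1 / ?C > 0" using C by simp
  ultimately show ?thesis by linarith
qed

text \<open>The sharp constant enters here, through its definition as an infimum. Functions
  vanishing almost everywhere are outside that infimum and are treated apart.\<close>

lemma crit_integral_le:
  assumes N: "DIM('a) > 2" and ne: "\<Omega> \<noteq> {}" and U: "U \<in> jet_space \<Omega>"
  shows "crit_integral \<Omega> U \<le>
    sobolev_const \<Omega> powr (- (crit_exp DIM('a) / 2)) * grad_inner \<Omega> U U powr (crit_exp DIM('a) / 2)"
proof (cases "ae_eq \<Omega> (\<lambda>x. fst (U x)) (\<lambda>x. 0)")
  case True
  then show ?thesis by (simp add: crit_integral_zero)
next
  case False
  let ?p = "crit_exp DIM('a)" and ?u = "\<lambda>x. fst (U x)"
  define S where "S = sobolev_const \<Omega>"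
  define P where "P = crit_integral \<Omega> U"
  have S: "S > 0" unfolding S_def by (rule sobolev_const_pos[OF N ne])
  have P: "P > 0" unfolding P_def by (rule crit_integral_pos[OF U N False])
  have p: "?p > 0" by (rule crit_exp_props(2)[OF N])
  have "S \<le> (LINT x|lebesgue_on \<Omega>. (norm (weak_gradient \<Omega> ?u x))\<^sup>2) / (LINT x|lebesgue_on \<Omega>. \<bar>?u x\<bar> powr ?p) powr (2 / ?p)"
    unfolding S_def sobolev_const_def
  proof (rule cINF_lower)
    show "?u \<in> {u \<in> H10 \<Omega>. \<not> ae_eq \<Omega> u (\<lambda>x. 0)}" using jet_space_imp_H10(1)[OF U] False by simp
    show "bdd_below ((\<lambda>u. (LINT x|lebesgue_on \<Omega>. (norm (weak_gradient \<Omega> u x))\<^sup>2) /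
        (LINT x|lebesgue_on \<Omega>. \<bar>u x\<bar> powr ?p) powr (2 / ?p)) ` {u \<in> H10 \<Omega>. \<not> ae_eq \<Omega> u (\<lambda>x. 0)})"
      by (rule bdd_belowI[of _ 0]) auto
  qed
  then have "S \<le> grad_inner \<Omega> U U / P powr (2 / ?p)"
    unfolding weak_gradient_norm_eq[OF U] by (simp add: P_def crit_integral_def)
  then have "P powr (2 / ?p) \<le> grad_inner \<Omega> U U / S" using S P by (simp add: field_simps)
  then have "(P powr (2 / ?p)) powr (?p / 2) \<le> (grad_inner \<Omega> U U / S) powr (?p / 2)"
    using p by (intro powr_mono2) auto
  moreover have "(P powr (2 / ?p)) powr (?p / 2) = P" using p P by (simp add: powr_powr)
  moreover have "(grad_inner \<Omega> U U / S) powr (?p / 2) = S powr (- (?p / 2)) * grad_inner \<Omega> U U powr (?p / 2)"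
    using S by (simp add: powr_divide powr_minus_divide)
  ultimately show ?thesis unfolding P_def S_def by simp
qed

text \<open>Pointwise t^2 \<le> 1 + |t|^p on a set of finite measure; takes the place of a Poincare
  inequality.\<close>

lemma val_inner_le_crit_integral:
  assumes N: "DIM('a) > 2" and U: "U \<in> jet_space \<Omega>"
  shows "val_inner \<Omega> U U \<le> measure lebesgue \<Omega> + crit_integral \<Omega> U"
proof -
  interpret finite_measure "lebesgue_on \<Omega>" by (rule finite_measure_\<Omega>)
  have p: "crit_exp DIM('a) > 2" by (rule crit_exp_props(1)[OF N])
  have "val_inner \<Omega> U U \<le> (LINT x|lebesgue_on \<Omega>. 1 + \<bar>fst (U x)\<bar> powr crit_exp DIM('a))"
    unfolding val_inner_def l2_inner_def
  proof (rule integral_mono)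
    show "integrable (lebesgue_on \<Omega>) (\<lambda>x. fst (U x) \<bullet> fst (U x))"
      by (rule L2_inner_integrable; rule L2_fst_snd(1)[OF jet_space_L2[OF U]])
    show "integrable (lebesgue_on \<Omega>) (\<lambda>x. 1 + \<bar>fst (U x)\<bar> powr crit_exp DIM('a))"
      using sobolev_inequality(1)[OF U N] by simp
    fix x
    show "fst (U x) \<bullet> fst (U x) \<le> 1 + \<bar>fst (U x)\<bar> powr crit_exp DIM('a)"
    proof (cases "\<bar>fst (U x)\<bar> \<le> 1")
      case True
      then have "(fst (U x))\<^sup>2 \<le> 1" by (simp add: abs_square_le_1)
      then show ?thesis by (simp add: power2_eq_square add_increasing2)
    next
      case False
      then have "\<bar>fst (U x)\<bar> powr 2 \<le> \<bar>fst (U x)\<bar> powr crit_exp DIM('a)" using p by (intro powr_mono) auto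
      moreover have "\<bar>fst (U x)\<bar> powr 2 = fst (U x) \<bullet> fst (U x)" using False by (simp add: power2_eq_square)
      ultimately show ?thesis by simp
    qed
  qed
  also have "\<dots> = measure lebesgue \<Omega> + crit_integral \<Omega> U"
    using sobolev_inequality(1)[OF U N] fmeasurableD[OF lmeasurable_\<Omega>]
    by (simp add: crit_integral_def measure_restrict_space)
  finally show ?thesis .
qed

text \<open>The energy contains b/4 times the square of the squared gradient norm g, while the value
  and critical terms grow at most like g^(p/2) up to a constant; p/2 < 2 is where N \<ge> 5 enters.
  Half of the quartic term is spent on absorbing them.\<close>

lemma energy_coercive:
  assumes N: "DIM('a) \<ge> 5" and ne: "\<Omega> \<noteq> {}" and "a \<ge> 0" "b > 0" "lam \<ge> 0"
  obtains C where "\<And>U. U \<in> jet_space \<Omega> \<Longrightarrow> b / 8 * (grad_inner \<Omega> U U)\<^sup>2 \<le> energy \<Omega> a b lam U + C"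
proof -
  let ?p = "crit_exp DIM('a)"
  define c where "c = sobolev_const \<Omega> powr (- (?p / 2))"
  have N2: "DIM('a) > 2" using N by simp
  have p: "?p > 2" "?p / 2 < 2" using N crit_exp_props(1)[OF N2] by (auto simp: crit_exp_def field_simps)
  define A where "A = (lam / 2 + 1 / ?p) * c"
  have "A \<ge> 0" using assms p by (simp add: A_def c_def)
  then obtain C where C: "C \<ge> 0" "\<And>g. g \<ge> 0 \<Longrightarrow> A * g powr (?p / 2) \<le> b / 8 * g\<^sup>2 + C"
    using powr_le_square_plus_const[of A "b / 8" "?p / 2"] assms p by auto
  have "b / 8 * (grad_inner \<Omega> U U)\<^sup>2 \<le> energy \<Omega> a b lam U + (C + lam / 2 * measure lebesgue \<Omega>)" if U: "U \<in> jet_space \<Omega>" for U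
  proof -
    define g where "g = grad_inner \<Omega> U U"
    have g: "g \<ge> 0" by (simp add: g_def)
    have P: "crit_integral \<Omega> U \<le> c * g powr (?p / 2)" unfolding c_def g_def by (rule crit_integral_le[OF N2 ne U])
    have "lam / 2 * val_inner \<Omega> U U \<le> lam / 2 * (measure lebesgue \<Omega> + crit_integral \<Omega> U)"
      using val_inner_le_crit_integral[OF N2 U] assms by (intro mult_left_mono) auto
    then have "lam / 2 * val_inner \<Omega> U U + crit_integral \<Omega> U / ?p \<le> lam / 2 * measure lebesgue \<Omega> + (lam / 2 + 1 / ?p) * crit_integral \<Omega> U"
      by (simp add: algebra_simps)
    also have "(lam / 2 + 1 / ?p) * crit_integral \<Omega> U \<le> (lam / 2 + 1 / ?p) * (c * g powr (?p / 2))"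
      using P assms p by (intro mult_left_mono) auto
    also have "\<dots> \<le> b / 8 * g\<^sup>2 + C" using C(2)[OF g] by (simp add: A_def mult.assoc)
    finally have "lam / 2 * val_inner \<Omega> U U + crit_integral \<Omega> U / ?p \<le> lam / 2 * measure lebesgue \<Omega> + (b / 8 * g\<^sup>2 + C)" by simp
    moreover have "0 \<le> a / 2 * g" using g assms by simp
    ultimately show ?thesis unfolding energy_def g_def[symmetric] by (simp add: field_simps)
  qed
  then show ?thesis by (rule that)
qed

lemma energy_minimizer:
  assumes N: "DIM('a) \<ge> 5" and ne: "\<Omega> \<noteq> {}" and ab: "a \<ge> 0" "b > 0" "lam \<ge> 0"
    and thr: "\<And>s. s \<ge> 0 \<Longrightarrow> sobolev_const \<Omega> powr (- (crit_exp DIM('a) / 2)) * s powr (crit_exp DIM('a) / 2) / crit_exp DIM('a)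
      \<le> a / 2 * s + b / 4 * s\<^sup>2"
  obtains V where "V \<in> jet_space \<Omega>" "\<And>U. U \<in> jet_space \<Omega> \<Longrightarrow> energy \<Omega> a b lam V \<le> energy \<Omega> a b lam U"
proof -
  let ?p = "crit_exp DIM('a)" and ?E = "energy \<Omega> a b lam"
  define c where "c = sobolev_const \<Omega> powr (- (?p / 2))"
  have N2: "DIM('a) > 2" using N by simp
  have p: "?p > 2" "?p > 0" using crit_exp_props(1,2)[OF N2] by auto
  have c0: "c \<ge> 0" by (simp add: c_def)
  obtain C where C: "\<And>U. U \<in> jet_space \<Omega> \<Longrightarrow> b / 8 * (grad_inner \<Omega> U U)\<^sup>2 \<le> ?E U + C"
    using energy_coercive[OF N ne ab] by metis
  define m where "m = Inf (?E ` jet_space \<Omega>)"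
  have nonempty: "?E ` jet_space \<Omega> \<noteq> {}" using jet_space_nontrivial[OF ne] by blast
  have bdd: "bdd_below (?E ` jet_space \<Omega>)"
  proof (rule bdd_belowI2[of _ "- C"])
    fix U assume "U \<in> jet_space \<Omega>"
    from C[OF this] have "0 \<le> ?E U + C" using ab by (intro order_trans[OF _ C[OF \<open>U \<in> jet_space \<Omega>\<close>]]) simp
    then show "- C \<le> ?E U" by simp
  qed
  have m_le: "m \<le> ?E U" if "U \<in> jet_space \<Omega>" for U unfolding m_def using that by (intro cInf_lower[OF _ bdd]) auto
  have "\<exists>U. U \<in> jet_space \<Omega> \<and> ?E U < m + inverse (real (Suc n))" for n
  proof -
    have "Inf (?E ` jet_space \<Omega>) < m + inverse (real (Suc n))" by (simp add: m_def)
    from cInf_lessD[OF nonempty this] show ?thesis by blast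
  qed
  then obtain U where U: "\<And>n. U n \<in> jet_space \<Omega>" "\<And>n. ?E (U n) < m + inverse (real (Suc n))" by metis
  \<comment> \<open>K solves b/8 K^2 = m + 1 + C: the energies in the sequence are at most m + 1,
    and coercivity bounds the gradients.\<close>
  define K where "K = sqrt (8 / b * (m + 1 + C))"
  have gK: "grad_inner \<Omega> (U n) (U n) \<le> K" for n
  proof -
    have "inverse (real (Suc n)) \<le> 1" by (simp add: field_simps)
    then have "b / 8 * (grad_inner \<Omega> (U n) (U n))\<^sup>2 \<le> m + 1 + C" using C[OF U(1)[of n]] U(2)[of n] by linarith
    then have "(grad_inner \<Omega> (U n) (U n))\<^sup>2 \<le> 8 / b * (m + 1 + C)" using ab by (simp add: field_simps)
    then show ?thesis unfolding K_def by (rule real_le_rsqrt)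
  qed
  have K0: "K \<ge> 0" using gK[of 0] grad_inner_nonneg order_trans by blast
  have nK: "l2_norm \<Omega> (U n) \<le> sqrt (measure lebesgue \<Omega> + c * K powr (?p / 2) + K)" for n
  proof -
    have "crit_integral \<Omega> (U n) \<le> c * grad_inner \<Omega> (U n) (U n) powr (?p / 2)"
      unfolding c_def by (rule crit_integral_le[OF N2 ne U(1)])
    also have "\<dots> \<le> c * K powr (?p / 2)" using c0 p gK by (intro mult_left_mono powr_mono2) auto
    finally have "val_inner \<Omega> (U n) (U n) \<le> measure lebesgue \<Omega> + c * K powr (?p / 2)"
      using val_inner_le_crit_integral[OF N2 U(1)[of n]] by linarith
    then show ?thesis unfolding l2_norm_def l2_inner_jets[OF jet_space_L2[OF U(1)]] using gK[of n] by simp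
  qed
  obtain r :: "nat \<Rightarrow> nat" and u where r: "strict_mono r" "u \<in> L2_space \<Omega>"
    "(\<lambda>n. l2_norm \<Omega> (\<lambda>x. fst (U (r n) x) - u x)) \<longlonglongrightarrow> 0" by (rule rellich[OF U(1) nK])
  \<comment> \<open>Rellich yields a limit of the values in L2 only; that it is the value component
    of a jet has to be supplied.\<close>
  obtain V where V: "V \<in> jet_space \<Omega>" "(\<lambda>n. l2_norm \<Omega> (\<lambda>x. fst (U (r n) x) - fst (V x))) \<longlonglongrightarrow> 0"
    by (rule jet_space_L2_limit[of "\<lambda>n. U (r n)" K u, OF U(1) gK r(2,3)])
  have fL2: "(\<lambda>x. fst (Y x)) \<in> L2_space \<Omega>" if "Y \<in> jet_space \<Omega>" for Y by (rule L2_fst_snd(1)[OF jet_space_L2[OF that]])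
  obtain r2 :: "nat \<Rightarrow> nat" where r2: "strict_mono r2"
    "AE x in lebesgue_on \<Omega>. (\<lambda>n. fst (U (r (r2 n)) x)) \<longlonglongrightarrow> fst (V x)"
    by (rule L2_AE_subseq[OF lmeasurable_\<Omega> fL2[OF U(1)] fL2[OF V(1)] V(2)])
  define X0 where "X0 n x = U (r (r2 n)) x - V x" for n x
  have X0J: "X0 n \<in> jet_space \<Omega>" for n unfolding X0_def[abs_def] by (rule jet_space_diff[OF U(1) V(1)])
  have X0K: "grad_inner \<Omega> (X0 n) (X0 n) \<le> 2 * K + 2 * grad_inner \<Omega> V V" for n
    unfolding X0_def[abs_def] grad_inner_parallelogram[OF jet_space_L2[OF U(1)] jet_space_L2[OF V(1)]]
    using gK[of "r (r2 n)"] grad_inner_nonneg[of \<Omega> "\<lambda>x. U (r (r2 n)) x + V x"] by argo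
  \<comment> \<open>A further subsequence lets the squared gradient norms of the remainders
    converge; their limit s measures the loss of compactness.\<close>
  have "bounded (range (\<lambda>n. grad_inner \<Omega> (X0 n) (X0 n)))"
    unfolding bounded_iff using X0K by (intro exI[of _ "2 * K + 2 * grad_inner \<Omega> V V"]) auto
  from bounded_imp_convergent_subsequence[OF this] obtain s r3 where r3: "strict_mono r3"
    "((\<lambda>n. grad_inner \<Omega> (X0 n) (X0 n)) \<circ> r3) \<longlonglongrightarrow> s" by blast
  define T where "T n = U (r (r2 (r3 n)))" for n
  define X where "X n = X0 (r3 n)" for n
  have TJ: "T n \<in> jet_space \<Omega>" and XJ: "X n \<in> jet_space \<Omega>" for n unfolding T_def X_def by (rule U(1), rule X0J)
  have TX: "T n = (\<lambda>x. X n x + 1 *\<^sub>R V x)" for n by (simp add: T_def X_def X0_def[abs_def])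
  have Xs: "(\<lambda>n. grad_inner \<Omega> (X n) (X n)) \<longlonglongrightarrow> s" using r3(2) by (simp add: X_def o_def)
  have s0: "s \<ge> 0" by (rule LIMSEQ_le_const[OF Xs]) auto
  have "(\<lambda>n. l2_norm \<Omega> (\<lambda>x. fst (T n x) - fst (V x))) \<longlonglongrightarrow> 0"
    using LIMSEQ_subseq_LIMSEQ[OF V(2) strict_mono_o[OF r2(1) r3(1)]] by (simp add: T_def o_def)
  note Tval = this
  then have Xval: "(\<lambda>n. l2_norm \<Omega> (\<lambda>x. fst (X n x))) \<longlonglongrightarrow> 0" by (simp add: X_def X0_def T_def)
  have Xae: "AE x in lebesgue_on \<Omega>. (\<lambda>n. fst (X n x)) \<longlonglongrightarrow> 0"
    using r2(2)
  proof eventually_elim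
    case (elim x)
    have "(\<lambda>n. fst (U (r (r2 (r3 n))) x)) \<longlonglongrightarrow> fst (V x)"
      using LIMSEQ_subseq_LIMSEQ[OF elim r3(1)] by (simp add: o_def)
    from tendsto_diff[OF this tendsto_const[of "fst (V x)"]]
    have "(\<lambda>n. fst (U (r (r2 (r3 n))) x) - fst (V x)) \<longlonglongrightarrow> fst (V x) - fst (V x)" .
    then show ?case by (simp add: X_def X0_def)
  qed
  \<comment> \<open>The remainders have bounded gradients and values tending to 0, so the cross term
    in the expansion of the gradient norm vanishes and g tends to s + gV.\<close>
  have XV: "(\<lambda>n. grad_inner \<Omega> (X n) V) \<longlonglongrightarrow> 0"
    by (rule grad_inner_weak_convergence[OF XJ _ Xval V(1), where K="2 * K + 2 * grad_inner \<Omega> V V"]) (simp add: X_def X0K)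
  define gV where "gV = grad_inner \<Omega> V V"
  define g where "g n = grad_inner \<Omega> (T n) (T n)" for n
  have "(\<lambda>n. grad_inner \<Omega> (X n) (X n) + 2 * 1 * grad_inner \<Omega> (X n) V + 1\<^sup>2 * gV) \<longlonglongrightarrow> s + 2 * 1 * 0 + 1\<^sup>2 * gV"
    by (intro tendsto_intros Xs XV)
  then have g: "g \<longlonglongrightarrow> s + gV"
    unfolding g_def[abs_def] TX grad_inner_add[OF jet_space_L2[OF XJ] jet_space_L2[OF V(1)]] gV_def[symmetric] by simp
  have val: "(\<lambda>n. val_inner \<Omega> (T n) (T n)) \<longlonglongrightarrow> val_inner \<Omega> V V"
    using tendsto_power[OF l2_norm_tendsto[OF fL2[OF TJ] fL2[OF V(1)] Tval], of 2] by (simp add: val_inner_def l2_norm_square)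
  have ET: "?E (T n) \<le> m + inverse (real (Suc n))" for n
  proof -
    have "n \<le> r (r2 (r3 n))"
      using seq_suble[OF r(1), of "r2 (r3 n)"] seq_suble[OF r2(1), of "r3 n"] seq_suble[OF r3(1), of n] by linarith
    then have "inverse (real (Suc (r (r2 (r3 n))))) \<le> inverse (real (Suc n))" by (simp add: le_imp_inverse_le)
    then show ?thesis using U(2)[of "r (r2 (r3 n))"] unfolding T_def by linarith
  qed
  \<comment> \<open>L would be the limit of the energies if the remainders contributed nothing to
    the critical integral; k bounds that contribution up to the factor 1 + \<epsilon>.\<close>
  define L where "L = a / 2 * (s + gV) + b / 4 * (s + gV)\<^sup>2 - lam / 2 * val_inner \<Omega> V V - crit_integral \<Omega> V / ?p"
  define k where "k = c * s powr (?p / 2) / ?p"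
  have k0: "k \<ge> 0" using c0 p by (simp add: k_def)
  have Lk: "L - (1 + \<epsilon>) * k \<le> m" if \<epsilon>: "\<epsilon> > 0" for \<epsilon>
  proof -
    obtain \<delta> where \<delta>: "\<delta> \<longlonglongrightarrow> 0"
      "\<And>n. (LINT x|lebesgue_on \<Omega>. \<bar>fst (V x) + fst (X n x)\<bar> powr ?p) \<le> (1 + \<epsilon>) * (LINT x|lebesgue_on \<Omega>. \<bar>fst (X n x)\<bar> powr ?p)
        + (LINT x|lebesgue_on \<Omega>. \<bar>fst (V x)\<bar> powr ?p) + \<delta> n"
      using Brezis_Lieb_upper[OF p(2) \<epsilon> jet_fst_measurable[OF V(1)] jet_fst_measurable[OF XJ]
            sobolev_inequality(1)[OF V(1) N2] sobolev_inequality(1)[OF XJ N2] Xae] by blast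
    have P: "crit_integral \<Omega> (T n) \<le> (1 + \<epsilon>) * (c * grad_inner \<Omega> (X n) (X n) powr (?p / 2)) + crit_integral \<Omega> V + \<delta> n" for n
    proof -
      have "crit_integral \<Omega> (T n) \<le> (1 + \<epsilon>) * crit_integral \<Omega> (X n) + crit_integral \<Omega> V + \<delta> n"
        using \<delta>(2)[of n] by (simp add: crit_integral_def TX add.commute)
      also have "crit_integral \<Omega> (X n) \<le> c * grad_inner \<Omega> (X n) (X n) powr (?p / 2)"
        unfolding c_def by (rule crit_integral_le[OF N2 ne XJ])
      finally show ?thesis using \<epsilon> by simp
    qed
    have "a / 2 * (s + gV) + b / 4 * (s + gV)\<^sup>2 - lam / 2 * val_inner \<Omega> V V
        - ((1 + \<epsilon>) * (c * s powr (?p / 2)) + crit_integral \<Omega> V + 0) / ?p \<le> m + 0"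
    proof (rule LIMSEQ_le)
      show "(\<lambda>n. a / 2 * g n + b / 4 * (g n)\<^sup>2 - lam / 2 * val_inner \<Omega> (T n) (T n)
          - ((1 + \<epsilon>) * (c * grad_inner \<Omega> (X n) (X n) powr (?p / 2)) + crit_integral \<Omega> V + \<delta> n) / ?p)
        \<longlonglongrightarrow> a / 2 * (s + gV) + b / 4 * (s + gV)\<^sup>2 - lam / 2 * val_inner \<Omega> V V
        - ((1 + \<epsilon>) * (c * s powr (?p / 2)) + crit_integral \<Omega> V + 0) / ?p"
        using p by (intro tendsto_intros g val \<delta>(1) tendsto_powr' Xs) auto
      show "(\<lambda>n. m + inverse (real (Suc n))) \<longlonglongrightarrow> m + 0" by (intro tendsto_intros LIMSEQ_inverse_real_of_nat)
      have "a / 2 * g n + b / 4 * (g n)\<^sup>2 - lam / 2 * val_inner \<Omega> (T n) (T n)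
          - ((1 + \<epsilon>) * (c * grad_inner \<Omega> (X n) (X n) powr (?p / 2)) + crit_integral \<Omega> V + \<delta> n) / ?p \<le> m + inverse (real (Suc n))" for n
        using ET[of n] divide_right_mono[OF P[of n] less_imp_le[OF p(2)]] unfolding energy_def g_def by argo
      then show "\<exists>N. \<forall>n\<ge>N. a / 2 * g n + b / 4 * (g n)\<^sup>2 - lam / 2 * val_inner \<Omega> (T n) (T n)
          - ((1 + \<epsilon>) * (c * grad_inner \<Omega> (X n) (X n) powr (?p / 2)) + crit_integral \<Omega> V + \<delta> n) / ?p \<le> m + inverse (real (Suc n))"
        by blast
    qed
    then show ?thesis by (simp add: L_def k_def add_divide_distrib)
  qed
  have "L - k \<le> m"
  proof (rule field_le_epsilon)
    fix e :: real assume e: "e > 0"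
    have "e / (k + 1) > 0" using e k0 by (simp add: add_nonneg_pos)
    from Lk[OF this] have "L - k \<le> m + e / (k + 1) * k" by (simp add: algebra_simps)
    also have "e / (k + 1) * k \<le> e" using e k0 by (simp add: field_simps add_nonneg_pos)
    finally show "L - k \<le> m + e" by simp
  qed
  \<comment> \<open>L - k exceeds the energy of V by the threshold gap at s plus the mixed term b/2
    s gV, both nonnegative.\<close>
  moreover have "?E V \<le> L - k"
  proof -
    have "k \<le> a / 2 * s + b / 4 * s\<^sup>2" unfolding k_def c_def by (rule thr[OF s0])
    moreover have "0 \<le> b / 2 * (s * gV)" using ab s0 by (simp add: gV_def)
    moreover have "b / 4 * (s + gV)\<^sup>2 = b / 4 * s\<^sup>2 + b / 2 * (s * gV) + b / 4 * gV\<^sup>2"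
      by (simp add: power2_sum field_simps)
    moreover have "a / 2 * (s + gV) = a / 2 * s + a / 2 * gV" by (simp add: algebra_simps)
    ultimately show ?thesis unfolding L_def energy_def gV_def[symmetric] by linarith
  qed
  ultimately have "?E V \<le> m" by simp
  then show ?thesis using that[OF V(1)] m_le order_trans by blast
qed

text \<open>The energy of V + t Z is minimal at t = 0. Its gradient and value parts are built from
  quadratics in t, and \<open>integral_powr_DERIV\<close> differentiates the critical part.\<close>

lemma energy_Euler_Lagrange:
  assumes N: "DIM('a) > 2" and V: "V \<in> jet_space \<Omega>"
    and min: "\<And>U. U \<in> jet_space \<Omega> \<Longrightarrow> energy \<Omega> a b lam V \<le> energy \<Omega> a b lam U" and Z: "Z \<in> jet_space \<Omega>"
  shows "(a + b * grad_inner \<Omega> V V) * grad_inner \<Omega> V Z = lam * val_inner \<Omega> V Z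
    + (LINT x|lebesgue_on \<Omega>. \<bar>fst (V x)\<bar> powr (crit_exp DIM('a) - 2) * fst (V x) * fst (Z x))"
proof -
  let ?p = "crit_exp DIM('a)"
  define J where "J = (LINT x|lebesgue_on \<Omega>. \<bar>fst (V x)\<bar> powr (?p - 2) * fst (V x) * fst (Z x))"
  have p: "?p > 1" "?p > 0" using crit_exp_props(1)[OF N] by auto
  define f where "f t = energy \<Omega> a b lam (\<lambda>x. V x + t *\<^sub>R Z x)" for t
  define G where "G t = grad_inner \<Omega> V V + 2 * t * grad_inner \<Omega> V Z + t\<^sup>2 * grad_inner \<Omega> Z Z" for t
  define M where "M t = val_inner \<Omega> V V + 2 * t * val_inner \<Omega> V Z + t\<^sup>2 * val_inner \<Omega> Z Z" for t
  define P where "P t = (LINT x|lebesgue_on \<Omega>. \<bar>fst (V x) + t * fst (Z x)\<bar> powr ?p)" for t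
  have f: "f t = a / 2 * G t + b / 4 * (G t)\<^sup>2 - lam / 2 * M t - P t / ?p" for t
    unfolding f_def energy_def grad_inner_add[OF jet_space_L2[OF V] jet_space_L2[OF Z]]
      val_inner_add[OF jet_space_L2[OF V] jet_space_L2[OF Z]] G_def M_def P_def crit_integral_def by simp
  have "(P has_real_derivative ?p * J) (at 0)"
    unfolding P_def[abs_def] J_def
    by (rule integral_powr_DERIV[OF p(1) jet_fst_measurable[OF V] jet_fst_measurable[OF Z]
          sobolev_inequality(1)[OF V N] sobolev_inequality(1)[OF Z N]])
  moreover have "(G has_real_derivative 2 * grad_inner \<Omega> V Z) (at 0)"
    unfolding G_def[abs_def] by (auto intro!: derivative_eq_intros)
  moreover have "(M has_real_derivative 2 * val_inner \<Omega> V Z) (at 0)"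
    unfolding M_def[abs_def] by (auto intro!: derivative_eq_intros)
  ultimately have "(f has_real_derivative
      (a / 2 * (2 * grad_inner \<Omega> V Z) + b / 4 * (2 * G 0 * (2 * grad_inner \<Omega> V Z)) - lam / 2 * (2 * val_inner \<Omega> V Z) - ?p * J / ?p)) (at 0)"
    unfolding f[abs_def] by (auto intro!: derivative_eq_intros)
  moreover have "f 0 \<le> f t" for t
    unfolding f_def using min[OF jet_space_add[OF V jet_space_scale[OF Z]]] by simp
  ultimately have "a / 2 * (2 * grad_inner \<Omega> V Z) + b / 4 * (2 * G 0 * (2 * grad_inner \<Omega> V Z))
      - lam / 2 * (2 * val_inner \<Omega> V Z) - ?p * J / ?p = 0"
    by (intro DERIV_local_min[where f=f and x=0 and d=1]) auto
  then show ?thesis unfolding J_def[symmetric] using p by (simp add: G_def algebra_simps)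
qed

lemma energy_minimizer_weak_solution:
  assumes N: "DIM('a) > 2" and V: "V \<in> jet_space \<Omega>"
    and min: "\<And>U. U \<in> jet_space \<Omega> \<Longrightarrow> energy \<Omega> a b lam V \<le> energy \<Omega> a b lam U"
  shows "weak_solution \<Omega> a b lam (\<lambda>x. fst (V x))"
  unfolding weak_solution_def
proof (intro conjI ballI jet_space_imp_H10(1)[OF V])
  fix v assume v: "v \<in> H10 \<Omega>"
  show "(a + b * (LINT x|lebesgue_on \<Omega>. (norm (weak_gradient \<Omega> (\<lambda>x. fst (V x)) x))\<^sup>2)) * dirichlet_form \<Omega> (\<lambda>x. fst (V x)) v =
      lam * (LINT x|lebesgue_on \<Omega>. fst (V x) * v x) +
      (LINT x|lebesgue_on \<Omega>. \<bar>fst (V x)\<bar> powr (crit_exp DIM('a) - 2) * fst (V x) * v x)"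
    using energy_Euler_Lagrange[OF N V min H10_imp_jet_space[OF v]]
    by (simp add: weak_gradient_norm_eq[OF V] dirichlet_form_eq[OF V v] val_inner_def l2_inner_def)
qed

text \<open>On multiples t V of the first eigenfunction the quadratic terms add up to a nonpositive
  number, zero in the resonant case of equality; the critical term then has to beat the quartic one,
  which it does for small t.\<close>

lemma energy_negative:
  assumes N: "DIM('a) \<ge> 5" and ne: "\<Omega> \<noteq> {}" and "lam \<ge> a * first_eigenvalue \<Omega>"
  obtains U where "U \<in> jet_space \<Omega>" "energy \<Omega> a b lam U < 0"
proof -
  let ?p = "crit_exp DIM('a)"
  have N2: "DIM('a) > 2" using N by simp
  have p: "?p > 0" "?p < 4" using N crit_exp_props(2)[OF N2] by (auto simp: crit_exp_def field_simps)
  obtain V where V: "V \<in> jet_space \<Omega>" "val_inner \<Omega> V V = 1" "grad_inner \<Omega> V V = first_eigenvalue \<Omega>"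
    using first_eigenfunction[OF ne] by metis
  define P where "P = crit_integral \<Omega> V"
  have "\<not> ae_eq \<Omega> (\<lambda>x. fst (V x)) (\<lambda>x. 0)"
    using l2_norm_zero_iff[OF L2_fst_snd(1)[OF jet_space_L2[OF V(1)]]] V(2) by (simp add: val_inner_def l2_norm_def)
  then have P: "P > 0" unfolding P_def by (rule crit_integral_pos[OF V(1) N2])
  \<comment> \<open>The absolute value bounds the quartic coefficient whatever the sign of
    b.\<close>
  define k where "k = \<bar>b / 4 * (first_eigenvalue \<Omega>)\<^sup>2\<bar>"
  \<comment> \<open>t solves (k + 1) t^4 = (P/p) t^p; the summand 1 makes k t^4 strictly smaller
    than the critical term and avoids division by 0.\<close>
  define t where "t = (P / ?p / (k + 1)) powr (1 / (4 - ?p))"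
  have k: "k \<ge> 0" by (simp add: k_def)
  have t: "t > 0" using P p k by (simp add: t_def)
  have tp: "t powr (4 - ?p) = P / ?p / (k + 1)" using P p k by (simp add: t_def powr_powr)
  have "t ^ 4 = t powr (4 - ?p + ?p)" using t by simp
  also have "\<dots> = P / ?p / (k + 1) * t powr ?p" by (simp only: powr_add tp)
  finally have t4: "t ^ 4 = P / ?p / (k + 1) * t powr ?p" .
  have "k * (P / ?p / (k + 1)) < P / ?p"
  proof -
    have "k * (\<kappa> / (k + 1)) < \<kappa>" if "\<kappa> > 0" for \<kappa> using k that by (simp add: field_simps)
    moreover have "P / ?p > 0" using P p by simp
    ultimately show ?thesis by blast
  qed
  then have "k * (P / ?p / (k + 1)) * t powr ?p < P / ?p * t powr ?p"
    using t by (intro mult_strict_right_mono) auto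
  then have kt: "k * t ^ 4 < P / ?p * t powr ?p" by (simp only: t4 mult.assoc)
  have "energy \<Omega> a b lam (\<lambda>x. t *\<^sub>R V x) =
      t\<^sup>2 / 2 * (a * first_eigenvalue \<Omega> - lam) + b / 4 * (first_eigenvalue \<Omega>)\<^sup>2 * t ^ 4 - P / ?p * t powr ?p"
  proof -
    have "energy \<Omega> a b lam (\<lambda>x. t *\<^sub>R V x) =
        a / 2 * (t\<^sup>2 * first_eigenvalue \<Omega>) + b / 4 * (t\<^sup>2 * first_eigenvalue \<Omega>)\<^sup>2 - lam / 2 * t\<^sup>2 - t powr ?p * P / ?p"
      using t by (simp add: energy_def grad_inner_scale val_inner_scale crit_integral_scale V P_def)
    also have "(t\<^sup>2 * first_eigenvalue \<Omega>)\<^sup>2 = (first_eigenvalue \<Omega>)\<^sup>2 * t ^ 4"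
      by (simp add: power_mult_distrib flip: power_mult)
    also have "a / 2 * (t\<^sup>2 * first_eigenvalue \<Omega>) + b / 4 * ((first_eigenvalue \<Omega>)\<^sup>2 * t ^ 4) - lam / 2 * t\<^sup>2 - t powr ?p * P / ?p =
        t\<^sup>2 / 2 * (a * first_eigenvalue \<Omega> - lam) + b / 4 * (first_eigenvalue \<Omega>)\<^sup>2 * t ^ 4 - P / ?p * t powr ?p"
      by (simp add: right_diff_distrib mult_ac)
    finally show ?thesis .
  qed
  also have "t\<^sup>2 / 2 * (a * first_eigenvalue \<Omega> - lam) \<le> 0"
    using assms(3) by (intro mult_nonneg_nonpos) auto
  also have "b / 4 * (first_eigenvalue \<Omega>)\<^sup>2 * t ^ 4 \<le> k * t ^ 4"
    unfolding k_def by (intro mult_right_mono) auto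
  finally have "energy \<Omega> a b lam (\<lambda>x. t *\<^sub>R V x) < 0" using kt by simp
  with jet_space_scale[OF V(1)] show ?thesis by (rule that)
qed

lemma first_eigenvalue_nonneg: "\<Omega> \<noteq> {} \<Longrightarrow> first_eigenvalue \<Omega> \<ge> 0"
  using first_eigenfunction grad_inner_nonneg by metis

end

theorem corollary1p10:
  fixes \<Omega> :: "'a::euclidean_space set" and N :: nat and a b lam :: real
  assumes "N = DIM('a)" and "N \<ge> 5"
    and "open \<Omega>" and "connected \<Omega>" and "\<Omega> \<noteq> {}" and "bounded \<Omega>"
    and "a \<ge> 0" and "b > 0"
    and "a ^ (N - 4) * b\<^sup>2 >
      4 * real (N - 4) ^ (N - 4) / real (N - 2) ^ (N - 2) * sobolev_const \<Omega> powi (- int N)"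
    and "lam \<ge> a * first_eigenvalue \<Omega>"
  shows "\<exists>u1 u2. weak_solution \<Omega> a b lam u1 \<and> weak_solution \<Omega> a b lam u2 \<and>
    \<not> ae_eq \<Omega> u1 (\<lambda>x. 0) \<and> \<not> ae_eq \<Omega> u2 (\<lambda>x. 0) \<and> \<not> ae_eq \<Omega> u1 u2"
proof -
  interpret bounded_open \<Omega> by standard fact+
  have N: "DIM('a) \<ge> 5" "DIM('a) > 2" using assms by auto
  \<comment> \<open>Coercivity is available for lam \<ge> 0, which follows from a \<ge> 0 and the
    sign of the first eigenvalue.\<close>
  have "0 \<le> a * first_eigenvalue \<Omega>" using first_eigenvalue_nonneg assms by simp
  then have lam: "lam \<ge> 0" using assms by linarith
  have thr: "sobolev_const \<Omega> powr (- (crit_exp DIM('a) / 2)) * s powr (crit_exp DIM('a) / 2) / crit_exp DIM('a)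
      \<le> a / 2 * s + b / 4 * s\<^sup>2" if "s \<ge> 0" for s
    using energy_threshold[OF assms(2,7,8) sobolev_const_pos[OF N(2) assms(5)] that assms(9)] by (simp add: assms(1))
  obtain V where V: "V \<in> jet_space \<Omega>" "\<And>U. U \<in> jet_space \<Omega> \<Longrightarrow> energy \<Omega> a b lam V \<le> energy \<Omega> a b lam U"
    using energy_minimizer[OF N(1) assms(5,7,8) lam thr] by metis
  obtain U where "U \<in> jet_space \<Omega>" "energy \<Omega> a b lam U < 0"
    using energy_negative[OF N(1) assms(5,10)] by metis
  then have neg: "energy \<Omega> a b lam V < 0" using V(2) le_less_trans by blast
  let ?V' = "\<lambda>x. (-1) *\<^sub>R V x"
  have "energy \<Omega> a b lam ?V' = energy \<Omega> a b lam V"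
    unfolding energy_def grad_inner_scale val_inner_scale crit_integral_scale by simp
  then have V': "?V' \<in> jet_space \<Omega>" "\<And>U. U \<in> jet_space \<Omega> \<Longrightarrow> energy \<Omega> a b lam ?V' \<le> energy \<Omega> a b lam U"
    using jet_space_scale[OF V(1), of "-1"] V(2) by simp_all
  \<comment> \<open>If V vanished almost everywhere, only the gradient terms of the energy would
    remain, and these are nonnegative.\<close>
  have nz: "\<not> ae_eq \<Omega> (\<lambda>x. fst (V x)) (\<lambda>x. 0)"
  proof
    assume z: "ae_eq \<Omega> (\<lambda>x. fst (V x)) (\<lambda>x. 0)"
    have "val_inner \<Omega> V V = 0"
      using l2_norm_zero_iff[OF L2_fst_snd(1)[OF jet_space_L2[OF V(1)]]] z by (simp add: val_inner_def l2_norm_def)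
    then have "energy \<Omega> a b lam V \<ge> 0" using crit_integral_zero[OF z] assms(7,8) by (simp add: energy_def)
    with neg show False by simp
  qed
  show ?thesis
  proof (intro exI conjI)
    show "weak_solution \<Omega> a b lam (\<lambda>x. fst (V x))" by (rule energy_minimizer_weak_solution[OF N(2) V])
    show "weak_solution \<Omega> a b lam (\<lambda>x. fst (?V' x))" by (rule energy_minimizer_weak_solution[OF N(2) V'])
    show "\<not> ae_eq \<Omega> (\<lambda>x. fst (V x)) (\<lambda>x. 0)" by (rule nz)
    show "\<not> ae_eq \<Omega> (\<lambda>x. fst (?V' x)) (\<lambda>x. 0)" using nz by (simp add: ae_eq_def)
    show "\<not> ae_eq \<Omega> (\<lambda>x. fst (V x)) (\<lambda>x. fst (?V' x))" using nz by (simp add: ae_eq_def)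
  qed
qed

end
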